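(* Let $t\ge 2$ be an integer. For a positive integer $d$, let $F_t(d)$ denote the largest possible value of $\chi(G^t)$, taken over all (finite, simple) graphs $G$ of maximum degree at most $d$ that contain as a subgraph no cycle of length $6$ when $t=2$, and no cycle of length in $\{8,10,\dots,2t+2\}$ when $t\ge 3$. Then $F_t(d)=\Theta(d^t/\log d)$ as $d\to\infty$.
   Context: For a positive integer $t$, the $t$-th power $G^t$ of a simple graph $G=(V,E)$ is the graph on vertex set $V$ in which two distinct vertices are adjacent if and only if there is a path of length at most $t$ between them in $G$. $\chi$ denotes the chromatic number. *)

theory Defs
  imports "Graph_Theory.Pair_Digraph" "HOL-Library.Landau_Symbols"
begin

text \<open>
  Finite simple graphs are the members of the locale \<^locale>\<open>pair_graph\<close>: every edge is
  represented by the two arcs \<open>(u, v)\<close> and \<open>(v, u)\<close>, so that the out-degree of a vertex is its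
  degree.
\<close>

definition graph_power :: "'a pair_pre_digraph \<Rightarrow> nat \<Rightarrow> 'a pair_pre_digraph" where
  "graph_power G t = \<lparr> pverts = pverts G,
     parcs = {(u, v). u \<in> pverts G \<and> v \<in> pverts G \<and> u \<noteq> v \<and>
                (\<exists>p. pre_digraph.apath (with_proj G) u p v \<and> length p \<le> t)} \<rparr>"

definition proper_colouring :: "'a pair_pre_digraph \<Rightarrow> nat \<Rightarrow> ('a \<Rightarrow> nat) \<Rightarrow> bool" where
  "proper_colouring G k f \<longleftrightarrow>
     (\<forall>v \<in> pverts G. f v < k) \<and> (\<forall>(u, v) \<in> parcs G. f u \<noteq> f v)"

definition chromatic_number :: "'a pair_pre_digraph \<Rightarrow> nat" where
  "chromatic_number G = (LEAST k. \<exists>f. proper_colouring G k f)"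

definition max_degree_le :: "'a pair_pre_digraph \<Rightarrow> nat \<Rightarrow> bool" where
  "max_degree_le G d \<longleftrightarrow> (\<forall>v \<in> pverts G. out_degree (with_proj G) v \<le> d)"

text \<open>
  The library's notion of cycle also admits \<open>u, v, u\<close> as a cycle of length 2 in a symmetric
  digraph; for lengths at least 3, the only ones used below, it is the usual notion of a
  (not necessarily induced) cycle of an undirected graph.
\<close>

definition has_cycle_of_length :: "'a pair_pre_digraph \<Rightarrow> nat \<Rightarrow> bool" where
  "has_cycle_of_length G l \<longleftrightarrow> (\<exists>p. pre_digraph.cycle (with_proj G) p \<and> length p = l)"

definition forbidden_lengths :: "nat \<Rightarrow> nat set" where
  "forbidden_lengths t = (if t = 2 then {6} else {l. even l \<and> 8 \<le> l \<and> l \<le> 2 * t + 2})"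

definition admissible :: "nat \<Rightarrow> nat \<Rightarrow> 'a pair_pre_digraph \<Rightarrow> bool" where
  "admissible t d G \<longleftrightarrow> pair_graph G \<and> max_degree_le G d \<and>
     (\<forall>l \<in> forbidden_lengths t. \<not> has_cycle_of_length G l)"

text \<open>
  Every finite graph is isomorphic to one whose vertices are natural numbers, so the vertex
  type \<^typ>\<open>nat\<close> is no restriction.  The maximum is taken over a finite nonempty set:
  see \<open>F_attained\<close> and \<open>F_greatest\<close> below.
\<close>

definition F :: "nat \<Rightarrow> nat \<Rightarrow> nat" where
  "F t d = Max {chromatic_number (graph_power G t) | G :: nat pair_pre_digraph. admissible t d G}"


lemma greedy_colouring:
  assumes "finite V" "sym R" "\<And>v. (v, v) \<notin> R"
    and "\<And>v. v \<in> V \<Longrightarrow> card {u \<in> V. (v, u) \<in> R} \<le> k"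
  shows "\<exists>f :: 'a \<Rightarrow> nat. (\<forall>v \<in> V. f v < Suc k) \<and> (\<forall>u \<in> V. \<forall>v \<in> V. (u, v) \<in> R \<longrightarrow> f u \<noteq> f v)"
  using assms(1,4)
proof (induction V)
  case empty
  then show ?case by simp
next
  case (insert x V)
  have "card {u \<in> V. (v, u) \<in> R} \<le> k" if "v \<in> V" for v
  proof -
    have "card {u \<in> V. (v, u) \<in> R} \<le> card {u \<in> insert x V. (v, u) \<in> R}"
      using insert.hyps by (intro card_mono) auto
    also have "\<dots> \<le> k" using insert.prems that by blast
    finally show ?thesis .
  qed
  from insert.IH[OF this] obtain f :: "'a \<Rightarrow> nat"
    where f: "\<forall>v \<in> V. f v < Suc k" "\<forall>u \<in> V. \<forall>v \<in> V. (u, v) \<in> R \<longrightarrow> f u \<noteq> f v" by blast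
  let ?N = "{u \<in> insert x V. (x, u) \<in> R}"
  have "card (f ` ?N) \<le> card ?N" using insert.hyps by (intro card_image_le) auto
  also have "\<dots> \<le> k" using insert.prems by blast
  also have "\<dots> < card {..<Suc k}" by simp
  finally have "\<not> {..<Suc k} \<subseteq> f ` ?N"
    using insert.hyps card_mono[of "f ` ?N" "{..<Suc k}"] by auto
  then obtain c where c: "c < Suc k" "c \<notin> f ` ?N" by auto
  have "\<forall>v \<in> insert x V. (f(x := c)) v < Suc k" using f(1) c(1) by simp
  moreover have "\<forall>u \<in> insert x V. \<forall>v \<in> insert x V. (u, v) \<in> R \<longrightarrow> (f(x := c)) u \<noteq> (f(x := c)) v"
    using f(2) c(2) assms(2,3) by (auto simp: sym_def)
  ultimately show ?case by blast
qed

lemma card_walk_ends_le: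
  assumes "pair_graph G" "max_degree_le G d" "u \<in> pverts G"
  shows "card {v. \<exists>p. set p \<subseteq> parcs G \<and> pcas u p v \<and> length p = n} \<le> d ^ n"
    and "finite {v. \<exists>p. set p \<subseteq> parcs G \<and> pcas u p v \<and> length p = n}"
  using assms(3)
proof (induction n arbitrary: u)
  case 0
  { case 1 show ?case by simp }
  { case 2 show ?case by simp }
next
  case (Suc n)
  interpret pair_graph G by fact
  let ?B = "\<lambda>n u. {v. \<exists>p. set p \<subseteq> parcs G \<and> pcas u p v \<and> length p = n}"
  let ?N = "\<lambda>u. {e \<in> parcs G. fst e = u}"
  have sub: "?B (Suc n) u \<subseteq> (\<Union>e \<in> ?N u. ?B n (snd e))" for u
    by (auto simp: length_Suc_conv) (metis snd_conv)
  have finN: "finite (?N u)" for u using pair_finite_arcs by simp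
  have in_V: "snd e \<in> pverts G" if "e \<in> ?N u" for u e using that arc_snd_in_verts by blast
  have fin: "finite (\<Union>e \<in> ?N u. ?B n (snd e))" for u
    using finN Suc.IH(2)[OF in_V] by blast
  { case 1
    have "card (?N u) \<le> d"
      using assms(2) 1 by (auto simp: max_degree_le_def out_degree_def out_arcs_def)
    have "card (?B (Suc n) u) \<le> card (\<Union>e \<in> ?N u. ?B n (snd e))"
      by (rule card_mono[OF fin sub])
    also have "\<dots> \<le> (\<Sum>e \<in> ?N u. card (?B n (snd e)))" by (rule card_UN_le[OF finN])
    also have "\<dots> \<le> (\<Sum>e \<in> ?N u. d ^ n)" using Suc.IH(1)[OF in_V] by (intro sum_mono) blast
    also have "\<dots> \<le> d ^ Suc n" using \<open>card (?N u) \<le> d\<close> by simp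
    finally show ?case . }
  { case 2 show ?case using finite_subset[OF sub fin] . }
qed

lemma chromatic_number_graph_power_le:
  assumes "pair_graph G" "max_degree_le G d"
  shows "chromatic_number (graph_power G t) \<le> Suc (\<Sum>n\<le>t. d ^ n)"
proof -
  interpret pair_graph G by fact
  let ?B = "\<lambda>n u. {v. \<exists>p. set p \<subseteq> parcs G \<and> pcas u p v \<and> length p = n}"
  let ?R = "parcs (graph_power G t)"
  have "sym ?R"
  proof (rule symI)
    fix u v assume uv: "(u, v) \<in> ?R"
    then obtain p where p: "apath u p v" "length p \<le> t" by (auto simp: graph_power_def)
    have *: "pcas v (map prod.swap (rev p)) u \<and> set (map prod.swap (rev p)) \<subseteq> parcs G \<and>
        pawalk_verts v (map prod.swap (rev p)) = rev (pawalk_verts u p)"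
      if "pcas u p v" "set p \<subseteq> parcs G" for u p
      using that
    proof (induction p arbitrary: u)
      case (Cons e p)
      have app: "pcas a (xs @ [(b, c)]) c \<and> pawalk_verts a (xs @ [(b, c)]) = pawalk_verts a xs @ [c]"
        if "pcas a xs b" for a b c :: 'a and xs
        using that by (induction xs arbitrary: a) auto
      have IH: "pcas v (map prod.swap (rev p)) (snd e)" "set (map prod.swap (rev p)) \<subseteq> parcs G"
        "pawalk_verts v (map prod.swap (rev p)) = rev (pawalk_verts (snd e) p)"
        using Cons by auto
      have "(fst e, snd e) \<in> parcs G" using Cons.prems by (cases e) auto
      then have "(snd e, fst e) \<in> parcs G"
        using pair_sym_arcs by (auto simp: symmetric_def sym_def)
      moreover have "prod.swap e = (snd e, fst e)" by (simp add: prod.swap_def)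
      ultimately show ?case using app[OF IH(1), of "fst e"] IH Cons.prems by auto
    qed simp
    have "apath v (map prod.swap (rev p)) u"
      using *[of u p] p(1) uv by (auto simp: apath_def awalk_def graph_power_def)
    then show "(v, u) \<in> ?R" using uv p(2)
      by (auto simp: graph_power_def intro!: exI[of _ "map prod.swap (rev p)"])
  qed
  moreover have "card {v \<in> pverts G. (u, v) \<in> ?R} \<le> (\<Sum>n\<le>t. d ^ n)" if "u \<in> pverts G" for u
  proof -
    have "{v \<in> pverts G. (u, v) \<in> ?R} \<subseteq> (\<Union>n\<le>t. ?B n u)"
      by (auto simp: graph_power_def apath_def awalk_def)
    then have "card {v \<in> pverts G. (u, v) \<in> ?R} \<le> card (\<Union>n\<le>t. ?B n u)"
      using card_walk_ends_le(2)[OF assms that] by (intro card_mono) auto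
    also have "\<dots> \<le> (\<Sum>n\<le>t. card (?B n u))" by (rule card_UN_le) simp
    also have "\<dots> \<le> (\<Sum>n\<le>t. d ^ n)"
      using card_walk_ends_le(1)[OF assms that] by (intro sum_mono)
    finally show ?thesis .
  qed
  moreover have "(v, v) \<notin> ?R" for v by (simp add: graph_power_def)
  ultimately obtain f :: "'a \<Rightarrow> nat"
    where "\<forall>v \<in> pverts G. f v < Suc (\<Sum>n\<le>t. d ^ n)"
      "\<forall>u \<in> pverts G. \<forall>v \<in> pverts G. (u, v) \<in> ?R \<longrightarrow> f u \<noteq> f v"
    using greedy_colouring[OF pair_finite_verts, of ?R "\<Sum>n\<le>t. d ^ n"] by blast
  then have "proper_colouring (graph_power G t) (Suc (\<Sum>n\<le>t. d ^ n)) f"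
    by (auto simp: proper_colouring_def graph_power_def)
  then show ?thesis unfolding chromatic_number_def by (blast intro: Least_le)
qed

lemma finite_chromatic_numbers:
  "finite {chromatic_number (graph_power G t) | G :: nat pair_pre_digraph. admissible t d G}"
  by (rule finite_subset[of _ "{..Suc (\<Sum>n\<le>t. d ^ n)}"])
    (auto simp: admissible_def simp del: sum.atMost_Suc intro: chromatic_number_graph_power_le)

lemma F_greatest:
  fixes G :: "nat pair_pre_digraph"
  assumes "admissible t d G"
  shows "chromatic_number (graph_power G t) \<le> F t d"
  unfolding F_def using assms by (intro Max_ge[OF finite_chromatic_numbers]) blast

lemma admissible_empty: "admissible t d \<lparr> pverts = {}, parcs = {} \<rparr>"
proof -
  have "pair_graph \<lparr> pverts = {}, parcs = {} \<rparr>"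
    by unfold_locales (auto simp: symmetric_def sym_def)
  then show ?thesis
    by (auto simp: admissible_def max_degree_le_def has_cycle_of_length_def
        pre_digraph.cycle_def pre_digraph.awalk_def)
qed

lemma F_attained:
  "\<exists>G :: nat pair_pre_digraph. admissible t d G \<and> chromatic_number (graph_power G t) = F t d"
proof -
  have "F t d \<in> {chromatic_number (graph_power G t) | G :: nat pair_pre_digraph. admissible t d G}"
    unfolding F_def using admissible_empty by (intro Max_in[OF finite_chromatic_numbers]) blast
  then show ?thesis by auto
qed

end

theory Submission
  imports Defs "HOL-Library.FuncSet" "HOL-Real_Asymp.Real_Asymp"
begin

text \<open>
  Upper bound.  Let \<open>L\<close> be the set of vertices at distance \<open>t\<close> from \<open>v\<close>.  Closing short paths between
  vertices of \<open>L\<close> through a breadth-first tree shows that the forbidden cycles leave no bipartite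
  subgraph of large minimum degree between \<open>L\<close> and the levels from \<open>t\<close> on.  Hence a neighbourhood of the
  \<open>t\<close>-th power spans only \<open>O(d ^ (2 * t - 1))\<close> of the possible \<open>d ^ (2 * t)\<close> edges.  By the local
  lemma, a random splitting into about \<open>d powr (t - 1 / 3)\<close> classes makes the classes triangle-free
  up to a bounded factor, and a triangle-free graph of maximum degree \<open>\<Delta>\<close> has chromatic number
  \<open>O(\<Delta> / ln \<Delta>)\<close>, by the local lemma for a random proper partial colouring.

  Lower bound.  Start from an almost \<open>D\<close>-regular graph on many vertices without cycles of length at most
  \<open>2 * t + 2\<close> and let \<open>a + 1 + b = t\<close>.  The \<open>a\<close>-spheres, and likewise the \<open>b\<close>-spheres, around
  vertices of a set that is independent in the \<open>t\<close>-th power are disjoint, and no edge joins an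
  \<open>a\<close>-sphere to a \<open>b\<close>-sphere.  Adding edges greedily, each killing an average proportion of the
  sets of size about \<open>n * ln D / D ^ t\<close> that are still independent, destroys all of them while the
  degrees remain \<open>O(D)\<close> and no short cycle arises.
\<close>

section \<open>Walks and cycles in pair graphs\<close>

text \<open>Upper bound: for \<open>d\<close> about \<open>n ^ 12\<close> the classes get degree
  \<open>n ^ 4\<close>, the cube root of \<open>d\<close>. With \<open>O(d ^ (2 * t - 1))\<close>
  edges in a neighbourhood, only \<open>O(1 / n ^ 4)\<close> of them on average fall into the class
  of its centre. Hence \<open>12 * t\<close> disjoint ones are rare enough for the local lemma, and
  fewer disjoint ones admit a bounded cover. Replacing \<open>d\<close> by a fixed power of it
  changes the logarithm only by a constant factor. Lower bound: on \<open>N = s * L\<close> vertices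
  there are at most \<open>(e * L) ^ s\<close> candidate sets of size \<open>s\<close>. A random new
  edge joins the two families of spheres of a given one with probability of order
  \<open>D ^ (t - 1) / L ^ 2\<close>, and bounded degree leaves room for order \<open>N * D\<close>
  edges. The survivors therefore shrink by a factor exponential in \<open>s * D ^ t / L\<close>.
  This beats the entropy \<open>s * ln (e * L)\<close> as long as \<open>L\<close> is at most a
  small multiple of \<open>D ^ t / ln D\<close>, which is where the logarithm comes from. Choosing
  the edges one by one, instead of all at random, avoids having to delete short cycles
  afterwards.\<close>

definition cyc :: "('a \<times> 'a) set \<Rightarrow> 'a list \<Rightarrow> bool" where
  "cyc A xs \<longleftrightarrow> 3 \<le> length xs \<and> distinct xs \<and> successively (\<lambda>x y. (x, y) \<in> A) xs \<and> (last xs, hd xs) \<in> A"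

lemma awalk_of_relpow:
  assumes "pair_graph G" "u \<in> pverts G" "(u, v) \<in> parcs G ^^ n"
  shows "\<exists>p. pre_digraph.awalk (with_proj G) u p v \<and> length p = n"
  using assms(2,3)
proof (induction n arbitrary: u)
  case 0
  interpret pair_graph G by fact
  from 0 show ?case by (auto intro!: exI[of _ "[]"] simp: awalk_Nil_iff)
next
  case (Suc n)
  interpret pair_graph G by fact
  from Suc.prems obtain w where w: "(u, w) \<in> parcs G" "(w, v) \<in> parcs G ^^ n"
    by (meson relpow_Suc_D2)
  then obtain p where "awalk w p v" "length p = n"
    using Suc.IH in_arcsD2 by blast
  then show ?case using w by (auto intro!: exI[of _ "(u, w) # p"] simp: awalk_Cons_iff in_arcsD1)
qed

lemma relpow_of_pcas: "pcas u p v \<Longrightarrow> set p \<subseteq> A \<Longrightarrow> (u, v) \<in> A ^^ length p"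
proof (induction p arbitrary: u)
  case (Cons e p)
  then have "(u, snd e) \<in> A" "(snd e, v) \<in> A ^^ length p" by auto
  then show ?case by (simp del: relpow.simps add: relpow_Suc_I2)
qed simp

text \<open>A shortest walk is a path, since cutting out a closed subwalk shortens it. Adjacency in
  the power thus becomes membership in a relation power, where walks compose freely and distinctness
  need not be tracked.\<close>

lemma short_apath_iff_relpow:
  assumes "pair_graph G" "u \<in> pverts G"
  shows "(\<exists>p. pre_digraph.apath (with_proj G) u p v \<and> length p \<le> t) \<longleftrightarrow>
    (\<exists>n\<le>t. (u, v) \<in> parcs G ^^ n)"
proof
  interpret pair_graph G by fact
  assume "\<exists>p. apath u p v \<and> length p \<le> t"
  then show "\<exists>n\<le>t. (u, v) \<in> parcs G ^^ n"
    by (auto simp: apath_def awalk_def intro: relpow_of_pcas)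
next
  interpret pair_graph G by fact
  assume "\<exists>n\<le>t. (u, v) \<in> parcs G ^^ n"
  then obtain n where n: "n \<le> t" "(u, v) \<in> parcs G ^^ n"
    and min: "\<And>m. m < n \<Longrightarrow> (u, v) \<notin> parcs G ^^ m"
    using exists_least_iff[of "\<lambda>n. n \<le> t \<and> (u, v) \<in> parcs G ^^ n"] by fastforce
  obtain p where p: "awalk u p v" "length p = n"
    using awalk_of_relpow[OF assms n(2)] by blast
  have "distinct (pawalk_verts u p)"
  proof (rule ccontr)
    assume "\<not> ?thesis"
    then obtain q r s w where "p = q @ r @ s" "distinct (pawalk_verts u q)" "r \<noteq> []"
      "awalk u q w" "awalk w r w" "awalk w s v"
      using awalk_not_distinct_decomp[OF p(1)] by blast
    then have "awalk u (q @ s) v" "length (q @ s) < n" using p(2) by auto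
    then show False using min relpow_of_pcas[of u "q @ s" v "parcs G"] by (auto simp: awalk_def)
  qed
  then show "\<exists>p. apath u p v \<and> length p \<le> t" using p n by (auto simp: apath_def)
qed

lemma parcs_graph_power:
  assumes "pair_graph G"
  shows "parcs (graph_power G t) =
    {(u, v). u \<in> pverts G \<and> v \<in> pverts G \<and> u \<noteq> v \<and> (\<exists>n\<le>t. (u, v) \<in> parcs G ^^ n)}"
  by (simp add: graph_power_def short_apath_iff_relpow[OF assms] cong: conj_cong)

lemma pcas_successively:
  "pcas u p v \<Longrightarrow> set p \<subseteq> A \<Longrightarrow>
    successively (\<lambda>x y. (x, y) \<in> A) (pawalk_verts u p) \<and> last (pawalk_verts u p) = v \<and>
    hd (pawalk_verts u p) = u \<and> length (pawalk_verts u p) = Suc (length p)"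
proof (induction p arbitrary: u)
  case (Cons e p)
  then have "successively (\<lambda>x y. (x, y) \<in> A) (pawalk_verts (snd e) p)"
    "last (pawalk_verts (snd e) p) = v" "hd (pawalk_verts (snd e) p) = snd e"
    "length (pawalk_verts (snd e) p) = Suc (length p)" "(u, snd e) \<in> A" "fst e = u" by auto
  then show ?case by (auto simp: successively_Cons)
qed simp

lemma successively_pcas:
  "xs \<noteq> [] \<Longrightarrow> successively (\<lambda>x y. (x, y) \<in> A) xs \<Longrightarrow>
    \<exists>p. pcas (hd xs) p (last xs) \<and> set p \<subseteq> A \<and> pawalk_verts (hd xs) p = xs"
proof (induction xs)
  case (Cons x xs)
  show ?case
  proof (cases "xs = []")
    case True
    then show ?thesis by (auto intro!: exI[of _ "[]"])
  next
    case False
    then obtain p where "pcas (hd xs) p (last xs)" "set p \<subseteq> A" "pawalk_verts (hd xs) p = xs"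
      "(x, hd xs) \<in> A"
      using Cons by (auto simp: successively_Cons)
    then show ?thesis using False by (intro exI[of _ "(x, hd xs) # p"]) auto
  qed
qed simp

text \<open>The vertex list of a library cycle names its base point at both ends; dropping the head
  leaves a cyclic list without repetition, of the same length. The bound 3 keeps out the walk back
  and forth along one edge.\<close>

lemma cyc_of_has_cycle:
  assumes "pair_graph G" "has_cycle_of_length G l" "3 \<le> l"
  shows "\<exists>xs. cyc (parcs G) xs \<and> length xs = l"
proof -
  interpret pair_graph G by fact
  obtain p u where p: "pcas u p u" "set p \<subseteq> parcs G" "distinct (tl (pawalk_verts u p))" "length p = l"
    using assms(2) by (auto simp: has_cycle_of_length_def cycle_def awalk_def)
  let ?xs = "tl (pawalk_verts u p)"
  have w: "successively (\<lambda>x y. (x, y) \<in> parcs G) (pawalk_verts u p)" "last (pawalk_verts u p) = u"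
    "hd (pawalk_verts u p) = u" "length (pawalk_verts u p) = Suc l"
    using pcas_successively[OF p(1,2)] p(4) by auto
  then have eq: "pawalk_verts u p = u # ?xs" and ne: "?xs \<noteq> []"
    using assms(3) by (cases "pawalk_verts u p"; auto)+
  have "cyc (parcs G) ?xs"
    using w p(3) assms(3) ne unfolding cyc_def by (subst (asm) eq, subst (asm) eq) (auto simp: successively_Cons)
  then show ?thesis using w(4) by (intro exI[of _ ?xs]) simp
qed

lemma has_cycle_of_cyc:
  assumes "pair_graph G" "cyc (parcs G) xs"
  shows "has_cycle_of_length G (length xs)"
proof -
  interpret pair_graph G by fact
  let ?u = "last xs"
  have ne: "xs \<noteq> []" using assms(2) by (auto simp: cyc_def)
  have "successively (\<lambda>x y. (x, y) \<in> parcs G) (?u # xs)"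
    using assms(2) ne by (auto simp: cyc_def successively_Cons)
  then obtain p where p: "pcas ?u p ?u" "set p \<subseteq> parcs G" "pawalk_verts ?u p = ?u # xs"
    using successively_pcas[of "?u # xs" "parcs G"] ne by auto
  have "length p = length xs" using pcas_successively[OF p(1,2)] p(3) by auto
  moreover have "cycle p"
    using p assms(2) ne \<open>length p = length xs\<close> in_arcsD1 unfolding cycle_def awalk_def cyc_def
    by (intro exI[of _ ?u]) auto
  ultimately show ?thesis by (auto simp: has_cycle_of_length_def)
qed

lemma out_degree_eq:
  assumes "pair_graph G"
  shows "out_degree (with_proj G) v = card (parcs G `` {v})"
proof -
  have "out_arcs (with_proj G) v = Pair v ` (parcs G `` {v})" by (auto simp: out_arcs_def)
  then show ?thesis unfolding out_degree_def by (simp add: card_image inj_on_def)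
qed

section \<open>The lopsided local lemma\<close>

text \<open>Counting form of the symmetric local lemma. Instead of independence, \<open>cond\<close>
  bounds the proportion of \<open>A i\<close> given that far events fail. This suits uniform
  measures on sets that are not products, such as the proper partial colourings below.\<close>

lemma lopsided_local_lemma:
  fixes \<Omega> :: "'w set" and A :: "'i \<Rightarrow> 'w set" and near :: "'i \<Rightarrow> 'i set" and p :: real
  assumes fin: "finite \<Omega>" "\<Omega> \<noteq> {}" "finite I" and p: "0 \<le> p" "4 * p * real D \<le> 1" "D \<ge> 1"
    and near: "\<And>i. i \<in> I \<Longrightarrow> card (near i \<inter> I) \<le> D"
    and cond: "\<And>i J. i \<in> I \<Longrightarrow> J \<subseteq> I \<Longrightarrow> J \<inter> near i = {} \<Longrightarrow>
      real (card {w \<in> \<Omega>. (\<forall>j \<in> J. w \<notin> A j) \<and> w \<in> A i}) \<le> p * card {w \<in> \<Omega>. \<forall>j \<in> J. w \<notin> A j}"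
  shows "\<exists>w \<in> \<Omega>. \<forall>i \<in> I. w \<notin> A i"
proof -
  define N where "N J = {w \<in> \<Omega>. \<forall>j \<in> J. w \<notin> A j}" for J
  have finN: "finite (N J)" for J using fin(1) by (simp add: N_def)
  \<comment> \<open>The induction bounds the conditional proportion for every \<open>J\<close>, near
    or far, at the price of a factor 2: \<open>cond\<close> deals with the far events, and the near
    ones are paid for in the denominator.\<close>
  have key: "real (card {w \<in> N J. w \<in> A i}) \<le> 2 * p * card (N J)" if "i \<in> I" "J \<subseteq> I" for i J
    using that
  proof (induction "card J" arbitrary: i J rule: less_induct)
    case less
    have finJ: "finite J" using less.prems(2) fin(3) by (rule finite_subset)
    define J1 where "J1 = J \<inter> near i"
    define J2 where "J2 = J - near i"
    have J: "J = J1 \<union> J2" by (auto simp: J1_def J2_def)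
    have le: "real (card {w \<in> N J2. w \<in> A i}) \<le> p * card (N J2)"
      using cond[of i J2] less.prems by (auto simp: N_def J2_def conj_assoc)
    have sub: "{w \<in> N J. w \<in> A i} \<subseteq> {w \<in> N J2. w \<in> A i}" by (auto simp: N_def J)
    have "card {w \<in> N J. w \<in> A i} \<le> card {w \<in> N J2. w \<in> A i}"
      using finN by (intro card_mono sub) auto
    then have 1: "real (card {w \<in> N J. w \<in> A i}) \<le> p * card (N J2)" using le by linarith
    \<comment> \<open>Dropping the near conditions at most doubles the set: by induction each
      excludes a proportion of at most \<open>2 * p\<close>, and
      \<open>D * (2 * p) \<le> 1 / 2\<close>.\<close>
    have 2: "real (card (N J2)) \<le> 2 * card (N J)"
    proof (cases "J1 = {}")
      case True
      then show ?thesis by (simp add: J)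
    next
      case False
      have lt: "card J2 < card J"
        using False finJ by (intro psubset_card_mono) (auto simp: J1_def J2_def)
      have "J1 \<subseteq> near i \<inter> I" using less.prems by (auto simp: J1_def)
      then have c1: "card J1 \<le> D"
        using card_mono[of "near i \<inter> I" J1] near[OF less.prems(1)] fin(3) by auto
      have "N J2 \<subseteq> N J \<union> (\<Union>j\<in>J1. {w \<in> N J2. w \<in> A j})" by (auto simp: N_def J)
      then have "card (N J2) \<le> card (N J \<union> (\<Union>j\<in>J1. {w \<in> N J2. w \<in> A j}))"
        using finN finJ by (intro card_mono) (auto simp: J1_def)
      also have "\<dots> \<le> card (N J) + (\<Sum>j\<in>J1. card {w \<in> N J2. w \<in> A j})"
        using finJ by (intro order_trans[OF card_Un_le] add_mono order_refl card_UN_le) (auto simp: J1_def)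
      finally have "real (card (N J2)) \<le> card (N J) + (\<Sum>j\<in>J1. real (card {w \<in> N J2. w \<in> A j}))"
        by (simp flip: of_nat_sum of_nat_add)
      also have "(\<Sum>j\<in>J1. real (card {w \<in> N J2. w \<in> A j})) \<le> (\<Sum>j\<in>J1. 2 * p * card (N J2))"
        using less.hyps[OF lt] less.prems(2) by (intro sum_mono) (auto simp: J1_def J2_def)
      also have "\<dots> = card J1 * (2 * p * card (N J2))" by simp
      also have "\<dots> \<le> real D * (2 * p * card (N J2))"
        using c1 p by (intro mult_right_mono) auto
      also have "\<dots> = (4 * p * real D) * (card (N J2) / 2)" by simp
      also have "\<dots> \<le> 1 * (card (N J2) / 2)" using p by (intro mult_right_mono) auto
      finally show ?thesis by simp
    qed
    have "p * card (N J2) \<le> p * (2 * card (N J))" using 2 p by (intro mult_left_mono) auto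
    with 1 show ?case by simp
  qed
  have p2: "2 * p \<le> 1 / 2"
  proof -
    have "4 * p * 1 \<le> 4 * p * real D" using p by (intro mult_left_mono) auto
    then show ?thesis using p by simp
  qed
  have "N J \<noteq> {}" if "J \<subseteq> I" for J
    using finite_subset[OF that fin(3)] that
  proof (induction J)
    case empty
    then show ?case using fin by (simp add: N_def)
  next
    case (insert j J)
    have pos: "real (card (N J)) > 0" using insert finN by (simp add: card_gt_0_iff)
    have "card (N J) \<le> card (N (insert j J)) + card {w \<in> N J. w \<in> A j}"
      using fin(1) by (intro order_trans[OF card_mono card_Un_le]) (auto simp: N_def)
    moreover have "real (card {w \<in> N J. w \<in> A j}) \<le> 2 * p * card (N J)"
      using key insert.prems by blast
    moreover have "2 * p * card (N J) \<le> 1 / 2 * card (N J)" using p2 by (intro mult_right_mono) auto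
    ultimately have "real (card (N (insert j J))) > 0" using pos by linarith
    then show ?case by auto
  qed
  from this[of I] show ?thesis by (auto simp: N_def)
qed

text \<open>
  The hypothesis on conditional probabilities is verified by resampling: the event \<open>A i\<close> is unlikely
  even after the values outside of \<open>X i\<close> have been fixed, and these values determine all events
  that are not near \<open>i\<close>.
\<close>

lemma local_lemma_resampling:
  fixes \<Omega> :: "('v \<Rightarrow> 'c) set" and A :: "'i \<Rightarrow> ('v \<Rightarrow> 'c) set" and near :: "'i \<Rightarrow> 'i set"
    and X :: "'i \<Rightarrow> 'v set" and M :: "'i \<Rightarrow> ('v \<Rightarrow> 'c) \<Rightarrow> 'v \<Rightarrow> 'c set" and p :: real
  assumes fin: "finite \<Omega>" "\<Omega> \<noteq> {}" "finite I" and p: "0 \<le> p" "4 * p * real D \<le> 1" "D \<ge> 1"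
    and near: "\<And>i. i \<in> I \<Longrightarrow> card (near i \<inter> I) \<le> D"
    and comb: "\<And>i w f. i \<in> I \<Longrightarrow> w \<in> \<Omega> \<Longrightarrow> f \<in> PiE (X i) (M i w) \<Longrightarrow>
      (\<lambda>x. if x \<in> X i then f x else w x) \<in> \<Omega>"
    and restr: "\<And>i w w' x. i \<in> I \<Longrightarrow> w \<in> \<Omega> \<Longrightarrow> w' \<in> \<Omega> \<Longrightarrow> (\<And>x. x \<notin> X i \<Longrightarrow> w' x = w x) \<Longrightarrow>
      x \<in> X i \<Longrightarrow> w' x \<in> M i w x"
    and prob: "\<And>i w. i \<in> I \<Longrightarrow> w \<in> \<Omega> \<Longrightarrow>
      real (card {f \<in> PiE (X i) (M i w). (\<lambda>x. if x \<in> X i then f x else w x) \<in> A i})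
        \<le> p * card (PiE (X i) (M i w))"
    and inv: "\<And>i j w w'. i \<in> I \<Longrightarrow> j \<in> I \<Longrightarrow> j \<notin> near i \<Longrightarrow> w \<in> \<Omega> \<Longrightarrow> w' \<in> \<Omega> \<Longrightarrow>
      (\<And>x. x \<notin> X i \<Longrightarrow> w' x = w x) \<Longrightarrow> w \<in> A j \<Longrightarrow> w' \<in> A j"
  shows "\<exists>w \<in> \<Omega>. \<forall>i \<in> I. w \<notin> A i"
proof (rule lopsided_local_lemma[OF fin p near])
  fix i J assume i: "i \<in> I" and J: "J \<subseteq> I" "J \<inter> near i = {}"
  define N where "N = {w \<in> \<Omega>. \<forall>j \<in> J. w \<notin> A j}"
  \<comment> \<open>Two configurations share their \<open>\<rho>\<close> exactly when they agree
    outside \<open>X i\<close>. By \<open>inv\<close>, the part of \<open>N\<close> in such a class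
    corresponds to the box \<open>PiE (X i) (M i w)\<close>, so \<open>prob\<close> can be applied
    class by class and summed.\<close>
  define \<rho> where "\<rho> w x = (if x \<in> X i then undefined else w x)" for w :: "'v \<Rightarrow> 'c" and x
  have finN: "finite N" using fin by (simp add: N_def)
  have rho_eq: "\<rho> w = \<rho> w' \<longleftrightarrow> (\<forall>x. x \<notin> X i \<longrightarrow> w x = w' x)" for w w'
    by (auto simp: \<rho>_def fun_eq_iff)
  have cls: "real (card {w \<in> {w \<in> N. w \<in> A i}. \<rho> w = c}) \<le> p * card {w \<in> N. \<rho> w = c}" for c
  proof (cases "\<exists>w \<in> N. \<rho> w = c")
    case True
    then obtain w where w: "w \<in> N" "\<rho> w = c" by blast
    then have w\<Omega>: "w \<in> \<Omega>" by (simp add: N_def)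
    have eqc: "\<rho> w' = c \<longleftrightarrow> (\<forall>x. x \<notin> X i \<longrightarrow> w' x = w x)" for w'
      using rho_eq[of w' w] w(2) by simp
    let ?P = "PiE (X i) (M i w)"
    let ?g = "\<lambda>f x. if x \<in> X i then f x else w x"
    have bij: "bij_betw ?g ?P {w' \<in> N. \<rho> w' = c}"
    proof (rule bij_betw_byWitness[where f' = "\<lambda>w'. restrict w' (X i)"])
      show "\<forall>f\<in>?P. restrict (?g f) (X i) = f"
        by (auto simp: fun_eq_iff restrict_def PiE_def extensional_def)
      show "\<forall>w'\<in>{w' \<in> N. \<rho> w' = c}. ?g (restrict w' (X i)) = w'"
        by (auto simp: eqc intro!: ext)
      show "?g ` ?P \<subseteq> {w' \<in> N. \<rho> w' = c}"
      proof (rule image_subsetI)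
        fix f assume f: "f \<in> ?P"
        have g: "?g f \<in> \<Omega>" using comb[OF i w\<Omega> f] .
        have "?g f \<notin> A j" if "j \<in> J" for j
        proof
          assume "?g f \<in> A j"
          then have "w \<in> A j" using inv[OF i _ _ g w\<Omega>, of j] J that by auto
          then show False using w that by (auto simp: N_def)
        qed
        then show "?g f \<in> {w' \<in> N. \<rho> w' = c}" using g by (simp add: N_def eqc)
      qed
      show "(\<lambda>w'. restrict w' (X i)) ` {w' \<in> N. \<rho> w' = c} \<subseteq> ?P"
      proof (rule image_subsetI)
        fix w' assume "w' \<in> {w' \<in> N. \<rho> w' = c}"
        then have "w' \<in> \<Omega>" "\<And>x. x \<notin> X i \<Longrightarrow> w' x = w x" using eqc[of w'] by (auto simp: N_def)
        then show "restrict w' (X i) \<in> ?P" using restr[OF i w\<Omega>, of w'] by simp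
      qed
    qed
    have "bij_betw ?g {f \<in> ?P. ?g f \<in> A i} {w' \<in> {w' \<in> N. w' \<in> A i}. \<rho> w' = c}"
      using bij by (auto simp: bij_betw_def inj_on_def)
    then have "card {w' \<in> {w' \<in> N. w' \<in> A i}. \<rho> w' = c} = card {f \<in> ?P. ?g f \<in> A i}"
      by (simp add: bij_betw_same_card)
    then show ?thesis using prob[OF i w\<Omega>] bij_betw_same_card[OF bij] by simp
  next
    case False
    then have "{w \<in> {w \<in> N. w \<in> A i}. \<rho> w = c} = {}" by blast
    then show ?thesis using p(1) by (simp only: card.empty) simp
  qed
  have part: "card B = (\<Sum>c\<in>\<rho> ` N. card {w \<in> B. \<rho> w = c})" if "B \<subseteq> N" for B
  proof -
    have "card B = (\<Sum>w\<in>B. 1)" by simp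
    also have "\<dots> = (\<Sum>c\<in>\<rho> ` N. \<Sum>w\<in>{w \<in> B. \<rho> w = c}. 1)"
      using that finN finite_subset[OF that finN] by (intro sum.group[symmetric]) auto
    finally show ?thesis by simp
  qed
  have "real (card {w \<in> N. w \<in> A i}) = (\<Sum>c\<in>\<rho> ` N. real (card {w \<in> {w \<in> N. w \<in> A i}. \<rho> w = c}))"
    using part[of "{w \<in> N. w \<in> A i}"] by simp
  also have "\<dots> \<le> (\<Sum>c\<in>\<rho> ` N. p * card {w \<in> N. \<rho> w = c})" by (intro sum_mono cls)
  also have "\<dots> = p * card N" using part[of N] by (simp add: sum_distrib_left)
  finally show "real (card {w \<in> \<Omega>. (\<forall>j\<in>J. w \<notin> A j) \<and> w \<in> A i})
      \<le> p * real (card {w \<in> \<Omega>. \<forall>j\<in>J. w \<notin> A j})"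
    by (simp add: N_def conj_assoc)
qed

text \<open>\<open>b ^ b / fact b\<close> is a single term of the exponential series at
  \<open>b\<close>.\<close>

lemma binomial_le_exp: 
  assumes "b > 0"
  shows "real (m choose b) \<le> (exp 1 * m / b) ^ b"
proof -
  have "real b ^ b / fact b \<le> exp (real b)"
  proof -
    have "(\<lambda>n. real b ^ n / fact n) sums exp (real b)"
      using exp_converges[of "real b"] by (simp add: field_simps scaleR_conv_of_real)
    then have "(\<Sum>n\<in>{b}. real b ^ n / fact n) \<le> exp (real b)"
      by (metis (mono_tags, lifting) sums_iff sum_le_suminf finite.simps fact_ge_zero
          of_nat_0_le_iff divide_nonneg_nonneg zero_le_power)
    then show ?thesis by simp
  qed
  moreover have "exp (real b) = exp 1 ^ b" using exp_of_nat_mult[of b "1::real"] by simp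
  ultimately have f: "real b ^ b \<le> exp 1 ^ b * fact b"
    by (simp add: divide_le_eq)
  have "real (m choose b) * fact b \<le> real m ^ b"
    using binomial_fact_pow[of m b] by (metis of_nat_fact of_nat_le_iff of_nat_mult of_nat_power)
  then have "real (m choose b) * fact b * real b ^ b \<le> real m ^ b * (exp 1 ^ b * fact b)"
    using f by (intro mult_mono) auto
  then have "(real (m choose b) * real b ^ b) * fact b \<le> (real m ^ b * exp 1 ^ b) * fact b"
    by (simp only: ac_simps)
  then have "real (m choose b) * real b ^ b \<le> real m ^ b * exp 1 ^ b"
    by (rule mult_right_le_imp_le) simp
  then have "real (m choose b) \<le> real m ^ b * exp 1 ^ b / real b ^ b"
    using assms by (simp add: pos_le_divide_eq)
  then show ?thesis by (simp add: power_mult_distrib power_divide mult.commute)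
qed

section \<open>Colouring triangle-free graphs\<close>

text \<open>Expected number of colours of \<open>C\<close> used nowhere on \<open>U\<close> when
  each \<open>u\<close> picks uniformly and independently among \<open>M u\<close> and one blank;
  the \<open>+ 1\<close> counts the blank.\<close>

definition missed_weight :: "('v \<Rightarrow> 'c set) \<Rightarrow> 'v set \<Rightarrow> 'c set \<Rightarrow> real" where
  "missed_weight M U C = (\<Sum>c\<in>C. \<Prod>u\<in>{u \<in> U. c \<in> M u}. 1 - 1 / (real (card (M u)) + 1))"

text \<open>An exponential moment, found by revealing one vertex at a time. The choice
  \<open>c\<close> at \<open>u\<close> lowers the weight by \<open>w c\<close>, whereas the weight
  for \<open>insert u U\<close> is lower by the mean \<open>S / ?m\<close>; the fluctuation costs
  one factor \<open>exp (\<theta>\<^sup>2)\<close> per vertex.\<close>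

lemma sum_exp_missed_le:
  fixes M :: "'v \<Rightarrow> 'c set" and \<theta> :: real
  assumes "finite U" "finite C" "\<And>u. u \<in> U \<Longrightarrow> finite (M u)" "k \<notin> C" "\<And>u. u \<in> U \<Longrightarrow> k \<notin> M u"
    and \<theta>: "0 \<le> \<theta>" "\<theta> \<le> 1"
  shows "(\<Sum>f\<in>PiE U (\<lambda>u. insert k (M u)). exp (- \<theta> * card (C - f ` U)))
    \<le> card (PiE U (\<lambda>u. insert k (M u))) * exp (\<theta>\<^sup>2 * card U - \<theta> * missed_weight M U C)"
  using assms(1-5)
proof (induction U arbitrary: C)
  case empty
  then show ?case by (simp add: missed_weight_def)
next
  case (insert u U)
  let ?P = "PiE U (\<lambda>u. insert k (M u))"
  let ?m = "real (card (M u)) + 1"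
  \<comment> \<open>\<open>w c\<close> is the probability that all of \<open>U\<close> miss
    \<open>c\<close>. It is 0 off \<open>C\<close>, so that choosing blank or a colour outside
    \<open>C\<close> leaves the weight alone, as \<open>W1\<close> demands.\<close>
  define w where "w c = (if c \<in> C then \<Prod>x\<in>{x \<in> U. c \<in> M x}. 1 - 1 / (real (card (M x)) + 1) else 0)" for c
  define S where "S = (\<Sum>c\<in>M u. w c)"
  have w01: "0 \<le> w c" "w c \<le> 1" for c
    by (auto simp: w_def intro!: prod_nonneg prod_le_1)
  have W1: "missed_weight M U (C - {c}) = missed_weight M U C - w c" for c
    using insert.prems(1) by (auto simp: missed_weight_def w_def sum_diff1 add.commute)
  have W2: "missed_weight M (insert u U) C = missed_weight M U C - S / ?m"
  proof -
    have *: "(\<Prod>x\<in>{x \<in> insert u U. c \<in> M x}. 1 - 1 / (real (card (M x)) + 1)) =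
        w c - (if c \<in> M u then w c / ?m else 0)" if "c \<in> C" for c
    proof (cases "c \<in> M u")
      case True
      then have "{x \<in> insert u U. c \<in> M x} = insert u {x \<in> U. c \<in> M x}" by auto
      then show ?thesis using True insert.hyps that by (simp add: w_def field_simps)
    next
      case False
      then have "{x \<in> insert u U. c \<in> M x} = {x \<in> U. c \<in> M x}" by auto
      then show ?thesis using False that by (simp add: w_def)
    qed
    have "missed_weight M (insert u U) C = (\<Sum>c\<in>C. w c - (if c \<in> M u then w c / ?m else 0))"
      unfolding missed_weight_def by (intro sum.cong refl *)
    also have "\<dots> = (\<Sum>c\<in>C. w c) - (\<Sum>c\<in>C \<inter> M u. w c / ?m)"
      using insert.prems(1) by (simp add: sum_subtractf sum.inter_restrict)
    also have "(\<Sum>c\<in>C. w c) = missed_weight M U C" by (simp add: missed_weight_def w_def)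
    also have "(\<Sum>c\<in>C \<inter> M u. w c / ?m) = (\<Sum>c\<in>M u. w c / ?m)"
      using insert.prems(2) by (intro sum.mono_neutral_left) (auto simp: w_def)
    also have "\<dots> = S / ?m" by (simp add: S_def sum_divide_distrib)
    finally show ?thesis .
  qed
  have step: "(\<Sum>g\<in>?P. exp (- \<theta> * card (C - (g(u := c)) ` insert u U))) \<le>
      card ?P * exp (\<theta>\<^sup>2 * card U - \<theta> * missed_weight M U C) * exp (\<theta> * w c)" for c
  proof -
    have "C - (g(u := c)) ` insert u U = (C - {c}) - g ` U" for g :: "'v \<Rightarrow> 'c"
      using insert.hyps(2) by auto
    then have "(\<Sum>g\<in>?P. exp (- \<theta> * card (C - (g(u := c)) ` insert u U)))
      = (\<Sum>g\<in>?P. exp (- \<theta> * card ((C - {c}) - g ` U)))" by simp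
    also have "\<dots> \<le> card ?P * exp (\<theta>\<^sup>2 * card U - \<theta> * missed_weight M U (C - {c}))"
      using insert.prems by (intro insert.IH) auto
    also have "\<dots> = card ?P * exp (\<theta>\<^sup>2 * card U - \<theta> * missed_weight M U C) * exp (\<theta> * w c)"
      by (simp add: W1 algebra_simps flip: exp_add)
    finally show ?thesis .
  qed
  have fM: "finite (M u)" "k \<notin> M u" using insert.prems by auto
  have choice: "(\<Sum>c\<in>insert k (M u). exp (\<theta> * w c)) \<le> ?m * exp (\<theta> * S / ?m + \<theta>\<^sup>2)"
  proof -
    have "(\<Sum>c\<in>insert k (M u). exp (\<theta> * w c)) \<le> (\<Sum>c\<in>insert k (M u). 1 + \<theta> * w c + \<theta>\<^sup>2)"
    proof (intro sum_mono)
      fix c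
      have t: "0 \<le> \<theta> * w c" "\<theta> * w c \<le> \<theta>" using \<theta> w01[of c] by (auto simp: mult_left_le)
      then have "exp (\<theta> * w c) \<le> 1 + \<theta> * w c + (\<theta> * w c)\<^sup>2" using \<theta> by (intro exp_bound) auto
      also have "(\<theta> * w c)\<^sup>2 \<le> \<theta>\<^sup>2" using t by (intro power_mono) auto
      finally show "exp (\<theta> * w c) \<le> 1 + \<theta> * w c + \<theta>\<^sup>2" by simp
    qed
    also have "\<dots> = ?m + \<theta> * S + ?m * \<theta>\<^sup>2"
      using fM insert.prems(3) by (simp add: sum.distrib S_def sum_distrib_left w_def algebra_simps)
    also have "\<dots> = ?m * (1 + (\<theta> * S / ?m + \<theta>\<^sup>2))" by (simp add: field_simps)
    also have "\<dots> \<le> ?m * exp (\<theta> * S / ?m + \<theta>\<^sup>2)"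
      by (intro mult_left_mono exp_ge_add_one_self) auto
    finally show ?thesis .
  qed
  have "(\<Sum>f\<in>PiE (insert u U) (\<lambda>u. insert k (M u)). exp (- \<theta> * card (C - f ` insert u U)))
    = (\<Sum>(c, g)\<in>insert k (M u) \<times> ?P. exp (- \<theta> * card (C - (g(u := c)) ` insert u U)))"
  proof -
    have "U \<inter> {u} = {}" using insert.hyps(2) by simp
    then show ?thesis
      unfolding PiE_insert_eq
      by (subst sum.reindex[OF inj_combinator[OF insert.hyps(2)]]) (simp add: case_prod_unfold)
  qed
  also have "\<dots> = (\<Sum>c\<in>insert k (M u). \<Sum>g\<in>?P. exp (- \<theta> * card (C - (g(u := c)) ` insert u U)))"
    by (simp only: sum.cartesian_product)
  also have "\<dots> \<le> (\<Sum>c\<in>insert k (M u). card ?P * exp (\<theta>\<^sup>2 * card U - \<theta> * missed_weight M U C) * exp (\<theta> * w c))"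
    by (intro sum_mono step)
  also have "\<dots> = card ?P * exp (\<theta>\<^sup>2 * card U - \<theta> * missed_weight M U C) * (\<Sum>c\<in>insert k (M u). exp (\<theta> * w c))"
    by (simp only: sum_distrib_left)
  also have "\<dots> \<le> card ?P * exp (\<theta>\<^sup>2 * card U - \<theta> * missed_weight M U C) * (?m * exp (\<theta> * S / ?m + \<theta>\<^sup>2))"
    by (intro mult_left_mono choice) auto
  also have "card ?P * exp (\<theta>\<^sup>2 * card U - \<theta> * missed_weight M U C) * (?m * exp (\<theta> * S / ?m + \<theta>\<^sup>2))
    = (?m * card ?P) * exp (\<theta>\<^sup>2 * card (insert u U) - \<theta> * missed_weight M (insert u U) C)"
    using insert.hyps by (simp add: W2 algebra_simps flip: exp_add)
  also have "?m * card ?P = card (PiE (insert u U) (\<lambda>u. insert k (M u)))"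
    using insert.hyps fM by (simp add: card_PiE algebra_simps)
  finally show ?case .
qed

text \<open>Markov's inequality for \<open>exp (- \<theta> * X)\<close>, where \<open>X\<close>
  counts the missed colours.\<close>

lemma card_few_missed_le:
  fixes M :: "'v \<Rightarrow> 'c set" and \<theta> :: real
  assumes "finite U" "finite C" "\<And>u. u \<in> U \<Longrightarrow> finite (M u)" "k \<notin> C" "\<And>u. u \<in> U \<Longrightarrow> k \<notin> M u"
    and \<theta>: "0 \<le> \<theta>" "\<theta> \<le> 1"
  shows "real (card {f \<in> PiE U (\<lambda>u. insert k (M u)). card (C - f ` U) < l})
    \<le> exp (\<theta>\<^sup>2 * card U - \<theta> * (missed_weight M U C - l)) * card (PiE U (\<lambda>u. insert k (M u)))"
proof -
  let ?P = "PiE U (\<lambda>u. insert k (M u))"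
  let ?B = "{f \<in> ?P. card (C - f ` U) < l}"
  have fin: "finite ?P" using assms by (intro finite_PiE) auto
  have "card ?B * exp (- \<theta> * l) = (\<Sum>f\<in>?B. exp (- \<theta> * l))" by simp
  also have "\<dots> \<le> (\<Sum>f\<in>?B. exp (- \<theta> * card (C - f ` U)))"
    using \<theta> by (intro sum_mono) (auto intro!: mult_left_mono)
  also have "\<dots> \<le> (\<Sum>f\<in>?P. exp (- \<theta> * card (C - f ` U)))"
    using fin by (intro sum_mono2) auto
  also have "\<dots> \<le> card ?P * exp (\<theta>\<^sup>2 * card U - \<theta> * missed_weight M U C)"
    by (rule sum_exp_missed_le[OF assms])
  finally have "card ?B * exp (- \<theta> * l) * exp (\<theta> * l)
      \<le> card ?P * exp (\<theta>\<^sup>2 * card U - \<theta> * missed_weight M U C) * exp (\<theta> * l)"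
    by (rule mult_right_mono) simp
  moreover have "exp (- \<theta> * l) * exp (\<theta> * l) = 1" by (simp flip: exp_add)
  moreover have "exp (\<theta>\<^sup>2 * card U - \<theta> * missed_weight M U C) * exp (\<theta> * l)
      = exp (\<theta>\<^sup>2 * card U - \<theta> * (missed_weight M U C - l))"
    by (simp add: algebra_simps flip: exp_add)
  ultimately show ?thesis by (simp only: mult.assoc mult_1_right) (simp only: mult.commute)
qed

text \<open>Each factor \<open>1 - x\<close> has \<open>x \<le> 1 / 2\<close> and is at least
  \<open>exp (- 2 * x)\<close>. Every \<open>u\<close> contributes at most 1 to the sum of the
  \<open>s c\<close> over all colours, and convexity replaces the \<open>s c\<close> by the bound
  \<open>\<mu>\<close> on their mean.\<close>

lemma missed_weight_ge:
  assumes "finite U" "finite C" "\<And>u. u \<in> U \<Longrightarrow> finite (M u)" "\<And>u. u \<in> U \<Longrightarrow> M u \<subseteq> C"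
    and "card U \<le> \<Delta>" "C \<noteq> {}"
  shows "missed_weight M U C \<ge> card C * exp (- 2 * real \<Delta> / card C)"
proof -
  define s where "s c = (\<Sum>u\<in>{u \<in> U. c \<in> M u}. 1 / (real (card (M u)) + 1))" for c
  define \<mu> where "\<mu> = \<Delta> / card C"
  have C0: "card C > 0" using assms by (simp add: card_gt_0_iff)
  have "(\<Sum>c\<in>C. s c) = (\<Sum>c\<in>C. \<Sum>u\<in>U. if c \<in> M u then 1 / (real (card (M u)) + 1) else 0)"
    unfolding s_def using assms(1) by (simp add: sum.inter_filter)
  also have "\<dots> = (\<Sum>u\<in>U. \<Sum>c\<in>C. if c \<in> M u then 1 / (real (card (M u)) + 1) else 0)"
    by (rule sum.swap)
  also have "\<dots> \<le> (\<Sum>u\<in>U. 1)"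
  proof (intro sum_mono)
    fix u assume u: "u \<in> U"
    have "(\<Sum>c\<in>C. if c \<in> M u then 1 / (real (card (M u)) + 1) else 0)
        = (\<Sum>c\<in>C \<inter> M u. 1 / (real (card (M u)) + 1))"
      by (simp only: sum.inter_restrict[OF assms(2)])
    also have "C \<inter> M u = M u" using assms(4)[OF u] by auto
    finally show "(\<Sum>c\<in>C. if c \<in> M u then 1 / (real (card (M u)) + 1) else 0) \<le> 1" by simp
  qed
  also have "\<dots> \<le> \<Delta>" using assms(5) by simp
  finally have S: "(\<Sum>c\<in>C. s c) \<le> \<Delta>" .
  \<comment> \<open>Jensen's inequality, read off from the tangent of the exponential at
    \<open>- 2 * \<mu>\<close>.\<close>
  have "card C * exp (- 2 * \<mu>) \<le> exp (- 2 * \<mu>) * (card C + 2 * (\<mu> * card C - (\<Sum>c\<in>C. s c)))"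
    using S C0 by (simp add: \<mu>_def field_simps)
  also have "\<dots> = (\<Sum>c\<in>C. exp (- 2 * \<mu>) * (1 + (2 * \<mu> - 2 * s c)))"
    by (simp add: sum_distrib_left[symmetric] sum.distrib sum_subtractf)
  also have "\<dots> \<le> (\<Sum>c\<in>C. exp (- 2 * \<mu>) * exp (2 * \<mu> - 2 * s c))"
    by (intro sum_mono mult_left_mono exp_ge_add_one_self) auto
  also have "\<dots> = (\<Sum>c\<in>C. exp (- 2 * s c))" by (simp flip: exp_add)
  also have "\<dots> \<le> missed_weight M U C"
    unfolding missed_weight_def
  proof (intro sum_mono)
    fix c
    have "exp (- 2 * s c) = (\<Prod>u\<in>{u \<in> U. c \<in> M u}. exp (- 2 * (1 / (real (card (M u)) + 1))))"
      using assms(1) by (simp add: s_def sum_distrib_left flip: exp_sum)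
    also have "\<dots> \<le> (\<Prod>u\<in>{u \<in> U. c \<in> M u}. 1 - 1 / (real (card (M u)) + 1))"
    proof (intro prod_mono conjI)
      fix u assume u: "u \<in> {u \<in> U. c \<in> M u}"
      define x where "x = 1 / (real (card (M u)) + 1)"
      have "card (M u) \<ge> 1" using u assms(3)[of u] by (auto simp: Suc_le_eq card_gt_0_iff)
      then have x: "0 \<le> x" "x \<le> 1 / 2" by (auto simp: x_def field_simps)
      have "2 * x\<^sup>2 \<le> x" using mult_right_mono[of "2 * x" 1 x] x by (simp add: power2_eq_square)
      then have "- 2 * x \<le> ln (1 - x)" using ln_one_minus_pos_lower_bound[OF x] by simp
      then have "exp (- 2 * x) \<le> 1 - x" using x by (subst ln_ge_iff[symmetric]) auto
      then show "exp (- 2 * (1 / (real (card (M u)) + 1))) \<le> 1 - 1 / (real (card (M u)) + 1)"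
        by (simp add: x_def)
    qed auto
    finally show "exp (- 2 * s c) \<le> (\<Prod>u\<in>{u \<in> U. c \<in> M u}. 1 - 1 / (real (card (M u)) + 1))" .
  qed
  finally show ?thesis by (simp add: \<mu>_def)
qed

text \<open>Union bound over the \<open>l\<close>-sets of vertices with at least \<open>l\<close>
  colours to choose from: each of these is blank with probability below \<open>1 / l\<close>,
  independently of the others.\<close>

lemma card_many_blank_le:
  fixes M :: "'v \<Rightarrow> 'c set"
  assumes "finite U" "\<And>u. u \<in> U \<Longrightarrow> finite (M u)" "\<And>u. u \<in> U \<Longrightarrow> k \<notin> M u" "l > 0" "card U \<le> \<Delta>"
  shows "real (card {f \<in> PiE U (\<lambda>u. insert k (M u)). l \<le> card {u \<in> U. f u = k \<and> l \<le> card (M u)}})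
    \<le> (exp 1 * \<Delta> / (real l)\<^sup>2) ^ l * card (PiE U (\<lambda>u. insert k (M u)))"
proof -
  let ?P = "PiE U (\<lambda>u. insert k (M u))"
  let ?U = "{u \<in> U. l \<le> card (M u)}"
  let ?F = "{T. T \<subseteq> ?U \<and> card T = l}"
  have fin: "finite ?P" using assms by (intro finite_PiE) auto
  have finF: "finite ?F" using assms(1) by simp
  have sub: "{f \<in> ?P. l \<le> card {u \<in> U. f u = k \<and> l \<le> card (M u)}}
      \<subseteq> (\<Union>T\<in>?F. {f \<in> ?P. \<forall>u\<in>T. f u = k})"
  proof
    fix f assume f: "f \<in> {f \<in> ?P. l \<le> card {u \<in> U. f u = k \<and> l \<le> card (M u)}}"
    then obtain T where "T \<subseteq> {u \<in> U. f u = k \<and> l \<le> card (M u)}" "card T = l"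
      using obtain_subset_with_card_n[of l "{u \<in> U. f u = k \<and> l \<le> card (M u)}"] by blast
    then show "f \<in> (\<Union>T\<in>?F. {f \<in> ?P. \<forall>u\<in>T. f u = k})" using f by blast
  qed
  have each: "real (card {f \<in> ?P. \<forall>u\<in>T. f u = k}) \<le> card ?P / real l ^ l" if T: "T \<in> ?F" for T
  proof -
    have "{f \<in> ?P. \<forall>u\<in>T. f u = k} \<subseteq> PiE U (\<lambda>u. if u \<in> T then {k} else insert k (M u))"
      by (auto simp: PiE_def Pi_def extensional_def)
    then have "card {f \<in> ?P. \<forall>u\<in>T. f u = k} \<le> card (PiE U (\<lambda>u. if u \<in> T then {k} else insert k (M u)))"
      using assms by (intro card_mono finite_PiE) auto
    also have "\<dots> = (\<Prod>u\<in>U. if u \<in> T then 1 else card (insert k (M u)))"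
      using assms by (subst card_PiE) (auto intro!: prod.cong)
    finally have 1: "card {f \<in> ?P. \<forall>u\<in>T. f u = k} \<le> (\<Prod>u\<in>U. if u \<in> T then 1 else card (insert k (M u)))" .
    have "l ^ l = (\<Prod>u\<in>U. if u \<in> T then l else 1)"
    proof -
      have "U \<inter> T = T" using T by auto
      then show ?thesis using T assms(1) by (simp add: prod.inter_restrict[symmetric])
    qed
    then have "card {f \<in> ?P. \<forall>u\<in>T. f u = k} * l ^ l
      \<le> (\<Prod>u\<in>U. if u \<in> T then 1 else card (insert k (M u))) * (\<Prod>u\<in>U. if u \<in> T then l else 1)"
      using 1 by simp
    also have "\<dots> = (\<Prod>u\<in>U. (if u \<in> T then 1 else card (insert k (M u))) * (if u \<in> T then l else 1))"
      by (simp only: prod.distrib)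
    also have "\<dots> \<le> (\<Prod>u\<in>U. card (insert k (M u)))"
      using T assms(2,3) by (intro prod_mono) auto
    also have "\<dots> = card ?P" using assms by (simp add: card_PiE)
    finally have "real (card {f \<in> ?P. \<forall>u\<in>T. f u = k}) * real l ^ l \<le> card ?P"
      using of_nat_mono[where 'a = real] by fastforce
    then show ?thesis using assms(4) by (simp add: pos_le_divide_eq)
  qed
  have "real (card {f \<in> ?P. l \<le> card {u \<in> U. f u = k \<and> l \<le> card (M u)}})
      \<le> card (\<Union>T\<in>?F. {f \<in> ?P. \<forall>u\<in>T. f u = k})"
    using fin finF by (intro of_nat_mono card_mono sub) auto
  also have "\<dots> \<le> (\<Sum>T\<in>?F. real (card {f \<in> ?P. \<forall>u\<in>T. f u = k}))"
    using card_UN_le[OF finF] by (simp flip: of_nat_sum)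
  also have "\<dots> \<le> (\<Sum>T\<in>?F. card ?P / real l ^ l)" by (intro sum_mono each)
  also have "\<dots> = (card ?U choose l) * (card ?P / real l ^ l)"
    using assms(1) by (simp add: n_subsets)
  also have "\<dots> \<le> (\<Delta> choose l) * (card ?P / real l ^ l)"
  proof -
    have "card ?U \<le> \<Delta>" using assms(1,5) card_mono[of U ?U] by auto
    then show ?thesis by (intro mult_right_mono of_nat_mono binomial_right_mono) auto
  qed
  also have "\<dots> \<le> (exp 1 * \<Delta> / l) ^ l * (card ?P / real l ^ l)"
    using binomial_le_exp[OF assms(4)] by (intro mult_right_mono) auto
  also have "\<dots> = (exp 1 * \<Delta> / (real l)\<^sup>2) ^ l * card ?P"
    by (simp add: power_divide power2_eq_square power_mult_distrib)
  finally show ?thesis .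
qed

lemma greedy_list_colouring:
  assumes "finite B" "sym R" "\<And>v. (v, v) \<notin> R"
    and "\<And>v. v \<in> B \<Longrightarrow> card {u \<in> B. (v, u) \<in> R} < card (\<Lambda> v)"
  shows "\<exists>f. (\<forall>v\<in>B. f v \<in> \<Lambda> v) \<and> (\<forall>u\<in>B. \<forall>v\<in>B. (u, v) \<in> R \<longrightarrow> f u \<noteq> f v)"
  using assms(1,4)
proof (induction B)
  case (insert x B)
  have "card {u \<in> B. (v, u) \<in> R} < card (\<Lambda> v)" if "v \<in> B" for v
  proof -
    have "card {u \<in> B. (v, u) \<in> R} \<le> card {u \<in> insert x B. (v, u) \<in> R}"
      using insert.hyps by (intro card_mono) auto
    then show ?thesis using insert.prems[of v] that by simp
  qed
  then obtain f where f: "\<forall>v\<in>B. f v \<in> \<Lambda> v" "\<forall>u\<in>B. \<forall>v\<in>B. (u, v) \<in> R \<longrightarrow> f u \<noteq> f v"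
    using insert.IH by blast
  let ?N = "{u \<in> insert x B. (x, u) \<in> R}"
  have "card (f ` ?N) < card (\<Lambda> x)"
    using insert.prems[of x] card_image_le[of ?N f] insert.hyps by simp
  then have "\<not> \<Lambda> x \<subseteq> f ` ?N" using insert.hyps card_mono[of "f ` ?N" "\<Lambda> x"] by auto
  then obtain c where c: "c \<in> \<Lambda> x" "c \<notin> f ` ?N" by blast
  have "(\<forall>v\<in>insert x B. (f(x := c)) v \<in> \<Lambda> v) \<and>
      (\<forall>u\<in>insert x B. \<forall>v\<in>insert x B. (u, v) \<in> R \<longrightarrow> (f(x := c)) u \<noteq> (f(x := c)) v)"
    using f c assms(2,3) by (auto simp: sym_def)
  then show ?case by blast
qed simp

lemma card_Image_le:
  assumes "finite S" "\<And>v. v \<in> S \<Longrightarrow> card (R `` {v}) \<le> \<Delta>"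
  shows "card (R `` S) \<le> card S * \<Delta>"
proof -
  have "R `` S = (\<Union>v\<in>S. R `` {v})" by auto
  then have "card (R `` S) \<le> (\<Sum>v\<in>S. card (R `` {v}))" using card_UN_le[OF assms(1)] by simp
  also have "\<dots> \<le> (\<Sum>v\<in>S. \<Delta>)" by (intro sum_mono assms(2))
  finally show ?thesis by simp
qed

text \<open>
  Take a random proper partial colouring, with \<open>k\<close> playing the role of ``blank''.  Given the colours
  outside the neighbourhood of \<open>v\<close>, which is independent, its vertices choose independently and
  uniformly among their available colours and blank.  So almost surely many colours remain available
  at \<open>v\<close> and few neighbours with many available colours are blank; by the local lemma some partial
  colouring has these properties everywhere and is completed greedily.
\<close>

lemma triangle_free_colouring_aux:
  fixes R :: "('v \<times> 'v) set" and n k :: nat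
  assumes V: "finite V" "R \<subseteq> V \<times> V" and sym: "sym R" and irr: "\<And>v. (v, v) \<notin> R"
    and tri: "\<And>x y z. (x, y) \<in> R \<Longrightarrow> (y, z) \<in> R \<Longrightarrow> (x, z) \<notin> R"
    and deg: "\<And>v. v \<in> V \<Longrightarrow> card (R `` {v}) \<le> n ^ 4"
    and n: "n \<ge> 1" and k: "k > 0"
    and W: "real k * exp (- 2 * real n ^ 4 / k) \<ge> 2 * real n ^ 3"
    and p: "4 * (exp (- (real n ^ 2) / 4) + (exp 1 / (real n)\<^sup>2) ^ (n ^ 3)) * (2 * n ^ 12) \<le> 1"
  shows "\<exists>f :: 'v \<Rightarrow> nat. (\<forall>v\<in>V. f v < k) \<and> (\<forall>(u, v)\<in>R. f u \<noteq> f v)"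
proof -
  define l where "l = n ^ 3"
  define N where "N v = R `` {v}" for v
  have N_V: "N v \<subseteq> V" for v using V by (auto simp: N_def)
  have finN: "finite (N v)" for v using N_V V(1) by (rule finite_subset)
  have N_sym: "u \<in> N v \<longleftrightarrow> v \<in> N u" for u v using sym by (auto simp: N_def sym_def)
  have N_tri: "N u \<inter> N v = {}" if "u \<in> N v" for u v using that tri by (auto simp: N_def)
  have cardN: "card (N v) \<le> n ^ 4" for v
  proof (cases "v \<in> V")
    case False
    then have "R `` {v} = {}" using V(2) by auto
    then show ?thesis by (simp add: N_def)
  qed (simp add: N_def deg)
  define \<Omega> where "\<Omega> = {\<phi> \<in> PiE V (\<lambda>_. {..k}). \<forall>(u, v)\<in>R. \<phi> u = \<phi> v \<longrightarrow> \<phi> u = k}"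
  define L where "L \<phi> v = {..<k} - \<phi> ` N v" for \<phi> :: "'v \<Rightarrow> nat" and v
  \<comment> \<open>If both alternatives fail everywhere, each blank vertex has at least
    \<open>l\<close> available colours but fewer than \<open>l\<close> blank neighbours, which is
    what the greedy completion needs.\<close>
  define A where "A v = {\<phi>. card (L \<phi> v) < l \<or> l \<le> card {u \<in> N v. \<phi> u = k \<and> l \<le> card (L \<phi> u)}}" for v
  define M where "M v \<phi> u = insert k (L \<phi> u)" for v :: 'v and \<phi> u
  \<comment> \<open>\<open>A j\<close> looks at the colours on \<open>N j\<close> and, through
    \<open>L \<phi> u\<close> for \<open>u\<close> in \<open>N j\<close>, on the neighbours of such
    \<open>u\<close>. So \<open>j\<close> is near \<open>i\<close> when one of these sets meets the
    resampled set \<open>N i\<close>; the sizes are at most \<open>n ^ 8\<close> and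
    \<open>n ^ 12\<close>.\<close>
  define near where "near i = R `` N i \<union> R `` (R `` N i)" for i
  define p where "p = exp (- (real n ^ 2) / 4) + (exp 1 / (real n)\<^sup>2) ^ (n ^ 3)"
  have finL: "finite (L \<phi> v)" "k \<notin> L \<phi> v" for \<phi> v by (auto simp: L_def)
  have l0: "l > 0" using n by (simp add: l_def)
  have finPi: "finite (PiE (N i) (M i w))" for i w
    using finN finL by (intro finite_PiE) (auto simp: M_def)
  have "\<exists>\<phi>\<in>\<Omega>. \<forall>v\<in>V. \<phi> \<notin> A v"
  proof (rule local_lemma_resampling[where X = N and M = M and near = near and D = "2 * n ^ 12" and p = p])
    show "finite \<Omega>" using V finite_PiE[of V "\<lambda>_. {..k}"] by (simp add: \<Omega>_def)
    have "(\<lambda>v. if v \<in> V then k else undefined) \<in> \<Omega>" using V by (auto simp: \<Omega>_def PiE_def extensional_def)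
    then show "\<Omega> \<noteq> {}" by blast
    show "finite V" "0 \<le> p" by (fact V) (simp add: p_def)
    show "4 * p * real (2 * n ^ 12) \<le> 1" using p by (simp add: p_def)
    show "1 \<le> 2 * n ^ 12" using n by (simp add: Suc_le_eq)
    show "card (near i \<inter> V) \<le> 2 * n ^ 12" for i
    proof -
      have c2: "card (R `` N i) \<le> n ^ 4 * n ^ 4"
        using card_Image_le[OF finN[of i], of R "n ^ 4"] cardN[unfolded N_def] cardN[of i]
        by (meson le_trans mult_le_mono1)
      have f2: "finite (R `` N i)" using V by (auto intro: finite_subset)
      have f3: "finite (R `` (R `` N i))" using V by (auto intro: finite_subset)
      have c3: "card (R `` (R `` N i)) \<le> n ^ 4 * n ^ 4 * n ^ 4"
        using card_Image_le[OF f2, of R "n ^ 4"] cardN[unfolded N_def] c2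
        by (meson le_trans mult_le_mono1)
      have "card (near i \<inter> V) \<le> card (near i)" using f2 f3 by (intro card_mono) (auto simp: near_def)
      also have "\<dots> \<le> n ^ 4 * n ^ 4 + n ^ 4 * n ^ 4 * n ^ 4"
        unfolding near_def using c2 c3 card_Un_le[of "R `` N i" "R `` (R `` N i)"] by linarith
      also have "\<dots> \<le> n ^ 12 + n ^ 12"
        using n by (intro add_mono) (auto simp flip: power_add intro: power_increasing)
      finally show ?thesis by simp
    qed
    show "(\<lambda>x. if x \<in> N i then f x else w x) \<in> \<Omega>"
      if i: "i \<in> V" and w: "w \<in> \<Omega>" and f: "f \<in> PiE (N i) (M i w)" for i w f
    proof -
      have 1: "f a = k" if "a \<in> N i" "b \<notin> N i" "(a, b) \<in> R" "f a = w b" for a b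
        using f that by (auto simp: M_def L_def N_def dest!: PiE_mem)
      have 2: "(b, a) \<in> R" if "(a, b) \<in> R" for a b using that sym by (auto simp: sym_def)
      have 3: "\<not> (a \<in> N i \<and> b \<in> N i)" if "(a, b) \<in> R" for a b
        using tri that by (auto simp: N_def)
      have 4: "f a \<le> k" if "a \<in> N i" for a using PiE_mem[OF f that] by (auto simp: M_def L_def)
      have w': "w a = k" if "(a, b) \<in> R" "w a = w b" for a b using w that by (auto simp: \<Omega>_def)
      have w2: "w a \<le> k" if "a \<in> V" for a using w that by (auto simp: \<Omega>_def dest!: PiE_mem)
      have w3: "w a = undefined" if "a \<notin> V" for a using w that by (auto simp: \<Omega>_def)
      have "(if a \<in> N i then f a else w a) = k"
        if "(a, b) \<in> R" "(if a \<in> N i then f a else w a) = (if b \<in> N i then f b else w b)" for a b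
      proof (cases "a \<in> N i")
        case True
        then have "b \<notin> N i" using 3[OF that(1)] by simp
        then show ?thesis using that 1[of a b] True by simp
      next
        case False
        show ?thesis
        proof (cases "b \<in> N i")
          case True
          then show ?thesis using that 1[OF True False 2[OF that(1)]] False by simp
        next
          case False2: False
          then show ?thesis using that w'[OF that(1)] False by simp
        qed
      qed
      moreover have "(\<lambda>x. if x \<in> N i then f x else w x) \<in> PiE V (\<lambda>_. {..k})"
        using 4 w2 w3 N_V[of i] by (intro PiE_I) auto
      ultimately show ?thesis unfolding \<Omega>_def by blast
    qed
    show "w' x \<in> M i w x"
      if i: "i \<in> V" and w: "w \<in> \<Omega>" "w' \<in> \<Omega>" and eq: "\<And>x. x \<notin> N i \<Longrightarrow> w' x = w x" and x: "x \<in> N i"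
      for i w w' x
    proof (cases "w' x = k")
      case False
      have "x \<in> V" using x N_V by blast
      then have "w' x \<le> k" using w(2) by (auto simp: \<Omega>_def dest!: PiE_mem)
      moreover have "w' x \<noteq> w y" if "y \<in> N x" for y
      proof
        assume "w' x = w y"
        moreover have "y \<notin> N i" using N_tri[OF x] that by blast
        ultimately have "w' x = w' y" using eq by simp
        then show False using w(2) that False by (auto simp: \<Omega>_def N_def)
      qed
      ultimately show ?thesis using False by (auto simp: M_def L_def)
    qed (simp add: M_def)
    show "real (card {f \<in> PiE (N i) (M i w). (\<lambda>x. if x \<in> N i then f x else w x) \<in> A i})
        \<le> p * card (PiE (N i) (M i w))" if "i \<in> V" "w \<in> \<Omega>" for i w
    proof -
      let ?P = "PiE (N i) (M i w)"
      let ?B1 = "{f \<in> ?P. card ({..<k} - f ` N i) < l}"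
      let ?B2 = "{f \<in> ?P. l \<le> card {u \<in> N i. f u = k \<and> l \<le> card (L w u)}}"
      have P: "?P = PiE (N i) (\<lambda>u. insert k (L w u))" by (intro PiE_cong) (simp add: M_def)
      have "{f \<in> ?P. (\<lambda>x. if x \<in> N i then f x else w x) \<in> A i} \<subseteq> ?B1 \<union> ?B2"
      proof
        fix f assume f: "f \<in> {f \<in> ?P. (\<lambda>x. if x \<in> N i then f x else w x) \<in> A i}"
        let ?g = "\<lambda>x. if x \<in> N i then f x else w x"
        have "L ?g i = {..<k} - f ` N i" by (auto simp: L_def)
        \<comment> \<open>No edge lies inside \<open>N i\<close>, so resampling there does not
          change which colours its own vertices may use.\<close>
        moreover have "L ?g u = L w u" if "u \<in> N i" for u
          using N_tri[OF that] unfolding L_def by (intro arg_cong[where f = "\<lambda>S. {..<k} - S"] image_cong) auto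
        then have "{u \<in> N i. ?g u = k \<and> l \<le> card (L ?g u)} = {u \<in> N i. f u = k \<and> l \<le> card (L w u)}"
          by auto
        ultimately show "f \<in> ?B1 \<union> ?B2" using f by (simp add: A_def)
      qed
      then have "card {f \<in> ?P. (\<lambda>x. if x \<in> N i then f x else w x) \<in> A i} \<le> card (?B1 \<union> ?B2)"
        using finPi by (intro card_mono) auto
      also have "\<dots> \<le> card ?B1 + card ?B2" by (rule card_Un_le)
      finally have le: "real (card {f \<in> ?P. (\<lambda>x. if x \<in> N i then f x else w x) \<in> A i})
          \<le> real (card ?B1) + real (card ?B2)" by linarith
      \<comment> \<open>This value minimises
        \<open>\<theta>\<^sup>2 * n ^ 4 - \<theta> * n ^ 3\<close>; the minimum is
        \<open>- (n ^ 2) / 4\<close>.\<close>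
      define \<theta> where "\<theta> = 1 / (2 * real n)"
      have \<theta>: "0 \<le> \<theta>" "\<theta> \<le> 1" using n by (auto simp: \<theta>_def field_simps)
      let ?W = "missed_weight (L w) (N i) {..<k}"
      have "real (card {..<k}) * exp (- 2 * real (n ^ 4) / card {..<k}) \<le> ?W"
        using finN finL(1) cardN k by (intro missed_weight_ge) (auto simp: L_def)
      then have W2: "2 * real n ^ 3 \<le> ?W" using W by simp
      have "real (card ?B1) \<le> exp (\<theta>\<^sup>2 * card (N i) - \<theta> * (?W - l)) * card ?P"
        unfolding P using finN finL \<theta> by (intro card_few_missed_le) auto
      also have "\<dots> \<le> exp (- (real n ^ 2) / 4) * card ?P"
      proof -
        have "\<theta>\<^sup>2 * card (N i) \<le> \<theta>\<^sup>2 * n ^ 4"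
          using cardN[of i] by (intro mult_left_mono) (auto simp flip: of_nat_power)
        also have "\<dots> = real n ^ 2 / 4" using n by (simp add: \<theta>_def field_simps power2_eq_square power4_eq_xxxx)
        finally have 1: "\<theta>\<^sup>2 * card (N i) \<le> real n ^ 2 / 4" .
        have "\<theta> * real n ^ 3 \<le> \<theta> * (?W - l)" using W2 \<theta> by (intro mult_left_mono) (auto simp: l_def)
        moreover have "\<theta> * real n ^ 3 = real n ^ 2 / 2" using n by (simp add: \<theta>_def field_simps power2_eq_square power3_eq_cube)
        ultimately have "\<theta>\<^sup>2 * card (N i) - \<theta> * (?W - l) \<le> - (real n ^ 2) / 4" using 1 by simp
        then show ?thesis by (intro mult_right_mono) auto
      qed
      finally have b1: "real (card ?B1) \<le> exp (- (real n ^ 2) / 4) * card ?P" .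
      have "real (card ?B2) \<le> (exp 1 * real (n ^ 4) / (real l)\<^sup>2) ^ l * card ?P"
        unfolding P using finN finL l0 cardN by (intro card_many_blank_le) auto
      also have "exp 1 * real (n ^ 4) / (real l)\<^sup>2 = exp 1 / (real n)\<^sup>2"
        using n by (simp add: l_def field_simps flip: power_mult power_add)
      finally have "real (card ?B2) \<le> (exp 1 / (real n)\<^sup>2) ^ (n ^ 3) * card ?P" by (simp add: l_def)
      then show ?thesis using le b1 by (simp add: p_def algebra_simps)
    qed
    show "w' \<in> A j" if ij: "i \<in> V" "j \<in> V" "j \<notin> near i" and eq: "\<And>x. x \<notin> N i \<Longrightarrow> w' x = w x" and A: "w \<in> A j"
      for i j w w'
    proof -
      have 1: "w' x = w x" if "x \<in> N j" for x
        using eq[of x] that ij(3) N_sym[of x j] by (auto simp: near_def N_def)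
      have 2: "w' x = w x" if "u \<in> N j" "x \<in> N u" for x u
        using eq[of x] that ij(3) N_sym[of x u] N_sym[of u j] by (auto simp: near_def N_def)
      have "L w' j = L w j" using 1 by (simp add: L_def)
      moreover have "L w' u = L w u" if "u \<in> N j" for u using 2[OF that] by (simp add: L_def)
      then have "{u \<in> N j. w' u = k \<and> l \<le> card (L w' u)} = {u \<in> N j. w u = k \<and> l \<le> card (L w u)}"
        using 1 by auto
      ultimately show ?thesis using A by (simp add: A_def)
    qed
  qed
  then obtain \<phi> where \<phi>: "\<phi> \<in> \<Omega>" and good: "\<And>v. v \<in> V \<Longrightarrow> \<phi> \<notin> A v" by blast
  define B where "B = {v \<in> V. \<phi> v = k}"
  have "\<exists>f. (\<forall>v\<in>B. f v \<in> L \<phi> v) \<and> (\<forall>u\<in>B. \<forall>v\<in>B. (u, v) \<in> R \<longrightarrow> f u \<noteq> f v)"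
  proof (rule greedy_list_colouring[OF _ sym irr])
    show "finite B" using V by (simp add: B_def)
    fix v assume v: "v \<in> B"
    then have "v \<in> V" by (simp add: B_def)
    \<comment> \<open>Every vertex now has at least \<open>l\<close> available colours, so
      restricting the second alternative of \<open>A\<close> to such neighbours has lost
      nothing.\<close>
    have "{u \<in> B. (v, u) \<in> R} = {u \<in> N v. \<phi> u = k \<and> l \<le> card (L \<phi> u)}"
      using good N_V[of v] by (auto simp: B_def N_def A_def not_less)
    then show "card {u \<in> B. (v, u) \<in> R} < card (L \<phi> v)"
      using good[OF \<open>v \<in> V\<close>] by (auto simp: A_def not_less not_le)
  qed
  then obtain f where f: "\<And>v. v \<in> B \<Longrightarrow> f v \<in> L \<phi> v" "\<And>u v. u \<in> B \<Longrightarrow> v \<in> B \<Longrightarrow> (u, v) \<in> R \<Longrightarrow> f u \<noteq> f v"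
    by blast
  define g where "g v = (if \<phi> v = k then f v else \<phi> v)" for v
  have "g v < k" if "v \<in> V" for v
  proof (cases "\<phi> v = k")
    case True
    then show ?thesis using f(1)[of v] that by (auto simp: g_def B_def L_def)
  next
    case False
    have "\<phi> v \<le> k" using \<phi> that by (auto simp: \<Omega>_def dest!: PiE_mem)
    then show ?thesis using False by (simp add: g_def)
  qed
  moreover have "g u \<noteq> g v" if uv: "(u, v) \<in> R" for u v
  proof -
    have V': "u \<in> V" "v \<in> V" "(v, u) \<in> R" using uv V sym by (auto simp: sym_def)
    have 1: "f u \<noteq> \<phi> v" if "\<phi> u = k" "(u, v) \<in> R" "u \<in> V" for u v
      using f(1)[of u] that by (auto simp: B_def L_def N_def)
    have 2: "\<phi> u \<noteq> \<phi> v" if "\<phi> u \<noteq> k" using \<phi> uv that by (auto simp: \<Omega>_def)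
    show ?thesis
      using 1[of u v] 1[of v u] 2 f(2)[of u v] uv V' by (auto simp: g_def B_def)
  qed
  ultimately show ?thesis by (intro exI[of _ g]) auto
qed

text \<open>The factor 3 makes \<open>exp (- 2 * n ^ 4 / palette n)\<close> at least
  \<open>n powr (- 2 / 3)\<close>. A vertex then expects at least
  \<open>3 * n powr (10 / 3) / ln n\<close> colours to stay available, eventually more than
  \<open>2 * n ^ 3\<close>.\<close>

definition palette :: "nat \<Rightarrow> nat" where
  "palette n = nat \<lceil>3 * real n ^ 4 / ln n\<rceil>"

lemma eventually_triangle_free_colouring:
  "\<forall>\<^sub>F n in sequentially. \<forall>V (R :: ('v \<times> 'v) set). finite V \<longrightarrow> R \<subseteq> V \<times> V \<longrightarrow> sym R \<longrightarrow> (\<forall>v. (v, v) \<notin> R) \<longrightarrow>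
     (\<forall>x y z. (x, y) \<in> R \<longrightarrow> (y, z) \<in> R \<longrightarrow> (x, z) \<notin> R) \<longrightarrow> (\<forall>v\<in>V. card (R `` {v}) \<le> n ^ 4) \<longrightarrow>
     (\<exists>f :: 'v \<Rightarrow> nat. (\<forall>v\<in>V. f v < palette n) \<and> (\<forall>(u, v)\<in>R. f u \<noteq> f v))"
proof -
  have "\<forall>\<^sub>F n in sequentially. 3 * real n ^ 4 / ln n * exp (- (2 / 3) * ln n) \<ge> 2 * real n ^ 3"
    by real_asymp
  moreover have "\<forall>\<^sub>F n in sequentially. 4 * (exp (- (real n ^ 2) / 4) + exp (- (real n ^ 3))) * (2 * real n ^ 12) \<le> 1"
    by real_asymp
  moreover have "\<forall>\<^sub>F n in sequentially. n \<ge> (3 :: nat)" by (rule eventually_ge_at_top)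
  ultimately show ?thesis
  proof eventually_elim
    case (elim n)
    have n0: "real n > 0" "ln (real n) > 0" using elim by auto
    define x where "x = 3 * real n ^ 4 / ln n"
    have x0: "x > 0" using n0 by (simp add: x_def)
    have kx: "real (palette n) \<ge> x" unfolding palette_def x_def[symmetric] by linarith
    have W: "2 * real n ^ 3 \<le> real (palette n) * exp (- 2 * real n ^ 4 / palette n)"
    proof -
      have "2 * real n ^ 4 / palette n \<le> 2 * real n ^ 4 / x" using kx x0 by (intro divide_left_mono) auto
      also have "\<dots> = 2 / 3 * ln n" using n0 by (simp add: x_def field_simps)
      finally have "exp (- (2 / 3) * ln n) \<le> exp (- 2 * real n ^ 4 / palette n)" by simp
      then have "x * exp (- (2 / 3) * ln n) \<le> real (palette n) * exp (- 2 * real n ^ 4 / palette n)"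
        using kx x0 by (intro mult_mono) auto
      then show ?thesis using elim(1) by (simp add: x_def)
    qed
    have e: "(exp 1 / (real n)\<^sup>2) ^ (n ^ 3) \<le> exp (- (real n ^ 3))"
    proof -
      have "exp (1::real) * exp 1 \<le> 3 * 3" using exp_le by (intro mult_mono) auto
      also have "\<dots> \<le> (real n)\<^sup>2" using elim(3) unfolding power2_eq_square by (intro mult_mono) auto
      finally have "exp 1 / (real n)\<^sup>2 \<le> exp (- 1)"
        using n0 by (simp add: exp_minus field_simps)
      then have "(exp 1 / (real n)\<^sup>2) ^ (n ^ 3) \<le> exp (- 1) ^ (n ^ 3)" by (intro power_mono) auto
      also have "\<dots> = exp (- (real n ^ 3))" by (simp flip: exp_of_nat_mult)
      finally show ?thesis .
    qed
    have p: "4 * (exp (- (real n ^ 2) / 4) + (exp 1 / (real n)\<^sup>2) ^ (n ^ 3)) * (2 * n ^ 12) \<le> 1"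
    proof -
      have "4 * (exp (- (real n ^ 2) / 4) + (exp 1 / (real n)\<^sup>2) ^ (n ^ 3)) * (2 * n ^ 12)
        \<le> 4 * (exp (- (real n ^ 2) / 4) + exp (- (real n ^ 3))) * (2 * real n ^ 12)"
        using e by (intro mult_mono add_mono) auto
      then show ?thesis using elim(2) by linarith
    qed
    have k0: "palette n > 0" using kx x0 by simp
    have n1: "1 \<le> n" using elim by simp
    show ?case
    proof (intro allI impI)
      fix V :: "'v set" and R
      assume *: "finite V" "R \<subseteq> V \<times> V" "sym R" "\<forall>v. (v, v) \<notin> R"
        "\<forall>x y z. (x, y) \<in> R \<longrightarrow> (y, z) \<in> R \<longrightarrow> (x, z) \<notin> R" "\<forall>v\<in>V. card (R `` {v}) \<le> n ^ 4"
      show "\<exists>f :: 'v \<Rightarrow> nat. (\<forall>v\<in>V. f v < palette n) \<and> (\<forall>(u, v)\<in>R. f u \<noteq> f v)"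
        by (rule triangle_free_colouring_aux[where n = n, OF *(1,2,3) _ _ _ n1 k0 _ p])
          (use * W in blast)+
    qed
  qed
qed

section \<open>Colouring locally sparse graphs\<close>

text \<open>A family of disjoint pairs either can be extended or has endpoints meeting every pair of
  \<open>E\<close>.\<close>

lemma disjoint_pairs_or_cover:
  assumes "\<And>x. (x, x) \<notin> E"
  shows "(\<exists>es. length es = K \<and> set es \<subseteq> E \<and> distinct (map fst es @ map snd es)) \<or>
    (\<exists>X. finite X \<and> card X \<le> 2 * K \<and> (\<forall>(x, y)\<in>E. x \<in> X \<or> y \<in> X))"
proof (induction K)
  case 0
  show ?case by (intro disjI1 exI[of _ "[]"]) simp
next
  case (Suc K)
  then show ?case
  proof
    assume "\<exists>es. length es = K \<and> set es \<subseteq> E \<and> distinct (map fst es @ map snd es)"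
    then obtain es where es: "length es = K" "set es \<subseteq> E" "distinct (map fst es @ map snd es)" by blast
    let ?X = "set (map fst es @ map snd es)"
    show ?thesis
    proof (cases "\<forall>(x, y)\<in>E. x \<in> ?X \<or> y \<in> ?X")
      case True
      have "card ?X \<le> 2 * Suc K" using card_length[of "map fst es @ map snd es"] es(1) by simp
      then show ?thesis using True by (intro disjI2 exI[of _ ?X]) blast
    next
      case False
      then obtain x y where "(x, y) \<in> E" "x \<notin> ?X" "y \<notin> ?X" by blast
      moreover have "x \<noteq> y" using assms \<open>(x, y) \<in> E\<close> by blast
      ultimately show ?thesis using es by (intro disjI1 exI[of _ "(x, y) # es"]) simp
    qed
  next
    assume "\<exists>X. finite X \<and> card X \<le> 2 * K \<and> (\<forall>(x, y)\<in>E. x \<in> X \<or> y \<in> X)"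
    then obtain X where "finite X" "card X \<le> 2 * K" "\<forall>(x, y)\<in>E. x \<in> X \<or> y \<in> X" by blast
    then show ?thesis by (intro disjI2 exI[of _ X]) simp
  qed
qed

text \<open>The average in-degree equals the average out-degree, so some vertex has in-degree at
  most \<open>q\<close> and altogether at most \<open>2 * q\<close> conflicts. It is removed first
  and coloured last.\<close>

lemma bounded_outdegree_colouring:
  assumes "finite V" "\<And>v. v \<in> V \<Longrightarrow> finite (X v) \<and> card (X v) \<le> q"
  shows "\<exists>g :: 'v \<Rightarrow> nat. (\<forall>v\<in>V. g v < 2 * q + 1) \<and> (\<forall>v\<in>V. \<forall>u\<in>V \<inter> X v. u \<noteq> v \<longrightarrow> g u \<noteq> g v)"
  using assms
proof (induction "card V" arbitrary: V)
  case 0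
  then show ?case by simp
next
  case (Suc m)
  note finV = Suc.prems(1)
  have "\<exists>u\<in>V. card {v \<in> V. u \<in> X v} \<le> q"
  proof (rule ccontr)
    assume "\<not> ?thesis"
    then have "\<forall>u\<in>V. Suc q \<le> card {v \<in> V. u \<in> X v}" by (simp add: Suc_le_eq not_le)
    then have "(\<Sum>u\<in>V. Suc q) \<le> (\<Sum>u\<in>V. card {v \<in> V. u \<in> X v})" by (intro sum_mono) blast
    also have "\<dots> = (\<Sum>u\<in>V. \<Sum>v\<in>V. if u \<in> X v then 1 else 0)" using finV by (simp flip: sum.inter_filter)
    also have "\<dots> = (\<Sum>v\<in>V. \<Sum>u\<in>V. if u \<in> X v then 1 else 0)" by (rule sum.swap)
    also have "\<dots> = (\<Sum>v\<in>V. card {u \<in> V. u \<in> X v})" using finV by (simp flip: sum.inter_filter)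
    also have "\<dots> \<le> (\<Sum>v\<in>V. q)"
    proof (intro sum_mono)
      fix v assume "v \<in> V"
      then have X: "finite (X v)" "card (X v) \<le> q" using Suc.prems(2) by auto
      have "card {u \<in> V. u \<in> X v} \<le> card (X v)" using X(1) by (intro card_mono) auto
      then show "card {u \<in> V. u \<in> X v} \<le> q" using X(2) by simp
    qed
    finally show False using Suc.hyps(2) by simp
  qed
  then obtain u where u: "u \<in> V" "card {v \<in> V. u \<in> X v} \<le> q" by blast
  let ?V = "V - {u}"
  have "m = card ?V" using Suc.hyps(2) u finV by simp
  then obtain g :: "'v \<Rightarrow> nat" where g: "\<forall>v\<in>?V. g v < 2 * q + 1"
    "\<forall>v\<in>?V. \<forall>w\<in>?V \<inter> X v. w \<noteq> v \<longrightarrow> g w \<noteq> g v"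
    using Suc.hyps(1)[of ?V] finV Suc.prems(2) by blast
  let ?B = "{v \<in> V. u \<in> X v} \<union> X u"
  have "card (g ` ?B) \<le> card ?B" using finV Suc.prems(2)[OF u(1)] by (intro card_image_le) auto
  also have "\<dots> \<le> 2 * q" using u Suc.prems(2)[OF u(1)] card_Un_le[of "{v \<in> V. u \<in> X v}" "X u"] by linarith
  finally have "card (g ` ?B) < card {..<2 * q + 1}" by simp
  then have "\<not> {..<2 * q + 1} \<subseteq> g ` ?B"
    using card_mono[of "g ` ?B" "{..<2 * q + 1}"] finV Suc.prems(2)[OF u(1)] by auto
  then obtain c where c: "c < 2 * q + 1" "c \<notin> g ` ?B" by auto
  have "(\<forall>v\<in>V. (g(u := c)) v < 2 * q + 1) \<and>
      (\<forall>v\<in>V. \<forall>w\<in>V \<inter> X v. w \<noteq> v \<longrightarrow> (g(u := c)) w \<noteq> (g(u := c)) v)"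
    using g c by auto
  then show ?case by blast
qed

text \<open>The values on \<open>T\<close> are dictated by the value at \<open>i\<close>: all of
  \<open>T\<close> falls into the class of \<open>i\<close> with probability at most
  \<open>1 / r ^ card T\<close>.\<close>

lemma card_constant_on_le:
  assumes "finite X" "T \<subseteq> X" "i \<in> X" "i \<notin> T" "r > 0"
  shows "real (card {f \<in> PiE X (\<lambda>_. {..<r}). \<forall>x\<in>T. f x = f i}) \<le> real (r ^ card X) / real r ^ card T"
proof -
  let ?S = "{f \<in> PiE X (\<lambda>_. {..<r}). \<forall>x\<in>T. f x = f i}"
  have finT: "finite T" using assms finite_subset by blast
  have "inj_on (\<lambda>f. restrict f (X - T)) ?S"
  proof (rule inj_onI)
    fix f g assume fg: "f \<in> ?S" "g \<in> ?S" "restrict f (X - T) = restrict g (X - T)"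
    have eq: "f x = g x" if "x \<in> X - T" for x using fun_cong[OF fg(3), of x] that by simp
    have "f x = g x" if "x \<in> X" for x using eq[of x] eq[of i] that fg assms by (cases "x \<in> T") auto
    then show "f = g" using fg by (intro PiE_ext[of f X _ g]) auto
  qed
  moreover have "(\<lambda>f. restrict f (X - T)) ` ?S \<subseteq> PiE (X - T) (\<lambda>_. {..<r})" by auto
  ultimately have "card ?S \<le> card (PiE (X - T) (\<lambda>_. {..<r}))"
    using assms by (intro card_inj_on_le finite_PiE) auto
  also have "\<dots> = r ^ (card X - card T)"
    using assms finT by (simp add: card_PiE card_Diff_subset)
  finally have "real (card ?S) \<le> real r ^ (card X - card T)" by (simp flip: of_nat_power)
  also have "\<dots> = real (r ^ card X) / real r ^ card T"
    using assms card_mono[OF assms(1,2)] by (simp add: power_diff)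
  finally show ?thesis .
qed

text \<open>A uniform splitting and two kinds of bad events. Too large a degree: \<open>q\<close>
  neighbours in the own class have probability at most
  \<open>(exp 1 * \<Delta> / (q * r)) ^ q\<close>, which the factor 6 brings below
  \<open>(1 / 2) ^ q\<close>. Too many edges: there are at most \<open>m ^ K\<close> lists of
  \<open>K\<close> edges of a neighbourhood, and disjointness gives each the probability
  \<open>1 / r ^ (2 * K)\<close>.\<close>

lemma sparse_random_splitting:
  fixes R :: "('v \<times> 'v) set" and q r K \<Delta> m :: nat
  assumes V: "finite V" "R \<subseteq> V \<times> V" and sym: "sym R" and irr: "\<And>v. (v, v) \<notin> R"
    and deg: "\<And>v. v \<in> V \<Longrightarrow> card (R `` {v}) \<le> \<Delta>"
    and sparse: "\<And>v. v \<in> V \<Longrightarrow> card {(x, y). (x, y) \<in> R \<and> (v, x) \<in> R \<and> (v, y) \<in> R} \<le> m"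
    and pos: "q > 0" "r > 0" and q: "6 * \<Delta> \<le> q * r"
    and p: "4 * ((1 / 2) ^ q + (real m / (real r)\<^sup>2) ^ K) * (real \<Delta> + 1)\<^sup>2 \<le> 1"
  shows "\<exists>\<phi> :: 'v \<Rightarrow> nat. (\<forall>v\<in>V. \<phi> v < r) \<and> (\<forall>v\<in>V. card {u. (v, u) \<in> R \<and> \<phi> u = \<phi> v} < q) \<and>
    (\<forall>v\<in>V. \<not> (\<exists>es. length es = K \<and> distinct (map fst es @ map snd es) \<and>
      set es \<subseteq> {(x, y). (x, y) \<in> R \<and> (v, x) \<in> R \<and> (v, y) \<in> R \<and> \<phi> x = \<phi> v \<and> \<phi> y = \<phi> v}))"
proof -
  define N where "N v = R `` {v}" for v
  define X where "X v = insert v (N v)" for v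
  define E where "E v = {(x, y). (x, y) \<in> R \<and> (v, x) \<in> R \<and> (v, y) \<in> R}" for v
  define ok where "ok v es \<longleftrightarrow> length es = K \<and> set es \<subseteq> E v \<and> distinct (map fst es @ map snd es)" for v es
  define \<Omega> where "\<Omega> = PiE V (\<lambda>_. {..<r})"
  define A where "A v = {\<phi> :: 'v \<Rightarrow> nat. q \<le> card {u \<in> N v. \<phi> u = \<phi> v} \<or>
    (\<exists>es. ok v es \<and> (\<forall>x\<in>set (map fst es @ map snd es). \<phi> x = \<phi> v))}" for v
  \<comment> \<open>\<open>A j\<close> depends only on the closed neighbourhood \<open>X j\<close>;
    these are the \<open>j\<close> for which it meets \<open>X i\<close>.\<close>
  define near where "near i = X i \<union> R `` X i" for i
  define p where "p = (1 / 2) ^ q + (real m / (real r)\<^sup>2) ^ K"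
  have N_V: "N v \<subseteq> V" for v using V by (auto simp: N_def)
  have finN: "finite (N v)" for v using N_V V(1) by (rule finite_subset)
  have finX: "finite (X v)" for v using finN by (simp add: X_def)
  have finE: "finite (E v)" for v
    by (rule finite_subset[of _ "N v \<times> N v"]) (use finN in \<open>auto simp: E_def N_def\<close>)
  have N_sym: "u \<in> N v \<longleftrightarrow> v \<in> N u" for u v using sym by (auto simp: N_def sym_def)
  have self: "v \<notin> N v" for v using irr by (simp add: N_def)
  have cX: "card (X v) \<le> \<Delta> + 1" if "v \<in> V" for v
    using deg[OF that] finN[of v] self by (simp add: X_def N_def)
  have "\<exists>\<phi>\<in>\<Omega>. \<forall>v\<in>V. \<phi> \<notin> A v"
  proof (rule local_lemma_resampling[where X = X and M = "\<lambda>_ _ _. {..<r}" and near = near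
        and D = "(\<Delta> + 1)\<^sup>2" and p = p])
    show "finite \<Omega>" using V finite_PiE[of V "\<lambda>_. {..<r}"] by (simp add: \<Omega>_def)
    show "\<Omega> \<noteq> {}" using pos by (auto simp: \<Omega>_def PiE_eq_empty_iff)
    show "finite V" "0 \<le> p" "1 \<le> (\<Delta> + 1)\<^sup>2" by (fact V) (simp_all add: p_def)
    show "4 * p * real ((\<Delta> + 1)\<^sup>2) \<le> 1" using p by (simp add: p_def add.commute)
    show "card (near i \<inter> V) \<le> (\<Delta> + 1)\<^sup>2" if i: "i \<in> V" for i
    proof -
      have XV: "X i \<subseteq> V" using N_V i by (auto simp: X_def)
      have f: "finite (R `` X i)" using V by (auto intro: finite_subset)
      have "card (R `` X i) \<le> card (X i) * \<Delta>"
        using XV deg by (intro card_Image_le finX) auto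
      then have "card (near i) \<le> (\<Delta> + 1) + (\<Delta> + 1) * \<Delta>"
        unfolding near_def using card_Un_le[of "X i" "R `` X i"] cX[OF i] mult_le_mono1[OF cX[OF i], of \<Delta>]
        by linarith
      also have "\<dots> = (\<Delta> + 1)\<^sup>2" by (simp add: power2_eq_square algebra_simps)
      finally show ?thesis
        using card_mono[of "near i" "near i \<inter> V"] finX[of i] f by (auto simp: near_def)
    qed
    show "(\<lambda>x. if x \<in> X i then f x else w x) \<in> \<Omega>"
      if "i \<in> V" "w \<in> \<Omega>" "f \<in> PiE (X i) (\<lambda>_. {..<r})" for i w f
      using that N_V[of i] unfolding \<Omega>_def X_def by (intro PiE_I) (auto simp: PiE_mem)
    show "w' x \<in> {..<r}" if "i \<in> V" "w' \<in> \<Omega>" "x \<in> X i" for i w' x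
    proof -
      have "x \<in> V" using that N_V[of i] by (auto simp: X_def)
      then show ?thesis using PiE_mem that(2) unfolding \<Omega>_def by fastforce
    qed
    show "w' \<in> A j"
      if ij: "i \<in> V" "j \<in> V" "j \<notin> near i" and eq: "\<And>x. x \<notin> X i \<Longrightarrow> w' x = w x" and A: "w \<in> A j" for i j w w'
    proof -
      have 1: "w' x = w x" if "x \<in> X j" for x
      proof (rule eq)
        show "x \<notin> X i" using that ij(3) N_sym[of x j] by (auto simp: near_def X_def N_def)
      qed
      then have e1: "{u \<in> N j. w' u = w' j} = {u \<in> N j. w u = w j}" by (auto simp: X_def)
      have "x \<in> X j" if "ok j es" "x \<in> set (map fst es @ map snd es)" for es x
        using that by (auto simp: ok_def E_def X_def N_def)
      then have e2: "\<forall>x\<in>set (map fst es @ map snd es). w' x = w' j"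
        if "ok j es" "\<forall>x\<in>set (map fst es @ map snd es). w x = w j" for es
        using 1 that unfolding X_def by (metis insertI1)
      from A consider "q \<le> card {u \<in> N j. w u = w j}"
        | es where "ok j es" "\<forall>x\<in>set (map fst es @ map snd es). w x = w j"
        unfolding A_def by blast
      then show ?thesis
      proof cases
        case 1
        then show ?thesis using e1 by (simp add: A_def)
      next
        case 2
        then show ?thesis using e2 unfolding A_def by blast
      qed
    qed
    show "real (card {f \<in> PiE (X i) (\<lambda>_. {..<r}). (\<lambda>x. if x \<in> X i then f x else w x) \<in> A i})
        \<le> p * card (PiE (X i) (\<lambda>_. {..<r}))" if i: "i \<in> V" for i w
    proof -
      let ?P = "PiE (X i) (\<lambda>_. {..<r})"
      let ?C = "\<lambda>T. {f \<in> ?P. \<forall>x\<in>T. f x = f i}"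
      let ?T1 = "{T. T \<subseteq> N i \<and> card T = q}"
      let ?T2 = "{es. ok i es}"
      let ?v = "\<lambda>es. set (map fst es @ map snd es)"
      have finP: "finite ?P" using finX by (intro finite_PiE) auto
      have finT1: "finite ?T1" using finN by simp
      have T2: "?T2 \<subseteq> {es. set es \<subseteq> E i \<and> length es = K}" by (auto simp: ok_def)
      have finT2: "finite ?T2" using finite_subset[OF T2] finite_lists_length_eq[OF finE] by blast
      have cT2: "card ?T2 \<le> m ^ K"
      proof -
        have "card ?T2 \<le> card (E i) ^ K"
          using card_mono[OF finite_lists_length_eq[OF finE] T2] by (simp add: card_lists_length_eq[OF finE])
        also have "\<dots> \<le> m ^ K" using sparse[OF i] by (intro power_mono) (auto simp: E_def)
        finally show ?thesis .
      qed
      have sub: "{f \<in> ?P. (\<lambda>x. if x \<in> X i then f x else w x) \<in> A i}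
          \<subseteq> (\<Union>T\<in>?T1. ?C T) \<union> (\<Union>es\<in>?T2. ?C (?v es))"
      proof
        fix f assume f: "f \<in> {f \<in> ?P. (\<lambda>x. if x \<in> X i then f x else w x) \<in> A i}"
        let ?g = "\<lambda>x. if x \<in> X i then f x else w x"
        have gX: "?g x = f x" if "x \<in> X i" for x using that by simp
        have iX: "i \<in> X i" by (simp add: X_def)
        consider "q \<le> card {u \<in> N i. ?g u = ?g i}"
          | es where "ok i es" "\<forall>x\<in>?v es. ?g x = ?g i" using f by (auto simp: A_def)
        then show "f \<in> (\<Union>T\<in>?T1. ?C T) \<union> (\<Union>es\<in>?T2. ?C (?v es))"
        proof cases
          case 1
          then obtain T where "T \<subseteq> {u \<in> N i. ?g u = ?g i}" "card T = q"
            using obtain_subset_with_card_n[OF 1] by blast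
          moreover from this have "\<forall>x\<in>T. f x = f i" by (auto simp: X_def)
          ultimately have "T \<in> ?T1" "f \<in> ?C T" using f by auto
          then show ?thesis by blast
        next
          case 2
          have sub: "?v es \<subseteq> X i" using 2(1) by (auto simp: ok_def E_def X_def N_def)
          have "f x = f i" if "x \<in> ?v es" for x
          proof -
            have "?g x = ?g i" by (rule bspec[OF 2(2) that])
            then show ?thesis using subsetD[OF sub that] iX by (simp only: if_True)
          qed
          then have "f \<in> ?C (?v es)" using f by blast
          then show ?thesis using 2(1) by blast
        qed
      qed
      have iX: "i \<in> X i" by (simp add: X_def)
      have cP: "real (card ?P) = real (r ^ card (X i))" using card_PiE[OF finX[of i], of "\<lambda>_. {..<r}"] by simp
      have c1: "real (card (?C T)) \<le> card ?P / real r ^ q" if "T \<in> ?T1" for T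
      proof -
        have "T \<subseteq> X i" "i \<notin> T" "card T = q" using that self by (auto simp: X_def)
        then show ?thesis
          using card_constant_on_le[OF finX[of i], of T i r] pos iX unfolding cP by simp
      qed
      have c2: "real (card (?C (?v es))) \<le> card ?P / real r ^ (2 * K)" if "es \<in> ?T2" for es
      proof -
        have "card (?v es) = 2 * K" using that by (subst distinct_card) (auto simp: ok_def)
        moreover have "?v es \<subseteq> X i" "i \<notin> ?v es" using that irr by (auto simp: ok_def E_def X_def N_def)
        ultimately show ?thesis
          using card_constant_on_le[OF finX[of i], of "?v es" i r] pos
          iX unfolding cP by simp
      qed
      have "card {f \<in> ?P. (\<lambda>x. if x \<in> X i then f x else w x) \<in> A i}
          \<le> card ((\<Union>T\<in>?T1. ?C T) \<union> (\<Union>es\<in>?T2. ?C (?v es)))"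
        using finP finT1 finT2 by (intro card_mono sub finite_UnI finite_UN_I) auto
      also have "\<dots> \<le> (\<Sum>T\<in>?T1. card (?C T)) + (\<Sum>es\<in>?T2. card (?C (?v es)))"
        by (intro order_trans[OF card_Un_le] add_mono card_UN_le finT1 finT2)
      finally have "real (card {f \<in> ?P. (\<lambda>x. if x \<in> X i then f x else w x) \<in> A i})
          \<le> (\<Sum>T\<in>?T1. real (card (?C T))) + (\<Sum>es\<in>?T2. real (card (?C (?v es))))"
        by (simp flip: of_nat_sum of_nat_add)
      also have "\<dots> \<le> (\<Sum>T\<in>?T1. card ?P / real r ^ q) + (\<Sum>es\<in>?T2. card ?P / real r ^ (2 * K))"
        by (intro add_mono sum_mono c1 c2)
      also have "\<dots> = real (card ?T1) * (card ?P / real r ^ q) + real (card ?T2) * (card ?P / real r ^ (2 * K))"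
        by simp
      also have "\<dots> \<le> ((1 / 2) ^ q * real r ^ q) * (card ?P / real r ^ q) + real m ^ K * (card ?P / real r ^ (2 * K))"
      proof (intro add_mono mult_right_mono)
        have "real (card ?T1) = real (card (N i) choose q)" using finN by (simp add: n_subsets)
        also have "\<dots> \<le> real (\<Delta> choose q)"
          using deg[OF i] by (intro of_nat_mono binomial_right_mono) (auto simp: N_def)
        also have "\<dots> \<le> (exp 1 * \<Delta> / q) ^ q" by (rule binomial_le_exp[OF pos(1)])
        also have "\<dots> \<le> (1 / 2 * real r) ^ q"
        proof (intro power_mono)
          have "exp 1 * real \<Delta> \<le> 3 * real \<Delta>" using exp_le by (intro mult_right_mono) auto
          moreover have "6 * real \<Delta> \<le> real r * real q"
            using of_nat_mono[OF q, where 'a = real] by (simp add: mult.commute)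
          ultimately have "exp 1 * real \<Delta> \<le> (1 / 2 * real r) * real q" by simp
          then show "exp 1 * real \<Delta> / q \<le> 1 / 2 * real r" using pos by (simp add: pos_divide_le_eq)
        qed auto
        finally show "real (card ?T1) \<le> (1 / 2) ^ q * real r ^ q" by (simp only: power_mult_distrib)
        show "real (card ?T2) \<le> real m ^ K" using cT2 by (simp flip: of_nat_power)
      qed auto
      also have "\<dots> = p * card ?P"
      proof -
        have "(x * real r ^ q) * (y / real r ^ q) = x * y" for x y using pos by simp
        moreover have "real m ^ K * (y / real r ^ (2 * K)) = (real m / (real r)\<^sup>2) ^ K * y" for y
          by (simp add: power_divide power_mult)
        ultimately show ?thesis by (simp only: p_def distrib_right)
      qed
      finally show ?thesis .
    qed
  qed
  then obtain \<phi> where \<phi>: "\<phi> \<in> \<Omega>" and good: "\<And>v. v \<in> V \<Longrightarrow> \<phi> \<notin> A v" by blast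
  have "\<phi> v < r" if "v \<in> V" for v using \<phi> that by (auto simp: \<Omega>_def dest!: PiE_mem)
  moreover have "card {u. (v, u) \<in> R \<and> \<phi> u = \<phi> v} < q" if "v \<in> V" for v
    using good[OF that] by (auto simp: A_def N_def)
  moreover have "\<not> (\<exists>es. length es = K \<and> distinct (map fst es @ map snd es) \<and>
      set es \<subseteq> {(x, y). (x, y) \<in> R \<and> (v, x) \<in> R \<and> (v, y) \<in> R \<and> \<phi> x = \<phi> v \<and> \<phi> y = \<phi> v})" if "v \<in> V" for v
  proof
    assume "\<exists>es. length es = K \<and> distinct (map fst es @ map snd es) \<and>
      set es \<subseteq> {(x, y). (x, y) \<in> R \<and> (v, x) \<in> R \<and> (v, y) \<in> R \<and> \<phi> x = \<phi> v \<and> \<phi> y = \<phi> v}"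
    then obtain es where es: "length es = K" "distinct (map fst es @ map snd es)"
      "set es \<subseteq> {(x, y). (x, y) \<in> R \<and> (v, x) \<in> R \<and> (v, y) \<in> R \<and> \<phi> x = \<phi> v \<and> \<phi> y = \<phi> v}" by blast
    then have "ok v es" "\<forall>x\<in>set (map fst es @ map snd es). \<phi> x = \<phi> v" by (auto simp: ok_def E_def)
    then show False using good[OF that] unfolding A_def by blast
  qed
  ultimately show ?thesis by blast
qed

text \<open>
  Inside a class of the splitting, the neighbourhood of \<open>v\<close> has a cover \<open>X v\<close> of bounded size, so that
  every triangle of the class contains an arc of the digraph of bounded out-degree \<open>v \<mapsto> X v\<close>.
  Colouring this digraph therefore splits the class into triangle-free pieces.
\<close>

lemma sparse_colouring:
  fixes R :: "('v \<times> 'v) set" and q r K \<Delta> m k :: nat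
  assumes V: "finite V" "R \<subseteq> V \<times> V" and sym: "sym R" and irr: "\<And>v. (v, v) \<notin> R"
    and deg: "\<And>v. v \<in> V \<Longrightarrow> card (R `` {v}) \<le> \<Delta>"
    and sparse: "\<And>v. v \<in> V \<Longrightarrow> card {(x, y). (x, y) \<in> R \<and> (v, x) \<in> R \<and> (v, y) \<in> R} \<le> m"
    and pos: "q > 0" "r > 0" and q: "6 * \<Delta> \<le> q * r"
    and p: "4 * ((1 / 2) ^ q + (real m / (real r)\<^sup>2) ^ K) * (real \<Delta> + 1)\<^sup>2 \<le> 1"
    and colourable: "\<And>Q :: ('v \<times> 'v) set. Q \<subseteq> V \<times> V \<Longrightarrow> sym Q \<Longrightarrow> (\<And>v. (v, v) \<notin> Q) \<Longrightarrow>
      (\<And>x y z. (x, y) \<in> Q \<Longrightarrow> (y, z) \<in> Q \<Longrightarrow> (x, z) \<notin> Q) \<Longrightarrow> (\<And>v. v \<in> V \<Longrightarrow> card (Q `` {v}) \<le> q) \<Longrightarrow>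
      \<exists>f :: 'v \<Rightarrow> nat. (\<forall>v\<in>V. f v < k) \<and> (\<forall>(u, v)\<in>Q. f u \<noteq> f v)"
  shows "\<exists>f :: 'v \<Rightarrow> nat. (\<forall>v\<in>V. f v < r * (4 * K + 1) * k) \<and> (\<forall>(u, v)\<in>R. f u \<noteq> f v)"
proof -
  obtain \<phi> :: "'v \<Rightarrow> nat" where \<phi>: "\<And>v. v \<in> V \<Longrightarrow> \<phi> v < r"
    "\<And>v. v \<in> V \<Longrightarrow> card {u. (v, u) \<in> R \<and> \<phi> u = \<phi> v} < q"
    "\<And>v. v \<in> V \<Longrightarrow> \<not> (\<exists>es. length es = K \<and> distinct (map fst es @ map snd es) \<and>
      set es \<subseteq> {(x, y). (x, y) \<in> R \<and> (v, x) \<in> R \<and> (v, y) \<in> R \<and> \<phi> x = \<phi> v \<and> \<phi> y = \<phi> v})"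
    using sparse_random_splitting[OF V sym irr deg sparse pos q p] by blast
  let ?E = "\<lambda>v. {(x, y). (x, y) \<in> R \<and> (v, x) \<in> R \<and> (v, y) \<in> R \<and> \<phi> x = \<phi> v \<and> \<phi> y = \<phi> v}"
  have "\<exists>X. finite X \<and> card X \<le> 2 * K \<and> (\<forall>(x, y)\<in>?E v. x \<in> X \<or> y \<in> X)" if "v \<in> V" for v
    using disjoint_pairs_or_cover[of "?E v" K] \<phi>(3)[OF that] irr by blast
  then have "\<forall>v\<in>V. \<exists>X. finite X \<and> card X \<le> 2 * K \<and> (\<forall>(x, y)\<in>?E v. x \<in> X \<or> y \<in> X)" by blast
  from bchoice[OF this] obtain X
    where "\<forall>v\<in>V. finite (X v) \<and> card (X v) \<le> 2 * K \<and> (\<forall>(x, y)\<in>?E v. x \<in> X v \<or> y \<in> X v)" by blast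
  then have X: "\<And>v. v \<in> V \<Longrightarrow> finite (X v) \<and> card (X v) \<le> 2 * K"
    "\<And>v x y. v \<in> V \<Longrightarrow> (x, y) \<in> ?E v \<Longrightarrow> x \<in> X v \<or> y \<in> X v" by blast+
  obtain g :: "'v \<Rightarrow> nat" where g: "\<And>v. v \<in> V \<Longrightarrow> g v < 2 * (2 * K) + 1"
    "\<And>v u. v \<in> V \<Longrightarrow> u \<in> V \<inter> X v \<Longrightarrow> u \<noteq> v \<Longrightarrow> g u \<noteq> g v"
    using bounded_outdegree_colouring[where X = X, OF V(1) X(1)] by blast
  define Q where "Q = {(u, v). (u, v) \<in> R \<and> \<phi> u = \<phi> v \<and> g u = g v}"
  have "\<exists>f :: 'v \<Rightarrow> nat. (\<forall>v\<in>V. f v < k) \<and> (\<forall>(u, v)\<in>Q. f u \<noteq> f v)"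
  proof (rule colourable)
    show "Q \<subseteq> V \<times> V" "sym Q" "(v, v) \<notin> Q" for v using V sym irr by (auto simp: Q_def sym_def)
    show "card (Q `` {v}) \<le> q" if "v \<in> V" for v
    proof -
      have "finite {u. (v, u) \<in> R \<and> \<phi> u = \<phi> v}" by (rule finite_subset[OF _ V(1)]) (use V in auto)
      then have "card (Q `` {v}) \<le> card {u. (v, u) \<in> R \<and> \<phi> u = \<phi> v}"
        by (intro card_mono) (auto simp: Q_def)
      then show ?thesis using \<phi>(2)[OF that] by simp
    qed
    show "(x, z) \<notin> Q" if "(x, y) \<in> Q" "(y, z) \<in> Q" for x y z
    proof
      assume "(x, z) \<in> Q"
      then have "(y, z) \<in> ?E x" "x \<in> V" "y \<in> V" "z \<in> V" "x \<noteq> y" "x \<noteq> z" "g x = g y" "g x = g z"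
        using that V irr by (auto simp: Q_def)
      then show False using X(2)[of x y z] g(2)[of x y] g(2)[of x z] by auto
    qed
  qed
  then obtain f :: "'v \<Rightarrow> nat" where f: "\<And>v. v \<in> V \<Longrightarrow> f v < k" "\<And>u v. (u, v) \<in> Q \<Longrightarrow> f u \<noteq> f v" by blast
  \<comment> \<open>Mixed-radix code of the triple of colours, with radices
    \<open>4 * K + 1\<close>, the bound on \<open>g\<close>, and \<open>k\<close>, the bound on
    \<open>f\<close>.\<close>
  define h where "h v = (\<phi> v * (4 * K + 1) + g v) * k + f v" for v
  have mix: "a * b + c < a' * b" if "a < a'" "c < b" for a b c a' :: nat
  proof -
    have "a * b + c < Suc a * b" using that by simp
    also have "\<dots> \<le> a' * b" using that by (intro mult_right_mono) auto
    finally show ?thesis .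
  qed
  have uniq: "a = a' \<and> c = c'" if "a * b + c = a' * b + c'" "c < b" "c' < b" for a a' b c c' :: nat
  proof -
    have "(x * b + y) div b = x" if "y < b" for x y using that by simp
    then have "a = a'" using that by metis
    then show ?thesis using that(1) by simp
  qed
  have "h v < r * (4 * K + 1) * k" if "v \<in> V" for v
  proof -
    have "g v < 4 * K + 1" using g(1)[OF that] by simp
    from mix[OF mix[OF \<phi>(1)[OF that] this] f(1)[OF that]] show ?thesis by (simp add: h_def)
  qed
  moreover have "h u \<noteq> h v" if uv: "(u, v) \<in> R" for u v
  proof
    assume h: "h u = h v"
    have V': "u \<in> V" "v \<in> V" using uv V by auto
    have 1: "\<phi> u * (4 * K + 1) + g u = \<phi> v * (4 * K + 1) + g v \<and> f u = f v"
      using h f(1)[OF V'(1)] f(1)[OF V'(2)] unfolding h_def by (rule uniq)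
    moreover have "\<phi> u = \<phi> v \<and> g u = g v"
      using g(1)[OF V'(1)] g(1)[OF V'(2)] by (intro uniq[OF conjunct1[OF 1]]) auto
    ultimately show False using f(2)[of u v] uv by (simp add: Q_def)
  qed
  ultimately show ?thesis by (intro exI[of _ h]) auto
qed

section \<open>Sparse neighbourhoods in graph powers\<close>

lemma relpow_Image:
  assumes "finite V" "A \<subseteq> V \<times> V" "\<And>v. v \<in> V \<Longrightarrow> card (A `` {v}) \<le> d"
  shows "finite ((A ^^ n) `` {x}) \<and> card ((A ^^ n) `` {x}) \<le> d ^ n"
proof (induction n)
  case 0
  then show ?case by simp
next
  case (Suc n)
  have d: "card (A `` {v}) \<le> d" for v
  proof (cases "v \<in> V")
    case False
    then have "A `` {v} = {}" using assms(2) by auto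
    then show ?thesis by simp
  qed (rule assms(3))
  have eq: "(A ^^ Suc n) `` {x} = A `` ((A ^^ n) `` {x})" by auto
  have "finite (A `` ((A ^^ n) `` {x}))" using assms(1,2) by (auto intro: finite_subset)
  moreover have "card (A `` ((A ^^ n) `` {x})) \<le> d ^ n * d"
    using card_Image_le[of "(A ^^ n) `` {x}" A d] Suc d by (meson le_trans mult_le_mono1)
  ultimately show ?case unfolding eq by (simp add: mult.commute)
qed

lemma sym_relpow: "sym A \<Longrightarrow> sym (A ^^ n)"
proof (induction n)
  case (Suc n)
  show ?case
  proof (rule symI)
    fix x y assume "(x, y) \<in> A ^^ Suc n"
    then obtain w where "(x, w) \<in> A ^^ n" "(w, y) \<in> A" by auto
    then have "(y, w) \<in> A" "(w, x) \<in> A ^^ n" using Suc by (auto dest: symD)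
    then show "(y, x) \<in> A ^^ Suc n" by (rule relpow_Suc_I2)
  qed
qed (simp add: sym_Id)

lemma card_Sigma_le:
  assumes "finite X" "card X \<le> a" "\<And>x. x \<in> X \<Longrightarrow> finite (Y x) \<and> card (Y x) \<le> b"
  shows "finite (SIGMA x:X. Y x) \<and> card (SIGMA x:X. Y x) \<le> a * b"
proof -
  have "card (SIGMA x:X. Y x) = (\<Sum>x\<in>X. card (Y x))" using assms by (intro card_SigmaI) auto
  also have "\<dots> \<le> (\<Sum>x\<in>X. b)" using assms by (intro sum_mono) blast
  also have "\<dots> \<le> a * b" using assms(2) by simp
  finally show ?thesis using assms by auto
qed

text \<open>Repeatedly deleting a vertex of degree at most \<open>c\<close> loses at most
  \<open>c\<close> edges each time, so the surplus of edges survives and the process stops at a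
  nonempty graph.\<close>

lemma dense_subgraph:
  assumes "finite H" "finite Y" "card (E \<inter> H \<times> Y) > c * (card H + card Y)"
  shows "\<exists>H' Y'. H' \<subseteq> H \<and> Y' \<subseteq> Y \<and> H' \<noteq> {} \<and> Y' \<noteq> {} \<and>
    (\<forall>h\<in>H'. c < card {y \<in> Y'. (h, y) \<in> E}) \<and> (\<forall>y\<in>Y'. c < card {h \<in> H'. (h, y) \<in> E})"
  using assms
proof (induction "card H + card Y" arbitrary: H Y rule: less_induct)
  case less
  note fin = less.prems(1,2)
  consider h where "h \<in> H" "card {y \<in> Y. (h, y) \<in> E} \<le> c"
    | y where "y \<in> Y" "card {h \<in> H. (h, y) \<in> E} \<le> c"
    | "\<forall>h\<in>H. c < card {y \<in> Y. (h, y) \<in> E}" "\<forall>y\<in>Y. c < card {h \<in> H. (h, y) \<in> E}"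
    by (meson not_le)
  then show ?case
  proof cases
    case 1
    have H: "card H = Suc (card (H - {h}))" by (rule card.remove[OF fin(1) 1(1)])
    have "E \<inter> H \<times> Y \<subseteq> E \<inter> (H - {h}) \<times> Y \<union> Pair h ` {y \<in> Y. (h, y) \<in> E}" by auto
    then have "card (E \<inter> H \<times> Y) \<le> card (E \<inter> (H - {h}) \<times> Y \<union> Pair h ` {y \<in> Y. (h, y) \<in> E})"
      using fin by (intro card_mono) auto
    also have "\<dots> \<le> card (E \<inter> (H - {h}) \<times> Y) + card (Pair h ` {y \<in> Y. (h, y) \<in> E})" by (rule card_Un_le)
    also have "card (Pair h ` {y \<in> Y. (h, y) \<in> E}) \<le> c"
      using 1(2) fin card_image_le[of "{y \<in> Y. (h, y) \<in> E}" "Pair h"] by simp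
    finally have "c * (card (H - {h}) + card Y) < card (E \<inter> (H - {h}) \<times> Y)"
      using less.prems(3) by (simp add: H algebra_simps)
    then obtain H' Y' where "H' \<subseteq> H - {h}" "Y' \<subseteq> Y" "H' \<noteq> {}" "Y' \<noteq> {}"
      "\<forall>h\<in>H'. c < card {y \<in> Y'. (h, y) \<in> E}" "\<forall>y\<in>Y'. c < card {h \<in> H'. (h, y) \<in> E}"
      using less.hyps[of "H - {h}" Y] fin H by auto
    then show ?thesis by (intro exI[of _ H'] exI[of _ Y']) blast
  next
    case 2
    have Y: "card Y = Suc (card (Y - {y}))" by (rule card.remove[OF fin(2) 2(1)])
    have "E \<inter> H \<times> Y \<subseteq> E \<inter> H \<times> (Y - {y}) \<union> (\<lambda>h. (h, y)) ` {h \<in> H. (h, y) \<in> E}" by auto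
    then have "card (E \<inter> H \<times> Y) \<le> card (E \<inter> H \<times> (Y - {y}) \<union> (\<lambda>h. (h, y)) ` {h \<in> H. (h, y) \<in> E})"
      using fin by (intro card_mono) auto
    also have "\<dots> \<le> card (E \<inter> H \<times> (Y - {y})) + card ((\<lambda>h. (h, y)) ` {h \<in> H. (h, y) \<in> E})" by (rule card_Un_le)
    also have "card ((\<lambda>h. (h, y)) ` {h \<in> H. (h, y) \<in> E}) \<le> c"
      using 2(2) fin card_image_le[of "{h \<in> H. (h, y) \<in> E}" "\<lambda>h. (h, y)"] by simp
    finally have "c * (card H + card (Y - {y})) < card (E \<inter> H \<times> (Y - {y}))"
      using less.prems(3) by (simp add: Y algebra_simps)
    then obtain H' Y' where "H' \<subseteq> H" "Y' \<subseteq> Y - {y}" "H' \<noteq> {}" "Y' \<noteq> {}"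
      "\<forall>h\<in>H'. c < card {y \<in> Y'. (h, y) \<in> E}" "\<forall>y\<in>Y'. c < card {h \<in> H'. (h, y) \<in> E}"
      using less.hyps[of H "Y - {y}"] fin Y by auto
    then show ?thesis by (intro exI[of _ H'] exI[of _ Y']) blast
  next
    case 3
    have "E \<inter> H \<times> Y \<noteq> {}" using less.prems(3) by auto
    then have "H \<noteq> {}" "Y \<noteq> {}" by auto
    then show ?thesis using 3 by blast
  qed
qed

section \<open>Breadth-first trees and the cycles they close\<close>

definition level :: "('a \<times> 'a) set \<Rightarrow> 'a \<Rightarrow> nat \<Rightarrow> 'a set" where
  "level A v i = {u. (v, u) \<in> A ^^ i \<and> (\<forall>j<i. (v, u) \<notin> A ^^ j)}"

text \<open>The index \<open>i\<close> is quantified inside the choice, so one function serves all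
  levels and its iterates trace the tree path down to \<open>v\<close>.\<close>

definition parent :: "('a \<times> 'a) set \<Rightarrow> 'a \<Rightarrow> 'a \<Rightarrow> 'a" where
  "parent A v u = (SOME w. (w, u) \<in> A \<and> (\<forall>i. u \<in> level A v (Suc i) \<longrightarrow> w \<in> level A v i))"

lemma level_unique: "u \<in> level A v i \<Longrightarrow> u \<in> level A v j \<Longrightarrow> i = j"
  by (cases i j rule: linorder_cases) (auto simp: level_def)

lemma level_cases: "(v, u) \<in> A ^^ n \<Longrightarrow> \<exists>i\<le>n. u \<in> level A v i"
proof (induction n rule: less_induct)
  case (less n)
  show ?case
  proof (cases "\<forall>j<n. (v, u) \<notin> A ^^ j")
    case True
    then show ?thesis using less.prems by (auto simp: level_def)
  next
    case False
    then obtain j where "j < n" "(v, u) \<in> A ^^ j" by blast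
    then obtain i where "i \<le> j" "u \<in> level A v i" using less.IH by blast
    then show ?thesis using \<open>j < n\<close> by (intro exI[of _ i]) auto
  qed
qed

lemma parent:
  assumes "u \<in> level A v (Suc i)"
  shows "(parent A v u, u) \<in> A" "parent A v u \<in> level A v i"
proof -
  obtain w where w: "(v, w) \<in> A ^^ i" "(w, u) \<in> A" using assms by (auto simp: level_def)
  have "(v, w) \<notin> A ^^ j" if "j < i" for j
  proof
    assume "(v, w) \<in> A ^^ j"
    then have "(v, u) \<in> A ^^ Suc j" using w(2) by auto
    then show False using assms that by (auto simp: level_def simp del: relpow.simps)
  qed
  then have "w \<in> level A v i" using w(1) by (simp add: level_def)
  then have "\<exists>w. (w, u) \<in> A \<and> (\<forall>i. u \<in> level A v (Suc i) \<longrightarrow> w \<in> level A v i)"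
    using w(2) level_unique[OF assms] by blast
  from someI_ex[OF this] show "(parent A v u, u) \<in> A" "parent A v u \<in> level A v i"
    using assms by (auto simp: parent_def)
qed

lemma parent_funpow:
  "u \<in> level A v t \<Longrightarrow> i \<le> t \<Longrightarrow> (parent A v ^^ i) u \<in> level A v (t - i)"
proof (induction i)
  case (Suc i)
  then have "(parent A v ^^ i) u \<in> level A v (Suc (t - Suc i))" by (simp add: Suc_diff_Suc)
  from parent(2)[OF this] show ?case by simp
qed simp

lemma parent_funpow_arc:
  assumes "u \<in> level A v t" "i < t"
  shows "((parent A v ^^ Suc i) u, (parent A v ^^ i) u) \<in> A"
proof -
  have "(parent A v ^^ i) u \<in> level A v (Suc (t - Suc i))"
    using parent_funpow[OF assms(1), of i] assms(2) by (simp add: Suc_diff_Suc)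
  from parent(1)[OF this] show ?thesis by simp
qed

lemma level_0: "level A v 0 = {v}"
  by (auto simp: level_def)

lemma successively_map_upt:
  "successively P (map f [a..<b]) \<longleftrightarrow> (\<forall>i. a \<le> i \<and> Suc i < b \<longrightarrow> P (f i) (f (Suc i)))"
proof
  assume *: "successively P (map f [a..<b])"
  show "\<forall>i. a \<le> i \<and> Suc i < b \<longrightarrow> P (f i) (f (Suc i))"
  proof safe
    fix i assume "a \<le> i" "Suc i < b"
    then show "P (f i) (f (Suc i))"
      using successively_nth[OF *, of "i - a"] by (auto simp: Suc_diff_le)
  qed
qed (auto simp: successively_conv_nth)

text \<open>
  Two vertices of the same level have tree paths that first meet \<open>h\<close> levels above; together with a path
  between them that avoids the lower levels they form a cycle.
\<close>

lemma bfs_cycle: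
  assumes "sym A" "y \<in> level A v t" "y' \<in> level A v t" "h \<ge> 1" "h \<le> t"
    and meet: "(parent A v ^^ h) y = (parent A v ^^ h) y'"
    and least: "\<And>i. i < h \<Longrightarrow> (parent A v ^^ i) y \<noteq> (parent A v ^^ i) y'"
    and zs: "distinct zs" "successively (\<lambda>x y. (x, y) \<in> A) zs" "zs \<noteq> []" "hd zs = y" "last zs = y'" "length zs \<ge> 2"
    and high: "\<And>z j. z \<in> set zs \<Longrightarrow> j < t \<Longrightarrow> z \<notin> level A v j"
  shows "\<exists>xs. cyc A xs \<and> length xs = length zs + 2 * h - 1"
proof -
  let ?p = "\<lambda>i u. (parent A v ^^ i) u"
  \<comment> \<open>\<open>up\<close> contains the meeting vertex at height \<open>h\<close>,
    \<open>down\<close> stops just short of it. Together they add \<open>h + (h - 1)\<close>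
    vertices to \<open>zs\<close>.\<close>
  define up where "up = map (\<lambda>i. ?p i y') [1..<Suc h]"
  define down where "down = map (\<lambda>i. ?p i y) [1..<h]"
  have symA: "(b, a) \<in> A" if "(a, b) \<in> A" for a b using assms(1) that by (simp add: sym_def)
  have lev: "?p i y \<in> level A v (t - i)" "?p i y' \<in> level A v (t - i)" if "i \<le> t" for i
    using parent_funpow assms(2,3) that by metis+
  have arc: "(?p (Suc i) y, ?p i y) \<in> A" "(?p (Suc i) y', ?p i y') \<in> A" if "i < t" for i
    using parent_funpow_arc assms(2,3) that by metis+
  have inj: "i = j" if "?p i a = ?p j b" "i \<le> t" "j \<le> t" "a = y \<or> a = y'" "b = y \<or> b = y'" for i j a b
  proof -
    have "?p i a \<in> level A v (t - i)" using lev[of i] that(2,4) by auto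
    moreover have "?p i a \<in> level A v (t - j)" unfolding that(1) using lev[of j] that(3,5) by auto
    ultimately have "t - i = t - j" by (rule level_unique)
    then show ?thesis using that(2,3) by simp
  qed
  let ?xs = "zs @ up @ rev down"
  have "distinct up" using inj assms(5) by (auto simp: up_def distinct_map inj_on_def)
  moreover have "distinct down" using inj assms(5) by (auto simp: down_def distinct_map inj_on_def)
  moreover have "set up \<inter> set down = {}"
  proof (rule ccontr)
    assume "set up \<inter> set down \<noteq> {}"
    then obtain z where z: "z \<in> set up" "z \<in> set down" by blast
    from z(1) obtain i where i: "1 \<le> i" "i \<le> h" "z = ?p i y'" by (auto simp: up_def)
    from z(2) obtain j where j: "1 \<le> j" "j < h" "z = ?p j y" by (auto simp: down_def)
    note ij = i(1,2) j(1,2) i(3)[symmetric, unfolded j(3), symmetric]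
    then have "i = j" using inj[of i y' j y] assms(5) by simp
    then show False using least[of i] ij by simp
  qed
  moreover have "z \<notin> set up \<union> set down" if "z \<in> set zs" for z
  proof
    assume "z \<in> set up \<union> set down"
    then obtain i where "1 \<le> i" "i \<le> h" "z = ?p i y \<or> z = ?p i y'" by (auto simp: up_def down_def)
    then have "z \<in> level A v (t - i)" "t - i < t" using lev[of i] assms(4,5) by auto
    then show False using high that by blast
  qed
  ultimately have dist: "distinct ?xs" using zs(1) by auto
  have "successively (\<lambda>x y. (x, y) \<in> A) up"
    unfolding up_def successively_map_upt
  proof (intro allI impI)
    fix i assume "1 \<le> i \<and> Suc i < Suc h"
    then show "(?p i y', ?p (Suc i) y') \<in> A" using symA[OF arc(2)[of i]] assms(5) by simp
  qed
  moreover have "successively (\<lambda>x y. (x, y) \<in> A) (rev down)"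
    unfolding down_def successively_rev successively_map_upt
  proof (intro allI impI)
    fix i assume "1 \<le> i \<and> Suc i < h"
    then show "(?p (Suc i) y, ?p i y) \<in> A" using arc(1)[of i] assms(5) by simp
  qed
  moreover have up_ne: "up \<noteq> []" "hd up = parent A v y'" "last up = ?p h y"
  proof -
    show "up \<noteq> []" using assms(4) by (simp add: up_def)
    show "hd up = parent A v y'" using assms(4) by (simp add: up_def hd_map del: upt_Suc)
    show "last up = ?p h y" using assms(4) meet by (simp add: up_def last_map)
  qed
  moreover have hd_down: "hd (rev down) = ?p (h - 1) y" "last (rev down) = parent A v y" if "down \<noteq> []"
  proof -
    have "1 < h" using that by (simp add: down_def)
    then show "hd (rev down) = ?p (h - 1) y" "last (rev down) = parent A v y"
      by (simp_all add: down_def hd_rev last_rev last_map hd_map)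
  qed
  moreover have "(last up, ?p (h - 1) y) \<in> A" using arc(1)[of "h - 1"] assms(4,5) up_ne(3) by simp
  moreover have yp: "(y', parent A v y') \<in> A" using symA[OF arc(2)[of 0]] assms(4,5) by simp
  ultimately have "successively (\<lambda>x y. (x, y) \<in> A) (up @ rev down)" "hd (up @ rev down) = parent A v y'"
    by (cases "down = []"; simp add: successively_append_iff)+
  then have succ: "successively (\<lambda>x y. (x, y) \<in> A) ?xs"
    using zs yp up_ne by (subst successively_append_iff) simp
  have close: "(last ?xs, hd ?xs) \<in> A"
  proof -
    have 0: "(parent A v y, y) \<in> A" using arc(1)[of 0] assms(4,5) by simp
    show ?thesis
    proof (cases "down = []")
      case True
      then have "h = 1" using assms(4) by (auto simp: down_def)
      then show ?thesis using 0 up_ne True zs by simp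
    next
      case False
      then show ?thesis using 0 hd_down[OF False] zs by simp
    qed
  qed
  have len: "length ?xs = length zs + 2 * h - 1" using assms(4) by (simp add: up_def down_def)
  then have "cyc A ?xs" using dist succ close zs(6) assms(4) by (simp add: cyc_def)
  then show ?thesis using len by blast
qed

definition no_forbidden_cycle :: "('a \<times> 'a) set \<Rightarrow> nat \<Rightarrow> bool" where
  "no_forbidden_cycle A t \<longleftrightarrow> (\<forall>xs. cyc A xs \<longrightarrow> length xs \<notin> forbidden_lengths t)"

text \<open>Tree paths meet at the root \<open>v\<close> at the latest, and the first meeting closes
  a cycle. For \<open>zs\<close> with an odd number of vertices this cycle is even, so the forbidden
  lengths restrict \<open>h\<close>.\<close>

lemma meeting_height:
  assumes "sym A" "no_forbidden_cycle A t" "y \<in> level A v t" "y' \<in> level A v t"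
    and zs: "distinct zs" "successively (\<lambda>x y. (x, y) \<in> A) zs" "hd zs = y" "last zs = y'" "length zs \<ge> 2"
    and high: "\<And>z j. z \<in> set zs \<Longrightarrow> j < t \<Longrightarrow> z \<notin> level A v j"
  shows "\<exists>h\<ge>1. h \<le> t \<and> (parent A v ^^ h) y = (parent A v ^^ h) y' \<and>
    (\<forall>i<h. (parent A v ^^ i) y \<noteq> (parent A v ^^ i) y') \<and> length zs + 2 * h - 1 \<notin> forbidden_lengths t"
proof -
  let ?Q = "\<lambda>h. (parent A v ^^ h) y = (parent A v ^^ h) y'"
  have "y \<noteq> y'"
  proof
    assume "y = y'"
    obtain a b bs where "zs = a # b # bs" using zs(5) by (cases zs; cases "tl zs") auto
    then have ws: "zs = y # b # bs" using zs(3) by simp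
    then have "y \<in> set (b # bs)" using zs(4) \<open>y = y'\<close> last_in_set[of "b # bs"] by simp
    then show False using zs(1) ws by simp
  qed
  have "(parent A v ^^ t) y = v" "(parent A v ^^ t) y' = v"
    using parent_funpow[OF assms(3), of t] parent_funpow[OF assms(4), of t] by (simp_all add: level_0)
  then have t: "?Q t" by simp
  define h where "h = (LEAST h. ?Q h)"
  have h: "?Q h" "h \<le> t" "\<And>i. i < h \<Longrightarrow> \<not> ?Q i"
    using LeastI[of ?Q, OF t] Least_le[of ?Q, OF t] not_less_Least[of _ ?Q] by (auto simp: h_def)
  have "h \<ge> 1" using \<open>y \<noteq> y'\<close> h(1) by (cases h) auto
  moreover have "length zs + 2 * h - 1 \<notin> forbidden_lengths t"
  proof -
    have "zs \<noteq> []" using zs(5) by auto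
    from bfs_cycle[OF assms(1,3,4) \<open>h \<ge> 1\<close> h(2,1,3) zs(1,2) this zs(3,4,5) high]
    obtain xs where "cyc A xs" "length xs = length zs + 2 * h - 1" by blast
    then show ?thesis using assms(2) unfolding no_forbidden_cycle_def by metis
  qed
  ultimately show ?thesis using h by blast
qed

lemma pick_outside:
  assumes "c < card S" "length xs \<le> c"
  shows "\<exists>x\<in>S. x \<notin> set xs"
proof -
  have "\<not> S \<subseteq> set xs"
    using assms card_mono[of "set xs" S] card_length[of xs] by auto
  then show ?thesis by blast
qed

text \<open>
  If \<open>H\<close> and \<open>Y\<close> induced a bipartite graph of large minimum degree, then the ends of its paths of length 2
  have meeting height at most 2, so that the ends of its paths of length 4 are siblings.  All vertices
  of \<open>Y\<close> on a suitable path of length 6 are then siblings, and this path closes to an 8-cycle.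
\<close>

lemma no_dense_pair_above_level:
  assumes "sym A" "\<And>x. (x, x) \<notin> A" "no_forbidden_cycle A t" "t \<ge> 2"
    and Y: "Y \<subseteq> level A v t" "Y \<noteq> {}"
    and H: "\<And>h j. h \<in> H \<Longrightarrow> j < t \<Longrightarrow> h \<notin> level A v j"
    and degY: "\<And>y. y \<in> Y \<Longrightarrow> 10 < card {h \<in> H. (h, y) \<in> A}"
    and degH: "\<And>h. h \<in> H \<Longrightarrow> 10 < card {y \<in> Y. (h, y) \<in> A}"
  shows False
proof -
  let ?par = "parent A v"
  have symA: "(b, a) \<in> A" if "(a, b) \<in> A" for a b using assms(1) that by (simp add: sym_def)
  have lev: "y \<in> level A v t" if "y \<in> Y" for y using Y that by blast
  have lows: "z \<notin> level A v j" if "z \<in> Y \<union> H" "j < t" for z j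
  proof (cases "z \<in> Y")
    case True
    then show ?thesis using level_unique[OF lev[OF True], of j] that(2) by auto
  next
    case False
    then show ?thesis using that H by simp
  qed
  have pickH: "\<exists>h\<in>H. (h, y) \<in> A \<and> (y, h) \<in> A \<and> h \<notin> set xs" if mem: "y \<in> Y" and len: "length xs \<le> 10" for y xs
  proof -
    obtain h where "h \<in> {h \<in> H. (h, y) \<in> A}" "h \<notin> set xs"
      using pick_outside[OF degY[OF mem] len] by blast
    then show ?thesis using symA[of h y] by auto
  qed
  have pickY: "\<exists>y\<in>Y. (h, y) \<in> A \<and> (y, h) \<in> A \<and> y \<notin> set xs" if mem: "h \<in> H" and len: "length xs \<le> 10" for h xs
  proof -
    obtain y where "y \<in> {y \<in> Y. (h, y) \<in> A}" "y \<notin> set xs"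
      using pick_outside[OF degH[OF mem] len] by blast
    then show ?thesis using symA[of h y] by auto
  qed
  obtain y0 where y0: "y0 \<in> Y" using Y by blast
  obtain r0 where r0: "r0 \<in> H" "(r0, y0) \<in> A" "(y0, r0) \<in> A" "r0 \<notin> set [y0]"
    using pickH[OF y0, of "[y0]"] by auto
  obtain y1 where y1: "y1 \<in> Y" "(r0, y1) \<in> A" "(y1, r0) \<in> A" "y1 \<notin> set [y0, r0]"
    using pickY[OF r0(1), of "[y0, r0]"] by auto
  \<comment> \<open>\<open>P5\<close> below only compares ends of paths of length 4, hence
    \<open>y0\<close> with \<open>y2\<close> and \<open>y1\<close> with \<open>y3\<close>. The two
    classes are linked off the main path through \<open>y1'\<close>, a further neighbour of
    \<open>r0\<close>, and \<open>z\<close>, reached from \<open>y0\<close> via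
    \<open>r'\<close>.\<close>
  obtain y1' where y1': "y1' \<in> Y" "(r0, y1') \<in> A" "(y1', r0) \<in> A" "y1' \<notin> set [y0, r0, y1]"
    using pickY[OF r0(1), of "[y0, r0, y1]"] by auto
  obtain r1 where r1: "r1 \<in> H" "(r1, y1) \<in> A" "(y1, r1) \<in> A" "r1 \<notin> set [y0, r0, y1, y1']"
    using pickH[OF y1(1), of "[y0, r0, y1, y1']"] by auto
  obtain y2 where y2: "y2 \<in> Y" "(r1, y2) \<in> A" "(y2, r1) \<in> A" "y2 \<notin> set [y0, r0, y1, y1', r1]"
    using pickY[OF r1(1), of "[y0, r0, y1, y1', r1]"] by auto
  \<comment> \<open>The cycle has length \<open>2 * h + 2 \<le> 2 * t + 2\<close>. Only 4 and, for
    \<open>t \<ge> 3\<close>, also 6 are allowed; for \<open>t = 2\<close> the length 6 is excluded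
    and leaves \<open>h = 1\<close>.\<close>
  have P3: "?par (?par a) = ?par (?par b) \<and> (t = 2 \<longrightarrow> ?par a = ?par b)"
    if "a \<in> Y" "b \<in> Y" "r \<in> H" "distinct [a, r, b]" "(a, r) \<in> A" "(r, b) \<in> A" for a r b
  proof -
    obtain h where h: "h \<ge> 1" "h \<le> t" "(?par ^^ h) a = (?par ^^ h) b" "3 + 2 * h - 1 \<notin> forbidden_lengths t"
    proof -
      have "\<exists>h\<ge>1. h \<le> t \<and> (?par ^^ h) a = (?par ^^ h) b \<and>
          (\<forall>i<h. (?par ^^ i) a \<noteq> (?par ^^ i) b) \<and> length [a, r, b] + 2 * h - 1 \<notin> forbidden_lengths t"
        by (rule meeting_height[OF assms(1,3) lev[OF \<open>a \<in> Y\<close>] lev[OF \<open>b \<in> Y\<close>]])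
          (use \<open>distinct [a, r, b]\<close> \<open>(a, r) \<in> A\<close> \<open>(r, b) \<in> A\<close> \<open>a \<in> Y\<close> \<open>b \<in> Y\<close> \<open>r \<in> H\<close> lows in auto)
      then obtain h where "h \<ge> 1" "h \<le> t" "(?par ^^ h) a = (?par ^^ h) b" "length [a, r, b] + 2 * h - 1 \<notin> forbidden_lengths t"
        by blast
      then show thesis by (intro that[of h]) (simp_all add: eval_nat_numeral)
    qed
    then have "h = 1 \<or> h = 2 \<and> t \<noteq> 2" using assms(4) by (auto simp: forbidden_lengths_def split: if_splits)
    then show ?thesis using h(3) by (auto simp: numeral_2_eq_2)
  qed
  \<comment> \<open>Two applications of \<open>P3\<close> give a common grandparent, so
    \<open>h \<le> 2\<close> and the cycle has length 6 or 8. For \<open>t \<ge> 3\<close> the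
    8-cycle is forbidden, leaving \<open>h = 1\<close>. For \<open>t = 2\<close> parents already
    agree and the forbidden 6-cycle appears, so such paths exist only if
    \<open>t \<noteq> 2\<close>.\<close>
  have P5: "?par a = ?par b \<and> t \<noteq> 2"
    if "a \<in> Y" "b \<in> Y" "c \<in> Y" "r \<in> H" "s \<in> H" "distinct [a, r, c, s, b]"
      "(a, r) \<in> A" "(r, c) \<in> A" "(c, s) \<in> A" "(s, b) \<in> A" for a r c s b
  proof -
    obtain h where h: "h \<ge> 1" "h \<le> t" "(?par ^^ h) a = (?par ^^ h) b" "5 + 2 * h - 1 \<notin> forbidden_lengths t"
      "\<And>i. i < h \<Longrightarrow> (?par ^^ i) a \<noteq> (?par ^^ i) b"
    proof -
      have "\<exists>h\<ge>1. h \<le> t \<and> (?par ^^ h) a = (?par ^^ h) b \<and>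
          (\<forall>i<h. (?par ^^ i) a \<noteq> (?par ^^ i) b) \<and> length [a, r, c, s, b] + 2 * h - 1 \<notin> forbidden_lengths t"
        by (rule meeting_height[OF assms(1,3) lev[OF \<open>a \<in> Y\<close>] lev[OF \<open>b \<in> Y\<close>]])
          (use \<open>distinct [a, r, c, s, b]\<close> \<open>(a, r) \<in> A\<close> \<open>(r, c) \<in> A\<close> \<open>(c, s) \<in> A\<close> \<open>(s, b) \<in> A\<close>
            \<open>a \<in> Y\<close> \<open>b \<in> Y\<close> \<open>c \<in> Y\<close> \<open>r \<in> H\<close> \<open>s \<in> H\<close> lows in auto)
      then obtain h where "h \<ge> 1" "h \<le> t" "(?par ^^ h) a = (?par ^^ h) b"
        "length [a, r, c, s, b] + 2 * h - 1 \<notin> forbidden_lengths t"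
        "\<And>i. i < h \<Longrightarrow> (?par ^^ i) a \<noteq> (?par ^^ i) b"
        by blast
      then show thesis by (intro that[of h]) (simp_all add: eval_nat_numeral)
    qed
    have "?par (?par a) = ?par (?par b)" "t = 2 \<longrightarrow> ?par a = ?par b"
      using P3[of a c r] P3[of c b s] that by auto
    then have "\<not> 2 < h" "t = 2 \<longrightarrow> \<not> 1 < h" using h(5)[of 2] h(5)[of 1] by (auto simp: numeral_2_eq_2)
    then have "h = 1 \<and> t \<noteq> 2"
      using h(1,2,4) assms(4) by (cases "h = 1"; cases "h = 2") (auto simp: forbidden_lengths_def split: if_splits)
    then show ?thesis using h(3) by simp
  qed
  obtain r2 where r2: "r2 \<in> H" "(r2, y2) \<in> A" "(y2, r2) \<in> A" "r2 \<notin> set [y0, r0, y1, y1', r1, y2]"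
    using pickH[OF y2(1), of "[y0, r0, y1, y1', r1, y2]"] by auto
  obtain y3 where y3: "y3 \<in> Y" "(r2, y3) \<in> A" "(y3, r2) \<in> A" "y3 \<notin> set [y0, r0, y1, y1', r1, y2, r2]"
    using pickY[OF r2(1), of "[y0, r0, y1, y1', r1, y2, r2]"] by auto
  obtain r' where r': "r' \<in> H" "(r', y0) \<in> A" "(y0, r') \<in> A" "r' \<notin> set [y0, r0, y1, y1']"
    using pickH[OF y0, of "[y0, r0, y1, y1']"] by auto
  obtain z where z: "z \<in> Y" "(r', z) \<in> A" "(z, r') \<in> A" "z \<notin> set [y0, r0, y1, y1', r']"
    using pickY[OF r'(1), of "[y0, r0, y1, y1', r']"] by auto
  note facts = y0 r0 y1 y1' r1 y2 r2 y3 r' z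
  have t2: "t \<noteq> 2" and e1: "?par y0 = ?par y2" using P5[of y0 y2 y1 r0 r1] facts by auto
  have e2: "?par y1' = ?par y2" using P5[of y1' y2 y1 r0 r1] facts by auto
  have e3: "?par y1 = ?par z" using P5[of y1 z y0 r0 r'] facts by auto
  have e4: "?par y1' = ?par z" using P5[of y1' z y0 r0 r'] facts by auto
  have e5: "?par y1 = ?par y3" using P5[of y1 y3 y2 r1 r2] facts by auto
  have eq: "?par y0 = ?par y3" using e1 e2 e3 e4 e5 by simp
  obtain h where h: "h \<ge> 1" "7 + 2 * h - 1 \<notin> forbidden_lengths t"
    "\<And>i. i < h \<Longrightarrow> (?par ^^ i) y0 \<noteq> (?par ^^ i) y3"
  proof -
    have "\<exists>h\<ge>1. h \<le> t \<and> (?par ^^ h) y0 = (?par ^^ h) y3 \<and>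
        (\<forall>i<h. (?par ^^ i) y0 \<noteq> (?par ^^ i) y3) \<and>
        length [y0, r0, y1, r1, y2, r2, y3] + 2 * h - 1 \<notin> forbidden_lengths t"
      by (rule meeting_height[OF assms(1,3) lev[OF y0] lev[OF y3(1)]]) (use facts lows in auto)
    then obtain h where "h \<ge> 1" "\<And>i. i < h \<Longrightarrow> (?par ^^ i) y0 \<noteq> (?par ^^ i) y3"
      "length [y0, r0, y1, r1, y2, r2, y3] + 2 * h - 1 \<notin> forbidden_lengths t" by blast
    then show thesis by (intro that[of h]) (simp_all add: eval_nat_numeral)
  qed
  have "\<not> 1 < h" using h(3)[of 1] eq by auto
  then have "h = 1" using h(1) by simp
  then show False using h(2) t2 assms(4) by (simp add: forbidden_lengths_def)
qed

text \<open>With no subgraph of minimum degree above 10 there are at most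
  \<open>10 * (card H + card Y)\<close> arcs, where \<open>H\<close> denotes the heavy vertices and
  \<open>Y\<close> the level. The threshold 20 is twice this 10: every heavy vertex carries 20 arcs,
  so the term in \<open>card H\<close> is absorbed.\<close>

lemma card_heavy_arcs_le:
  assumes V: "finite V" "A \<subseteq> V \<times> V" and sym: "sym A" and irr: "\<And>x. (x, x) \<notin> A"
    and t: "t \<ge> 2" "no_forbidden_cycle A t"
  shows "card {(r, x) \<in> A. x \<in> level A v t \<and> (\<forall>j<t. r \<notin> level A v j) \<and> 20 \<le> card (A `` {r} \<inter> level A v t)}
    \<le> 20 * card (level A v t)"
proof -
  let ?Y = "level A v t"
  let ?H = "{r \<in> V. (\<forall>j<t. r \<notin> level A v j) \<and> 20 \<le> card (A `` {r} \<inter> ?Y)}"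
  have "(A ^^ t) `` {v} \<subseteq> V" if "t > 0"
    using that V(2) by (cases t) auto
  then have finY: "finite ?Y" using t V(1) by (auto simp: level_def intro: finite_subset)
  have finH: "finite ?H" using V(1) by simp
  have finN: "finite (A `` {r} \<inter> ?Y)" for r using finY by simp
  have W: "{(r, x) \<in> A. x \<in> ?Y \<and> (\<forall>j<t. r \<notin> level A v j) \<and> 20 \<le> card (A `` {r} \<inter> ?Y)} = A \<inter> ?H \<times> ?Y"
    using V(2) by auto
  have "card (A \<inter> ?H \<times> ?Y) \<le> 10 * (card ?H + card ?Y)"
  proof (rule ccontr)
    assume "\<not> ?thesis"
    then have "10 * (card ?H + card ?Y) < card (A \<inter> ?H \<times> ?Y)" by simp
    from dense_subgraph[OF finH finY this] obtain H Y where HY: "H \<subseteq> ?H" "Y \<subseteq> ?Y" "Y \<noteq> {}"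
      "\<And>h. h \<in> H \<Longrightarrow> 10 < card {y \<in> Y. (h, y) \<in> A}" "\<And>y. y \<in> Y \<Longrightarrow> 10 < card {h \<in> H. (h, y) \<in> A}"
      by blast
    show False
      by (rule no_dense_pair_above_level[OF sym irr t(2,1) HY(2,3) _ HY(5,4)]) (use HY(1) in auto)
  qed
  moreover have "20 * card ?H \<le> card (A \<inter> ?H \<times> ?Y)"
  proof -
    have "20 * card ?H = (\<Sum>r\<in>?H. 20)" by simp
    also have "\<dots> \<le> (\<Sum>r\<in>?H. card (A `` {r} \<inter> ?Y))" by (intro sum_mono) auto
    also have "\<dots> = card (SIGMA r:?H. A `` {r} \<inter> ?Y)" using finH finN by (subst card_SigmaI) auto
    also have "(SIGMA r:?H. A `` {r} \<inter> ?Y) = A \<inter> ?H \<times> ?Y" by auto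
    finally show ?thesis .
  qed
  moreover have "c \<le> 20 * b" if "c \<le> 10 * (a + b)" "20 * a \<le> c" for a b c :: nat using that by presburger
  ultimately show ?thesis unfolding W by blast
qed

text \<open>The trivial count is of order \<open>d ^ (2 * t)\<close>; a factor \<open>d\<close> must
  be saved. It is immediate if an end is closer to \<open>v\<close> than \<open>t\<close> or the
  ends are joined by fewer than \<open>t\<close> steps. Otherwise consider the first vertex
  \<open>r\<close> of the walk from \<open>x\<close> to \<open>y\<close>: arcs from low or heavy
  \<open>r\<close> into level \<open>t\<close> number only \<open>O(d ^ t)\<close>, while a light
  \<open>r\<close> leaves fewer than 20 choices for \<open>x\<close>.\<close>

lemma sparse_power_neighbourhood:
  fixes A :: "('a \<times> 'a) set" and t d :: nat
  defines "R \<equiv> {(x, y). x \<noteq> y \<and> (\<exists>n\<le>t. (x, y) \<in> A ^^ n)}"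
  assumes V: "finite V" "A \<subseteq> V \<times> V" and sym: "sym A" and irr: "\<And>x. (x, x) \<notin> A"
    and deg: "\<And>v. v \<in> V \<Longrightarrow> card (A `` {v}) \<le> d" and d: "d \<ge> 1"
    and t: "t \<ge> 2" "no_forbidden_cycle A t"
  shows "card {(x, y). (x, y) \<in> R \<and> (v, x) \<in> R \<and> (v, y) \<in> R} \<le> (2 * t * (t + 1) + 2 * t + 40) * d ^ (2 * t - 1)"
proof -
  define B where "B n x = (A ^^ n) `` {x}" for n x
  define ball where "ball m x = (\<Union>n<m. B n x)" for m x
  define Y where "Y = level A v t"
  have B: "finite (B n x)" "card (B n x) \<le> d ^ n" for n x
    using relpow_Image[OF V deg] by (simp_all add: B_def)
  have finball: "finite (ball m x)" for m x using B by (simp add: ball_def)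
  have cball: "card (ball m x) \<le> m * d ^ (m - 1)" for m x
  proof -
    have "card (ball m x) \<le> (\<Sum>n<m. card (B n x))" unfolding ball_def by (intro card_UN_le) simp
    also have "\<dots> \<le> (\<Sum>n<m. d ^ (m - 1))"
    proof (intro sum_mono)
      fix n assume "n \<in> {..<m}"
      then have "d ^ n \<le> d ^ (m - 1)" using d by (intro power_increasing) auto
      then show "card (B n x) \<le> d ^ (m - 1)" using B(2)[of n x] by linarith
    qed
    finally show ?thesis by simp
  qed
  have symB: "y \<in> B n x \<longleftrightarrow> x \<in> B n y" for x y n
    using sym_relpow[OF sym, of n] by (auto simp: B_def sym_def)
  have YB: "Y \<subseteq> B t v" by (auto simp: Y_def level_def B_def)
  have finY: "finite Y" using finite_subset[OF YB B(1)] .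
  have cY: "card Y \<le> d ^ t" using card_mono[OF B(1) YB] B(2)[of t v] by linarith
  have low: "(\<exists>j<t. r \<in> level A v j) \<longleftrightarrow> r \<in> ball t v" for r
  proof
    assume "r \<in> ball t v"
    then obtain n where "n < t" "(v, r) \<in> A ^^ n" by (auto simp: ball_def B_def)
    then show "\<exists>j<t. r \<in> level A v j" using level_cases by (metis le_less_trans)
  qed (auto simp: ball_def B_def level_def)
  define heavy where "heavy r \<longleftrightarrow> 20 \<le> card (A `` {r} \<inter> Y)" for r
  define W where "W = {(r, x) \<in> A. x \<in> Y \<and> (r \<in> ball t v \<or> heavy r)}"
  have cW: "finite W \<and> card W \<le> (t + 20) * d ^ t"
  proof -
    let ?W1 = "SIGMA r:ball t v. A `` {r}"
    let ?W2 = "{(r, x) \<in> A. x \<in> Y \<and> (\<forall>j<t. r \<notin> level A v j) \<and> 20 \<le> card (A `` {r} \<inter> Y)}"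
    have A1: "finite (A `` {r}) \<and> card (A `` {r}) \<le> d" for r using B[of 1 r] by (simp add: B_def)
    have W1: "finite ?W1 \<and> card ?W1 \<le> (t * d ^ (t - 1)) * d"
      using finball cball A1 by (intro card_Sigma_le) auto
    have "(t * d ^ (t - 1)) * d = t * d ^ t" using t(1) by (cases t) (auto simp: algebra_simps)
    moreover have "card ?W2 \<le> 20 * d ^ t"
      using card_heavy_arcs_le[OF V sym irr t, of v] cY unfolding Y_def by linarith
    moreover have "finite A" using V by (auto intro: finite_subset)
    then have "finite ?W2" by (rule rev_finite_subset) auto
    moreover have sub: "W \<subseteq> ?W1 \<union> ?W2" using low by (auto simp: W_def heavy_def)
    ultimately have fin: "finite (?W1 \<union> ?W2)" and "card ?W1 + card ?W2 \<le> t * d ^ t + 20 * d ^ t"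
      using W1 by (blast, linarith)
    moreover have "card W \<le> card ?W1 + card ?W2"
      using card_mono[OF fin sub] card_Un_le[of ?W1 ?W2] by (rule le_trans)
    ultimately have "card W \<le> t * d ^ t + 20 * d ^ t" by linarith
    then show ?thesis using finite_subset[OF sub fin] by (simp add: algebra_simps)
  qed
  \<comment> \<open>\<open>?S1\<close> and \<open>?S2\<close>: one end is low; \<open>?S3\<close>:
    the walk is short; \<open>?S4\<close>: the arc from \<open>r\<close> to \<open>x\<close> is
    chosen first, then \<open>y\<close> by \<open>t - 1\<close> steps; \<open>?S5\<close>: first
    \<open>y\<close>, then \<open>r\<close> by \<open>t - 1\<close> steps, then \<open>x\<close>
    among the few neighbours of the light \<open>r\<close>.\<close>
  let ?S1 = "SIGMA x:ball t v. ball (Suc t) x"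
  let ?S2 = "(\<lambda>(y, x). (x, y)) ` ?S1"
  let ?S3 = "SIGMA x:Y. ball t x"
  let ?S4 = "SIGMA rx:W. B (t - 1) (fst rx)"
  let ?S5 = "SIGMA yr:(SIGMA y:Y. B (t - 1) y). (if heavy (snd yr) then {} else A `` {snd yr} \<inter> Y)"
  have "{(x, y). (x, y) \<in> R \<and> (v, x) \<in> R \<and> (v, y) \<in> R} \<subseteq>
      ?S1 \<union> ?S2 \<union> ?S3 \<union> (\<lambda>((r, x), y). (x, y)) ` ?S4 \<union> (\<lambda>((y, r), x). (x, y)) ` ?S5"
  proof
    fix p assume "p \<in> {(x, y). (x, y) \<in> R \<and> (v, x) \<in> R \<and> (v, y) \<in> R}"
    then obtain x y where p: "p = (x, y)" and xy: "(x, y) \<in> R" "(v, x) \<in> R" "(v, y) \<in> R" by blast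
    from xy(1) obtain n where n: "n \<le> t" "y \<in> B n x" by (auto simp: R_def B_def)
    have Y: "z \<in> Y" if "(v, z) \<in> R" "z \<notin> ball t v" for z
    proof -
      obtain m where "m \<le> t" "(v, z) \<in> A ^^ m" using \<open>(v, z) \<in> R\<close> by (auto simp: R_def)
      then obtain i where "i \<le> t" "z \<in> level A v i" using level_cases by (metis le_trans)
      moreover have "\<not> i < t" using low[of z] \<open>z \<notin> ball t v\<close> \<open>z \<in> level A v i\<close> by blast
      ultimately show ?thesis by (simp add: Y_def)
    qed
    consider "x \<in> ball t v" | "y \<in> ball t v" | "x \<notin> ball t v" "y \<notin> ball t v" "n < t"
      | "x \<notin> ball t v" "y \<notin> ball t v" "n = t" using n(1) by linarith
    then show "p \<in> ?S1 \<union> ?S2 \<union> ?S3 \<union> (\<lambda>((r, x), y). (x, y)) ` ?S4 \<union> (\<lambda>((y, r), x). (x, y)) ` ?S5"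
    proof cases
      case 1
      have "y \<in> ball (Suc t) x" using n unfolding ball_def by (auto simp: less_Suc_eq_le)
      then have "p \<in> ?S1" using 1 p by blast
      then show ?thesis by blast
    next
      case 2
      have "x \<in> ball (Suc t) y" using n symB unfolding ball_def by (auto simp: less_Suc_eq_le)
      then have "(y, x) \<in> ?S1" using 2 by blast
      then have "p \<in> ?S2" unfolding p by (rule rev_image_eqI) simp
      then show ?thesis by blast
    next
      case 3
      have "y \<in> ball t x" using n 3 unfolding ball_def by auto
      then have "p \<in> ?S3" using 3 Y xy p by blast
      then show ?thesis by blast
    next
      case 4
      have "(x, y) \<in> A ^^ Suc (t - 1)" using n 4 t(1) by (simp add: B_def)
      then obtain r where "(x, r) \<in> A" "(r, y) \<in> A ^^ (t - 1)" by (meson relpow_Suc_D2)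
      then have r: "(r, x) \<in> A" "y \<in> B (t - 1) r" using sym by (auto simp: B_def sym_def)
      show ?thesis
      proof (cases "r \<in> ball t v \<or> heavy r")
        case True
        then have "((r, x), y) \<in> ?S4" using r Y[OF xy(2)] 4 by (auto simp: W_def)
        then have "p \<in> (\<lambda>((r, x), y). (x, y)) ` ?S4" unfolding p by (rule rev_image_eqI) simp
        then show ?thesis by blast
      next
        case False
        then have "((y, r), x) \<in> ?S5" using r Y[OF xy(2)] Y[OF xy(3)] 4 symB[of y "t - 1" r] by auto
        then have "p \<in> (\<lambda>((y, r), x). (x, y)) ` ?S5" unfolding p by (rule rev_image_eqI) simp
        then show ?thesis by blast
      qed
    qed
  qed
  note sub = this
  have c1: "finite ?S1 \<and> card ?S1 \<le> (t * d ^ (t - 1)) * (Suc t * d ^ t)"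
    using finball cball cball[of "Suc t"] by (intro card_Sigma_le) auto
  have c3: "finite ?S3 \<and> card ?S3 \<le> d ^ t * (t * d ^ (t - 1))"
    using finball cball finY cY by (intro card_Sigma_le) auto
  have c4: "finite ?S4 \<and> card ?S4 \<le> ((t + 20) * d ^ t) * d ^ (t - 1)"
    using cW B by (intro card_Sigma_le) auto
  have c5: "finite ?S5 \<and> card ?S5 \<le> (d ^ t * d ^ (t - 1)) * 20"
  proof (rule card_Sigma_le)
    show "finite (SIGMA y:Y. B (t - 1) y)" "card (SIGMA y:Y. B (t - 1) y) \<le> d ^ t * d ^ (t - 1)"
      using card_Sigma_le[of Y "d ^ t" "B (t - 1)" "d ^ (t - 1)"] finY cY B by auto
  qed (use finY in \<open>auto simp: heavy_def not_le\<close>)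
  have D: "d ^ (2 * t - 1) = d ^ (t - 1) * d ^ t" using t(1) by (simp flip: power_add add: mult_2)
  have "card {(x, y). (x, y) \<in> R \<and> (v, x) \<in> R \<and> (v, y) \<in> R}
      \<le> card (?S1 \<union> ?S2 \<union> ?S3 \<union> (\<lambda>((r, x), y). (x, y)) ` ?S4 \<union> (\<lambda>((y, r), x). (x, y)) ` ?S5)"
    by (intro card_mono sub finite_UnI finite_imageI) (use c1 c3 c4 c5 in auto)
  also have "\<dots> \<le> card ?S1 + card ?S1 + card ?S3 + card ?S4 + card ?S5"
    by (intro order_trans[OF card_Un_le] add_mono card_image_le order_refl) (use c1 c4 c5 in auto)
  also have "\<dots> \<le> (2 * t * (t + 1) + 2 * t + 40) * (d ^ (t - 1) * d ^ t)"
    using c1 c3 c4 c5 by (simp add: algebra_simps)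
  finally show ?thesis unfolding D .
qed

section \<open>The upper bound\<close>

lemma eventually_power_le_two_power: "\<forall>\<^sub>F n in sequentially. real n ^ k \<le> 2 ^ n"
proof -
  have "((\<lambda>n. real n ^ k / 2 ^ n) \<longlongrightarrow> 0) sequentially"
    by real_asymp
  then have "\<forall>\<^sub>F n in sequentially. real n ^ k / 2 ^ n < 1" by (rule order_tendstoD) simp
  then show ?thesis by eventually_elim (simp add: field_simps)
qed

text \<open>Here \<open>c / n ^ 4\<close> bounds the mean number of edges and
  \<open>K = 12 * t\<close>, so both bad events have probability \<open>O(1 / n ^ (48 * t))\<close>.
  The number of dependencies is of order \<open>n ^ (24 * t)\<close>, the square of a degree of
  order \<open>n ^ (12 * t)\<close>.\<close>

lemma eventually_splitting_probability:
  fixes t :: nat and c :: real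
  assumes "t \<ge> 1" "c \<ge> 0"
  shows "\<forall>\<^sub>F n in sequentially. 4 * ((1 / 2) ^ (n ^ 4) + (c / real n ^ 4) ^ (12 * t)) *
    ((real t + 2) * (2 * real n) ^ (12 * t))\<^sup>2 \<le> 1"
proof -
  define M where "M = 4 * (1 + c ^ (12 * t)) * (real t + 2)\<^sup>2 * 2 ^ (24 * t)"
  have "\<forall>\<^sub>F n in sequentially. M \<le> real n"
    using filterlim_real_sequentially by (simp add: filterlim_at_top)
  moreover have "\<forall>\<^sub>F n in sequentially. n \<ge> (1 :: nat)" by (rule eventually_ge_at_top)
  ultimately show ?thesis using eventually_power_le_two_power[of "48 * t"]
  proof eventually_elim
    case (elim n)
    have n0: "real n > 0" using elim by simp
    have "(1 / 2) ^ (n ^ 4) \<le> (1 / 2 :: real) ^ n"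
      using elim by (intro power_decreasing) (auto intro: self_le_power)
    also have "\<dots> \<le> 1 / real n ^ (48 * t)"
      using elim(3) n0 by (simp add: power_one_over field_simps)
    finally have 1: "(1 / 2) ^ (n ^ 4) \<le> 1 / real n ^ (48 * t)" .
    have 2: "(c / real n ^ 4) ^ (12 * t) = c ^ (12 * t) / real n ^ (48 * t)"
      by (simp add: power_divide flip: power_mult)
    have 3: "((real t + 2) * (2 * real n) ^ (12 * t))\<^sup>2 = (real t + 2)\<^sup>2 * 2 ^ (24 * t) * real n ^ (24 * t)"
      by (simp add: power_mult_distrib flip: power_mult)
    have "4 * ((1 / 2) ^ (n ^ 4) + (c / real n ^ 4) ^ (12 * t)) * ((real t + 2) * (2 * real n) ^ (12 * t))\<^sup>2
      \<le> 4 * (1 / real n ^ (48 * t) + c ^ (12 * t) / real n ^ (48 * t)) * ((real t + 2)\<^sup>2 * 2 ^ (24 * t) * real n ^ (24 * t))"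
      unfolding 2 3 using 1 by (intro mult_right_mono mult_left_mono add_right_mono) auto
    also have "\<dots> = M * (real n ^ (24 * t) / real n ^ (48 * t))"
      by (simp add: M_def add_divide_distrib[symmetric])
    also have "real n ^ (24 * t) / real n ^ (48 * t) = 1 / real n ^ (24 * t)"
    proof -
      have "real n ^ (48 * t) = real n ^ (24 * t) * real n ^ (24 * t)" by (simp flip: power_add)
      then show ?thesis using n0 by simp
    qed
    also have "M * (1 / real n ^ (24 * t)) \<le> 1"
    proof -
      have "real n ^ 1 \<le> real n ^ (24 * t)" using elim assms by (intro power_increasing) auto
      then have "M \<le> real n ^ (24 * t)" using elim(1) by (metis order_trans power_one_right)
      then show ?thesis using n0 by simp
    qed
    finally show ?case .
  qed
qed

lemma chromatic_number_le: "proper_colouring G k f \<Longrightarrow> chromatic_number G \<le> k"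
  unfolding chromatic_number_def by (blast intro: Least_le)

lemma chromatic_number_graph_power_upper:
  assumes "pair_graph G" "max_degree_le G d" "\<forall>l\<in>forbidden_lengths t. \<not> has_cycle_of_length G l"
    and t: "t \<ge> 2" and d: "d \<ge> 1" and pos: "q > 0" "r > 0" and q: "6 * ((t + 1) * d ^ t) \<le> q * r"
    and p: "4 * ((1 / 2) ^ q + (real ((2 * t * (t + 1) + 2 * t + 40) * d ^ (2 * t - 1)) / (real r)\<^sup>2) ^ K) *
      (real ((t + 1) * d ^ t) + 1)\<^sup>2 \<le> 1"
    and colourable: "\<And>V (Q :: ('a \<times> 'a) set). finite V \<Longrightarrow> Q \<subseteq> V \<times> V \<Longrightarrow> sym Q \<Longrightarrow> (\<And>v. (v, v) \<notin> Q) \<Longrightarrow>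
      (\<And>x y z. (x, y) \<in> Q \<Longrightarrow> (y, z) \<in> Q \<Longrightarrow> (x, z) \<notin> Q) \<Longrightarrow> (\<And>v. v \<in> V \<Longrightarrow> card (Q `` {v}) \<le> q) \<Longrightarrow>
      \<exists>f :: 'a \<Rightarrow> nat. (\<forall>v\<in>V. f v < k) \<and> (\<forall>(u, v)\<in>Q. f u \<noteq> f v)"
  shows "chromatic_number (graph_power (G :: 'a pair_pre_digraph) t) \<le> r * (4 * K + 1) * k"
proof -
  interpret pair_graph G by fact
  let ?V = "pverts G" and ?A = "parcs G"
  define R where "R = {(x, y). x \<noteq> y \<and> (\<exists>n\<le>t. (x, y) \<in> ?A ^^ n)}"
  have V: "finite ?V" "?A \<subseteq> ?V \<times> ?V"
    using pair_finite_verts in_arcsD1 in_arcsD2 by auto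
  have sym: "sym ?A" using pair_sym_arcs by (auto simp: symmetric_def)
  have irr: "(x, x) \<notin> ?A" for x using no_loops' by blast
  have deg: "card (?A `` {v}) \<le> d" if "v \<in> ?V" for v
    using assms(2) that by (simp add: max_degree_le_def out_degree_eq[OF assms(1)])
  have nfc: "no_forbidden_cycle ?A t"
    using assms(3) has_cycle_of_cyc[OF assms(1)] by (auto simp: no_forbidden_cycle_def)
  have RV: "R \<subseteq> ?V \<times> ?V"
  proof
    fix e assume "e \<in> R"
    then obtain x y n where e: "e = (x, y)" "x \<noteq> y" "(x, y) \<in> ?A ^^ n" by (auto simp: R_def)
    then obtain m where "n = Suc m" by (cases n) auto
    then have "(\<exists>z. (x, z) \<in> ?A) \<and> (\<exists>z. (z, y) \<in> ?A)"
      using e(3) by (metis relpow_Suc_D2 relpow_Suc_E)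
    then show "e \<in> ?V \<times> ?V" using V(2) e(1) by auto
  qed
  have R: "parcs (graph_power G t) = R"
    using RV unfolding parcs_graph_power[OF assms(1)] R_def by auto
  have symR: "sym R" using sym_relpow[OF sym] unfolding R_def sym_def by blast
  have degR: "card (R `` {v}) \<le> (t + 1) * d ^ t" for v
  proof -
    have "R `` {v} \<subseteq> (\<Union>n\<le>t. (?A ^^ n) `` {v})" by (auto simp: R_def)
    then have "card (R `` {v}) \<le> card (\<Union>n\<le>t. (?A ^^ n) `` {v})"
      using relpow_Image[OF V deg] by (intro card_mono) auto
    also have "\<dots> \<le> (\<Sum>n\<le>t. card ((?A ^^ n) `` {v}))" by (rule card_UN_le) simp
    also have "\<dots> \<le> (\<Sum>n\<le>t. d ^ t)"
    proof (intro sum_mono)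
      fix n assume "n \<in> {..t}"
      then have "d ^ n \<le> d ^ t" using d by (intro power_increasing) auto
      then show "card ((?A ^^ n) `` {v}) \<le> d ^ t" using relpow_Image[OF V deg, of n v] by linarith
    qed
    finally show ?thesis by simp
  qed
  have sparse: "card {(x, y). (x, y) \<in> R \<and> (v, x) \<in> R \<and> (v, y) \<in> R} \<le> (2 * t * (t + 1) + 2 * t + 40) * d ^ (2 * t - 1)" for v
    unfolding R_def by (rule sparse_power_neighbourhood[OF V sym irr deg d t nfc])
  have irrR: "(v, v) \<notin> R" for v by (simp add: R_def)
  have "\<exists>f :: 'a \<Rightarrow> nat. (\<forall>v\<in>?V. f v < r * (4 * K + 1) * k) \<and> (\<forall>(u, v)\<in>R. f u \<noteq> f v)"
    by (rule sparse_colouring[OF V(1) RV symR irrR degR sparse pos q p colourable[OF V(1)]])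
  then obtain f :: "'a \<Rightarrow> nat" where "\<forall>v\<in>?V. f v < r * (4 * K + 1) * k" "\<forall>(u, v)\<in>R. f u \<noteq> f v" by blast
  then have "proper_colouring (graph_power G t) (r * (4 * K + 1) * k) f"
    unfolding proper_colouring_def R by (simp add: graph_power_def)
  then show ?thesis by (rule chromatic_number_le)
qed

lemma filterlim_floor_root: "filterlim (\<lambda>d. nat \<lfloor>root 12 (real d)\<rfloor>) at_top sequentially"
  by real_asymp

text \<open>Between consecutive twelfth powers \<open>d\<close> varies by a bounded factor. About
  \<open>d ^ t / n ^ 4\<close> classes with \<open>O(n ^ 4 / ln n)\<close> colours each give
  \<open>O(d ^ t / ln n)\<close>, and \<open>ln n\<close> is comparable to
  \<open>ln d\<close>.\<close>

lemma F_upper: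
  assumes t: "t \<ge> 2"
  shows "\<exists>C>0. \<forall>\<^sub>F d in sequentially. real (F t d) \<le> C * (real d ^ t / ln (real d))"
proof -
  define c where "c = real (2 * t * (t + 1) + 2 * t + 40)"
  \<comment> \<open>\<open>6 * (t + 1)\<close> comes from \<open>r\<close>, and
    \<open>48 * t + 1\<close> is \<open>4 * K + 1\<close> with \<open>K = 12 * t\<close>. The rest
    is \<open>192 = 2 * 4 * 24\<close>: rounding in \<open>r\<close>, the palette, and
    \<open>ln d \<le> 24 * ln n\<close>.\<close>
  define C where "C = real (6 * (t + 1) * (48 * t + 1)) * 192"
  have t1: "t \<ge> 1" and c0: "c \<ge> 0" using t by (simp_all add: c_def)
  have "\<forall>\<^sub>F n in sequentially. 3 * real n ^ 4 / ln n + 1 \<le> 4 * real n ^ 4 / ln n" by real_asymp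
  moreover have "\<forall>\<^sub>F n in sequentially. n \<ge> (2 :: nat)" by (rule eventually_ge_at_top)
  ultimately have ev: "\<forall>\<^sub>F n in sequentially. \<forall>d. n ^ 12 \<le> d \<and> d < (n + 1) ^ 12 \<longrightarrow>
      real (F t d) \<le> C * (real d ^ t / ln (real d))"
    using eventually_splitting_probability[OF t1 c0]
      eventually_triangle_free_colouring[where 'v = nat]
  proof eventually_elim
    case (elim n)
    show ?case
    proof (intro allI impI)
      fix d assume d: "n ^ 12 \<le> d \<and> d < (n + 1) ^ 12"
      have n0: "real n > 0" "ln (real n) > 0" using elim(2) by auto
      have nd: "n \<le> d" using self_le_power[of n 12] elim(2) d by linarith
      have d1: "d \<ge> 1" using nd elim(2) by simp
      \<comment> \<open>The quotient is rounded up so that \<open>n ^ 4 * r\<close> is at least 6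
        times the degree bound \<open>(t + 1) * d ^ t\<close> of the power.\<close>
      define r where "r = 6 * (t + 1) * (d ^ t div n ^ 4 + 1)"
      have n4: "n ^ 4 > 0" using elim(2) by simp
      have dt: "d ^ t < n ^ 4 * (d ^ t div n ^ 4 + 1)"
        using n4 by (metis Suc_eq_plus1 dividend_less_times_div mult_Suc_right add.commute)
      have q: "6 * ((t + 1) * d ^ t) \<le> n ^ 4 * r"
      proof -
        have "6 * (t + 1) * d ^ t \<le> 6 * (t + 1) * (n ^ 4 * (d ^ t div n ^ 4 + 1))" 
          using dt by (intro mult_left_mono) auto
        then show ?thesis by (simp add: r_def algebra_simps)
      qed
      have r0: "r > 0" by (simp add: r_def)
      have dn: "real d \<le> (2 * real n) ^ 12"
      proof -
        have "real d \<le> real ((n + 1) ^ 12)" using d by (intro of_nat_mono) auto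
        also have "\<dots> \<le> (2 * real n) ^ 12" unfolding of_nat_power using elim(2) by (intro power_mono) auto
        finally show ?thesis .
      qed
      have rr: "real d ^ t / real n ^ 4 \<le> real r"
      proof -
        have "real d ^ t \<le> real n ^ 4 * real (d ^ t div n ^ 4 + 1)"
          using of_nat_mono[OF less_imp_le[OF dt], where 'a = real] by (simp add: algebra_simps)
        then have "real d ^ t / real n ^ 4 \<le> real (d ^ t div n ^ 4 + 1)" using n0 by (simp add: field_simps)
        also have "d ^ t div n ^ 4 + 1 \<le> r"
        proof -
          have "1 * (d ^ t div n ^ 4 + 1) \<le> 6 * (t + 1) * (d ^ t div n ^ 4 + 1)"
            by (intro mult_right_mono) simp_all
          then show ?thesis unfolding r_def by (simp only: mult_1)
        qed
        finally show ?thesis by simp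
      qed
      have p: "4 * ((1 / 2) ^ (n ^ 4) + (real ((2 * t * (t + 1) + 2 * t + 40) * d ^ (2 * t - 1)) / (real r)\<^sup>2) ^ (12 * t)) *
        (real ((t + 1) * d ^ t) + 1)\<^sup>2 \<le> 1"
      proof -
        have "real ((2 * t * (t + 1) + 2 * t + 40) * d ^ (2 * t - 1)) / (real r)\<^sup>2
          \<le> c * real d ^ (2 * t - 1) / (real d ^ t / real n ^ 4)\<^sup>2"
        proof -
          have "0 < (real r)\<^sup>2 * (real d ^ t / real n ^ 4)\<^sup>2" using r0 n0 d1 by simp
          then have "c * real d ^ (2 * t - 1) / (real r)\<^sup>2 \<le> c * real d ^ (2 * t - 1) / (real d ^ t / real n ^ 4)\<^sup>2"
            using rr n0 by (intro divide_left_mono power_mono) (auto simp: c_def)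
          then show ?thesis by (simp only: of_nat_mult of_nat_power c_def)
        qed
        also have "\<dots> = c * real n ^ 8 / real d"
        proof -
          have "(real d ^ t)\<^sup>2 = real d ^ (2 * t - 1) * real d"
          proof -
            have "(real d ^ t)\<^sup>2 = real d ^ (2 * t)" by (simp add: mult.commute flip: power_mult)
            also have "2 * t = Suc (2 * t - 1)" using t by simp
            finally show ?thesis by (simp only: power_Suc2)
          qed
          then show ?thesis using d1 n0 by (simp add: power_divide flip: power_mult)
        qed
        also have "\<dots> \<le> c * real n ^ 8 / real n ^ 12"
        proof (intro divide_left_mono)
          show "real n ^ 12 \<le> real d" using d by (metis of_nat_mono of_nat_power)
        qed (use n0 d1 in \<open>auto simp: c_def\<close>)
        also have "\<dots> = c / real n ^ 4"
        proof -
          have "real n ^ 12 = real n ^ 8 * real n ^ 4" by (simp flip: power_add)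
          moreover have "c * x / (x * y) = c / y" if "x \<noteq> 0" for x y :: real using that by simp
          then have "c * real n ^ 8 / (real n ^ 8 * real n ^ 4) = c / real n ^ 4"
            using n0 by (metis zero_less_power less_irrefl)
          ultimately show ?thesis by simp
        qed
        finally have 1: "real ((2 * t * (t + 1) + 2 * t + 40) * d ^ (2 * t - 1)) / (real r)\<^sup>2 \<le> c / real n ^ 4" .
        have "real ((t + 1) * d ^ t) + 1 \<le> (real t + 1) * real d ^ t + real d ^ t"
          using one_le_power[of "real d" t] d1 by (simp add: algebra_simps)
        also have "\<dots> = (real t + 2) * real d ^ t" by (simp add: algebra_simps)
        also have "\<dots> \<le> (real t + 2) * ((2 * real n) ^ 12) ^ t"
          using dn by (intro mult_left_mono power_mono) auto
        finally have 2: "real ((t + 1) * d ^ t) + 1 \<le> (real t + 2) * (2 * real n) ^ (12 * t)"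
          by (simp add: power_mult)
        have "4 * ((1 / 2) ^ (n ^ 4) + (real ((2 * t * (t + 1) + 2 * t + 40) * d ^ (2 * t - 1)) / (real r)\<^sup>2) ^ (12 * t)) *
          (real ((t + 1) * d ^ t) + 1)\<^sup>2 \<le> 4 * ((1 / 2) ^ (n ^ 4) + (c / real n ^ 4) ^ (12 * t)) *
            ((real t + 2) * (2 * real n) ^ (12 * t))\<^sup>2"
          by (intro mult_mono add_mono power_mono 1 2 order_refl) (auto simp: c_def)
        also have "\<dots> \<le> 1" using elim(3) by (simp add: c_def)
        finally show ?thesis .
      qed
      obtain G :: "nat pair_pre_digraph" where G: "admissible t d G" "chromatic_number (graph_power G t) = F t d"
        using F_attained by blast
      have "chromatic_number (graph_power G t) \<le> r * (4 * (12 * t) + 1) * palette n"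
        by (rule chromatic_number_graph_power_upper[OF _ _ _ t d1 n4 r0 q p])
          (use G(1) elim(4) in \<open>auto simp: admissible_def\<close>)
      then have "real (F t d) \<le> real (r * (4 * (12 * t) + 1)) * real (palette n)"
        unfolding G(2) by (metis of_nat_le_iff of_nat_mult)
      also have "\<dots> \<le> (real (6 * (t + 1) * (48 * t + 1)) * (2 * real d ^ t / real n ^ 4)) * (4 * real n ^ 4 / ln n)"
      proof (intro mult_mono)
        have "real (d ^ t div n ^ 4) \<le> real d ^ t / real n ^ 4"
          using of_nat_div_le_of_nat[where 'a = real, of "d ^ t" "n ^ 4"] by simp
        moreover have "1 \<le> real d ^ t / real n ^ 4"
        proof -
          have "real n ^ 4 \<le> real n ^ 12" using elim(2) by (intro power_increasing) auto
          also have "\<dots> \<le> real d ^ 1" using d by (metis of_nat_mono of_nat_power power_one_right)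
          also have "\<dots> \<le> real d ^ t" using d1 t by (intro power_increasing) auto
          finally show ?thesis using n0 by simp
        qed
        ultimately have "real (d ^ t div n ^ 4 + 1) \<le> 2 * real d ^ t / real n ^ 4" by simp
        then have "real (6 * (t + 1) * (48 * t + 1)) * real (d ^ t div n ^ 4 + 1)
            \<le> real (6 * (t + 1) * (48 * t + 1)) * (2 * real d ^ t / real n ^ 4)"
          by (intro mult_left_mono) auto
        then show "real (r * (4 * (12 * t) + 1)) \<le> real (6 * (t + 1) * (48 * t + 1)) * (2 * real d ^ t / real n ^ 4)"
          by (simp add: r_def algebra_simps)
        have "real (palette n) \<le> 3 * real n ^ 4 / ln n + 1"
        proof -
          define x where "x = 3 * real n ^ 4 / ln n"
          have "x \<ge> 0" using n0 by (simp add: x_def)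
          then show ?thesis unfolding palette_def x_def[symmetric] by linarith
        qed
        then show "real (palette n) \<le> 4 * real n ^ 4 / ln n" using elim(1) by linarith
      qed auto
      also have "\<dots> = real (6 * (t + 1) * (48 * t + 1)) * 8 * (real d ^ t / ln n)"
        using n0 by (simp add: field_simps)
      also have "\<dots> \<le> real (6 * (t + 1) * (48 * t + 1)) * 8 * (real d ^ t * (24 / ln d))"
      proof -
        \<comment> \<open>Since \<open>n \<ge> 2\<close>, the bound \<open>(2 * n) ^ 12\<close> is
          at most \<open>n ^ 24\<close>.\<close>
        have "real d \<le> (real n * real n) ^ 12"
          using elim(2) by (intro order_trans[OF dn] power_mono mult_right_mono) auto
        then have "ln (real d) \<le> ln ((real n * real n) ^ 12)" using d1 n0 by (subst ln_le_cancel_iff) auto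
        also have "\<dots> = 24 * ln n" using n0 by (simp add: ln_realpow ln_mult)
        finally have "ln d \<le> 24 * ln n" .
        moreover have "ln (real d) > 0" using nd elim(2) by simp
        ultimately have "1 / ln n \<le> 24 / ln d" using n0 by (simp add: field_simps)
        then have "real d ^ t * (1 / ln n) \<le> real d ^ t * (24 / ln d)" by (intro mult_left_mono) auto
        then show ?thesis by (intro mult_left_mono) auto
      qed
      also have "\<dots> = C * (real d ^ t / ln d)" by (simp add: C_def)
      finally show "real (F t d) \<le> C * (real d ^ t / ln (real d))" .
    qed
  qed
  have "\<forall>\<^sub>F d in sequentially. real (F t d) \<le> C * (real d ^ t / ln (real d))"
    using eventually_compose_filterlim[OF ev filterlim_floor_root]
  proof eventually_elim
    case (elim d)
    let ?n = "nat \<lfloor>root 12 (real d)\<rfloor>"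
    have x: "root 12 (real d) \<ge> 0" "root 12 (real d) ^ 12 = real d" by (simp_all add: real_root_pow_pos2)
    have "real ?n \<le> root 12 (real d)" using x by simp
    then have "real ?n ^ 12 \<le> real d" using power_mono[of "real ?n" "root 12 (real d)" 12] x by simp
    then have 1: "?n ^ 12 \<le> d" by (metis of_nat_le_iff of_nat_power)
    have "root 12 (real d) < real (?n + 1)" using x by linarith
    then have "real d < real (?n + 1) ^ 12" using power_strict_mono[of "root 12 (real d)" "real (?n + 1)" 12] x by simp
    then have "d < (?n + 1) ^ 12" by (metis of_nat_less_iff of_nat_power)
    then show ?case using elim 1 by blast
  qed
  moreover have "C > 0"
  proof -
    have "0 < 6 * (t + 1) * (48 * t + 1)" by simp
    then have "0 < real (6 * (t + 1) * (48 * t + 1))" by (simp only: of_nat_0_less_iff)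
    then show ?thesis unfolding C_def by (intro mult_pos_pos) simp_all
  qed
  ultimately show ?thesis by blast
qed

section \<open>Graphs without short cycles\<close>

definition short_cycle_free :: "nat \<Rightarrow> ('a \<times> 'a) set \<Rightarrow> bool" where
  "short_cycle_free g A \<longleftrightarrow> (\<forall>xs. cyc A xs \<longrightarrow> g < length xs)"

lemma cyc_rotate:
  assumes "cyc A (us @ vs)"
  shows "cyc A (vs @ us)"
proof (cases "us = [] \<or> vs = []")
  case True
  then show ?thesis using assms by auto
next
  case False
  then show ?thesis using assms by (auto simp: cyc_def successively_append_iff)
qed

lemma relpow_of_successively:
  "successively (\<lambda>x y. (x, y) \<in> A) xs \<Longrightarrow> xs \<noteq> [] \<Longrightarrow> (hd xs, last xs) \<in> A ^^ (length xs - 1)"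
proof (induction xs)
  case (Cons x xs)
  show ?case
  proof (cases "xs = []")
    case False
    then have "(x, hd xs) \<in> A" "(hd xs, last xs) \<in> A ^^ (length xs - 1)"
      using Cons by (auto simp: successively_Cons)
    then have "(x, last xs) \<in> A ^^ Suc (length xs - 1)" by (rule relpow_Suc_I2)
    then show ?thesis using False by simp
  qed simp
qed simp

text \<open>A new cycle uses the new edge exactly once; the rest of it is a walk in \<open>A\<close>
  between \<open>x\<close> and \<open>y\<close> with one step fewer than the cycle.\<close>

lemma short_cycle_free_insert:
  assumes "sym A" "short_cycle_free g A" "\<And>n. n < g \<Longrightarrow> (x, y) \<notin> A ^^ n"
  shows "short_cycle_free g (A \<union> {(x, y), (y, x)})"
proof -
  let ?B = "A \<union> {(x, y), (y, x)}"
  have False if xs: "cyc ?B xs" "length xs \<le> g" for xs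
  proof -
    \<comment> \<open>Rotation puts an arc outside \<open>A\<close> at the closing position.\<close>
    have "\<exists>zs. cyc ?B zs \<and> length zs = length xs \<and> (last zs, hd zs) \<notin> A"
    proof (cases "(last xs, hd xs) \<in> A")
      case True
      have "\<not> successively (\<lambda>x y. (x, y) \<in> A) xs"
        using assms(2) xs True unfolding short_cycle_free_def cyc_def by fastforce
      then obtain i where i: "Suc i < length xs" "(xs ! i, xs ! Suc i) \<notin> A"
        by (auto simp: successively_conv_nth)
      let ?zs = "drop (Suc i) xs @ take (Suc i) xs"
      have "cyc ?B ?zs" using cyc_rotate[of ?B "take (Suc i) xs" "drop (Suc i) xs"] xs by simp
      moreover have "hd ?zs = xs ! Suc i" using i by (simp add: hd_drop_conv_nth)
      moreover have "last ?zs = xs ! i" using i by (simp add: take_Suc_conv_app_nth)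
      ultimately show ?thesis using i by (intro exI[of _ ?zs]) simp
    qed (use xs in blast)
    then obtain zs where zs: "cyc ?B zs" "length zs = length xs" "(last zs, hd zs) \<notin> A" by blast
    have len: "length zs \<ge> 3" and dist: "distinct zs" and B: "(last zs, hd zs) \<in> ?B"
      using zs(1) by (auto simp: cyc_def)
    have hl: "hd zs = zs ! 0" "last zs = zs ! (length zs - 1)"
    proof -
      have "zs \<noteq> []" using len by auto
      then show "hd zs = zs ! 0" "last zs = zs ! (length zs - 1)" by (rule hd_conv_nth, rule last_conv_nth)
    qed
    have "successively (\<lambda>x y. (x, y) \<in> A) zs"
      unfolding successively_conv_nth
    proof (intro allI impI)
      fix i assume i: "Suc i < length zs"
      show "(zs ! i, zs ! Suc i) \<in> A"
      proof (rule ccontr)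
        assume "(zs ! i, zs ! Suc i) \<notin> A"
        moreover have "(zs ! i, zs ! Suc i) \<in> ?B"
          using zs(1) i unfolding cyc_def by (auto dest: successively_nth)
        \<comment> \<open>A second arc outside \<open>A\<close> would have the same two ends as the
          closing arc, which is impossible for distinct vertices on a cycle of length at least
          3.\<close>
        ultimately have "{zs ! i, zs ! Suc i} = {zs ! (length zs - 1), zs ! 0}" using B zs(3) hl by auto
        then have "zs ! i = zs ! 0 \<and> zs ! Suc i = zs ! (length zs - 1) \<or> zs ! Suc i = zs ! 0"
          by (auto simp: doubleton_eq_iff)
        then show False
        proof
          assume *: "zs ! i = zs ! 0 \<and> zs ! Suc i = zs ! (length zs - 1)"
          have "i < length zs" "0 < length zs" "length zs - 1 < length zs" using i by auto
          then have "i = 0" "Suc i = length zs - 1"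
            using * nth_eq_iff_index_eq[OF dist] i by blast+
          then show False using len by simp
        next
          assume *: "zs ! Suc i = zs ! 0"
          have "0 < length zs" using i by auto
          then have "Suc i = 0" using * nth_eq_iff_index_eq[OF dist] i by blast
          then show False by simp
        qed
      qed
    qed
    then have "(hd zs, last zs) \<in> A ^^ (length zs - 1)" using len by (intro relpow_of_successively) auto
    moreover have "(x, y) = (hd zs, last zs) \<or> (x, y) = (last zs, hd zs)" using B zs(3) by auto
    ultimately have "(x, y) \<in> A ^^ (length zs - 1)" using sym_relpow[OF assms(1)] by (auto dest: symD)
    moreover have "length zs - 1 < g" using zs(2) xs(2) len by linarith
    ultimately show False using assms(3) by blast
  qed
  then show ?thesis unfolding short_cycle_free_def by (meson not_le)
qed

text \<open>After the common initial part is stripped off, the first vertex of \<open>p\<close> that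
  lies on \<open>q\<close> closes a cycle with the initial pieces of both.\<close>

lemma two_paths_cycle:
  assumes "sym A" "distinct (v # p)" "distinct (v # q)" "last (v # p) = last (v # q)" "p \<noteq> q"
    and "successively (\<lambda>x y. (x, y) \<in> A) (v # p)" "successively (\<lambda>x y. (x, y) \<in> A) (v # q)"
  shows "\<exists>xs. cyc A xs \<and> length xs \<le> length p + length q"
  using assms(2-)
proof (induction p arbitrary: v q)
  case Nil
  then have "q \<noteq> []" "last q = v" by auto
  then show ?case using Nil.prems last_in_set[of q] by auto
next
  case (Cons a p)
  have symA: "(y, x) \<in> A" if "(x, y) \<in> A" for x y using assms(1) that by (simp add: sym_def)
  have "q \<noteq> []"
  proof
    assume "q = []"
    then have "last (a # p) = v" using Cons.prems(3) by simp
    then show False using Cons.prems(1) last_in_set[of "a # p"] by auto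
  qed
  then obtain b q' where q: "q = b # q'" by (cases q) auto
  show ?case
  proof (cases "a = b")
    case True
    have "\<exists>xs. cyc A xs \<and> length xs \<le> length p + length q'"
      by (rule Cons.IH[of a]) (use Cons.prems q True in auto)
    then show ?thesis using q by auto
  next
    case False
    have "last (a # p) \<in> set (a # p)" "last (a # p) \<in> set q"
      using Cons.prems(3) q last_in_set[of "a # p"] last_in_set[of q] by auto
    then have "\<exists>z\<in>set (a # p). z \<in> set q" by blast
    then obtain p1 z p2 where p: "a # p = p1 @ z # p2" "z \<in> set q" "\<forall>w\<in>set p1. w \<notin> set q"
      using split_list_first_prop[of "a # p" "\<lambda>z. z \<in> set q"] by blast
    obtain q1 q2 where q12: "q = q1 @ z # q2" using p(2) split_list by metis
    let ?xs = "v # p1 @ z # rev q1"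
    have "distinct ?xs" using Cons.prems(1,2) p(1,3) q12 unfolding p(1) by auto
    moreover have "length ?xs \<ge> 3"
    proof (rule ccontr)
      assume "\<not> ?thesis"
      moreover have "length ?xs = 2 + (length p1 + length q1)" by simp
      ultimately have "length p1 + length q1 = 0" by linarith
      then have "p1 = []" "q1 = []" by simp_all
      then show False using p(1) q12 q False by simp
    qed
    moreover have "successively (\<lambda>x y. (x, y) \<in> A) ?xs"
    proof -
      have "successively (\<lambda>x y. (x, y) \<in> A) ((v # p1 @ [z]) @ p2)" using Cons.prems(5) p(1) by simp
      then have 1: "successively (\<lambda>x y. (x, y) \<in> A) (v # p1 @ [z])" unfolding successively_append_iff by blast
      have "successively (\<lambda>x y. (x, y) \<in> A) (v # q1 @ [z] @ q2)" using Cons.prems(6) q12 by simp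
      then have "successively (\<lambda>x y. (x, y) \<in> A) ([v] @ (q1 @ [z]) @ q2)" by simp
      then have "successively (\<lambda>x y. (x, y) \<in> A) (q1 @ [z])" unfolding successively_append_iff by blast
      then have "successively (\<lambda>x y. (y, x) \<in> A) (q1 @ [z])"
        by (rule successively_mono) (auto intro: symA)
      then have "successively (\<lambda>x y. (x, y) \<in> A) (rev (q1 @ [z]))" by (simp only: successively_rev)
      then have 2: "successively (\<lambda>x y. (x, y) \<in> A) (z # rev q1)" by simp
      have "?xs = (v # p1 @ [z]) @ rev q1" by simp
      then show ?thesis using 1 2 by (cases p1) (auto simp: successively_append_iff successively_Cons hd_append)
    qed
    moreover have "(last ?xs, hd ?xs) \<in> A"
    proof (cases q1)
      case Nil
      then show ?thesis using Cons.prems(6) q12 symA by (auto simp: successively_Cons)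
    next
      case (Cons c cs)
      then show ?thesis using \<open>successively (\<lambda>x y. (x, y) \<in> A) (v # q)\<close> q12 symA by (auto simp: successively_Cons)
    qed
    ultimately have "cyc A ?xs" by (simp add: cyc_def)
    moreover have "length p = length p1 + length p2" using arg_cong[OF p(1), of length] by simp
    then have "length ?xs \<le> length (a # p) + length q" using q12 by simp
    ultimately show ?thesis by blast
  qed
qed

section \<open>Spheres in almost regular graphs without short cycles\<close>

definition paths_from :: "('a \<times> 'a) set \<Rightarrow> nat \<Rightarrow> 'a \<Rightarrow> 'a list set" where
  "paths_from A j v = {xs. length xs = Suc j \<and> hd xs = v \<and> distinct xs \<and> successively (\<lambda>x y. (x, y) \<in> A) xs}"

definition ends_from :: "('a \<times> 'a) set \<Rightarrow> nat \<Rightarrow> 'a \<Rightarrow> 'a set" where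
  "ends_from A j v = last ` paths_from A j v"

lemma ends_from_relpow: "ends_from A j v \<subseteq> (A ^^ j) `` {v}"
proof
  fix x assume "x \<in> ends_from A j v"
  then obtain xs where xs: "xs \<in> paths_from A j v" "x = last xs" by (auto simp: ends_from_def)
  then have "xs \<noteq> []" by (auto simp: paths_from_def)
  then show "x \<in> (A ^^ j) `` {v}"
    using relpow_of_successively[of A xs] xs by (auto simp: paths_from_def)
qed

text \<open>A path of length below \<open>j\<close> extends in at least \<open>D - j\<close> ways,
  since at most \<open>j\<close> neighbours have been visited. Different paths of length
  \<open>j\<close> have different ends, for otherwise they would close a cycle of length at most
  \<open>2 * j \<le> g\<close>.\<close>

lemma card_ends_from_ge:
  assumes V: "finite V" "A \<subseteq> V \<times> V" and sym: "sym A" and g: "short_cycle_free g A" "2 * j \<le> g"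
    and deg: "\<And>w n. n < j \<Longrightarrow> (v, w) \<in> A ^^ n \<Longrightarrow> D \<le> card (A `` {w})"
  shows "(D - j) ^ j \<le> card (ends_from A j v)"
proof -
  have finA: "finite (A `` {w})" for w using V by (auto intro: finite_subset)
  have "finite (paths_from A i v) \<and> (D - j) ^ i \<le> card (paths_from A i v)" if "i \<le> j" for i
    using that
  proof (induction i)
    case 0
    have "paths_from A 0 v = {[v]}" by (auto simp: paths_from_def length_Suc_conv)
    then show ?case by simp
  next
    case (Suc i)
    let ?ext = "SIGMA xs:paths_from A i v. A `` {last xs} - set xs"
    have fin: "finite (paths_from A i v)" and IH: "(D - j) ^ i \<le> card (paths_from A i v)" using Suc by auto
    have eq: "paths_from A (Suc i) v = (\<lambda>(xs, y). xs @ [y]) ` ?ext"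
    proof
      show "paths_from A (Suc i) v \<subseteq> (\<lambda>(xs, y). xs @ [y]) ` ?ext"
      proof
        fix zs assume zs: "zs \<in> paths_from A (Suc i) v"
        then obtain xs y where e: "zs = xs @ [y]" by (cases zs rule: rev_cases) (auto simp: paths_from_def)
        then have "xs \<noteq> []" using zs by (auto simp: paths_from_def)
        then have "(xs, y) \<in> ?ext"
          using zs unfolding e by (auto simp: paths_from_def successively_append_iff)
        then show "zs \<in> (\<lambda>(xs, y). xs @ [y]) ` ?ext" unfolding e by (rule rev_image_eqI) simp
      qed
      show "(\<lambda>(xs, y). xs @ [y]) ` ?ext \<subseteq> paths_from A (Suc i) v"
        by (auto simp: paths_from_def successively_append_iff hd_append)
    qed
    have each: "D - j \<le> card (A `` {last xs} - set xs)" if xs: "xs \<in> paths_from A i v" for xs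
    proof -
      have "xs \<noteq> []" using xs by (auto simp: paths_from_def)
      then have "(v, last xs) \<in> A ^^ i"
        using relpow_of_successively[of A xs] xs by (auto simp: paths_from_def)
      then have "D \<le> card (A `` {last xs})" using deg[of i] Suc.prems by simp
      moreover have "card (set xs) \<le> j" using xs Suc.prems card_length[of xs] by (auto simp: paths_from_def)
      ultimately show ?thesis using diff_card_le_card_Diff[of "set xs" "A `` {last xs}"] by simp
    qed
    have "(D - j) ^ Suc i \<le> (\<Sum>xs\<in>paths_from A i v. D - j)" using IH by (simp add: mult.commute)
    also have "\<dots> \<le> (\<Sum>xs\<in>paths_from A i v. card (A `` {last xs} - set xs))" by (intro sum_mono each)
    also have "\<dots> = card ?ext" using fin finA by (subst card_SigmaI) auto
    also have "\<dots> = card (paths_from A (Suc i) v)"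
      unfolding eq by (intro card_image[symmetric]) (auto simp: inj_on_def)
    finally show ?case unfolding eq using fin finA by auto
  qed
  then have "(D - j) ^ j \<le> card (paths_from A j v)" by blast
  also have "\<dots> = card (ends_from A j v)"
    unfolding ends_from_def
  proof (intro card_image[symmetric] inj_onI)
    fix p q assume pq: "p \<in> paths_from A j v" "q \<in> paths_from A j v" "last p = last q"
    obtain p' q' where e: "p = v # p'" "q = v # q'" using pq by (cases p; cases q) (auto simp: paths_from_def)
    show "p = q"
    proof (rule ccontr)
      assume "p \<noteq> q"
      then have "\<exists>xs. cyc A xs \<and> length xs \<le> length p' + length q'"
        using pq e by (intro two_paths_cycle[OF sym, of v]) (auto simp: paths_from_def)
      moreover have "length p' + length q' \<le> g" using pq e g(2) by (auto simp: paths_from_def)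
      ultimately show False using g(1) unfolding short_cycle_free_def by (meson le_trans not_le)
    qed
  qed
  finally show ?thesis .
qed

lemma card_insert_arc_le:
  assumes "finite (A `` {v})" "v = x \<or> v = y \<Longrightarrow> card (A `` {v}) < D" "card (A `` {v}) \<le> D" "x \<noteq> y"
  shows "card ((A \<union> {(x, y), (y, x)}) `` {v}) \<le> D"
proof (cases "v = x \<or> v = y")
  case True
  let ?w = "if v = x then y else x"
  have "(A \<union> {(x, y), (y, x)}) `` {v} \<subseteq> insert ?w (A `` {v})" using assms(4) True by auto
  then have "card ((A \<union> {(x, y), (y, x)}) `` {v}) \<le> card (insert ?w (A `` {v}))"
    using assms(1) by (intro card_mono) auto
  also have "\<dots> \<le> Suc (card (A `` {v}))" by (rule card_insert_le_m1[THEN order_trans]) (use assms(1) in \<open>auto simp: card_insert_if\<close>)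
  finally show ?thesis using assms(2) True by linarith
next
  case False
  then have "(A \<union> {(x, y), (y, x)}) `` {v} = A `` {v}" by auto
  then show ?thesis using assms(3) by simp
qed

lemma card_short_walk_ends_le:
  assumes "finite V" "A \<subseteq> V \<times> V" "\<And>v. v \<in> V \<Longrightarrow> card (A `` {v}) \<le> D" "D \<ge> 1"
  shows "finite (\<Union>n<m. (A ^^ n) `` {x}) \<and> card (\<Union>n<m. (A ^^ n) `` {x}) \<le> m * D ^ m"
proof -
  note B = relpow_Image[OF assms(1-3)]
  have "card (\<Union>n<m. (A ^^ n) `` {x}) \<le> (\<Sum>n<m. card ((A ^^ n) `` {x}))" by (rule card_UN_le) simp
  also have "\<dots> \<le> (\<Sum>n<m. D ^ m)"
  proof (intro sum_mono)
    fix n assume "n \<in> {..<m}"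
    then have "D ^ n \<le> D ^ m" using assms(4) by (intro power_increasing) auto
    then show "card ((A ^^ n) `` {x}) \<le> D ^ m" using B[of n x] by linarith
  qed
  finally show ?thesis using B by simp
qed

text \<open>
  In an edge-maximal graph of maximum degree at most \<open>D\<close> without short cycles, any two vertices of
  smaller degree are joined by a short walk, so there are only boundedly many of them.
\<close>

lemma almost_regular_graph:
  assumes "finite V" "g \<ge> 2" "D \<ge> 1"
  shows "\<exists>A. A \<subseteq> V \<times> V \<and> sym A \<and> (\<forall>v. (v, v) \<notin> A) \<and> short_cycle_free g A \<and> (\<forall>v. card (A `` {v}) \<le> D) \<and>
    card {v \<in> V. card (A `` {v}) < D} \<le> g * D ^ g"
proof -
  let ?F = "{A. A \<subseteq> V \<times> V \<and> sym A \<and> (\<forall>v. (v, v) \<notin> A) \<and> short_cycle_free g A \<and> (\<forall>v. card (A `` {v}) \<le> D)}"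
  have "finite ?F" by (rule finite_subset[of _ "Pow (V \<times> V)"]) (use assms(1) in auto)
  moreover have "{} \<in> ?F" by (auto simp: short_cycle_free_def cyc_def sym_def)
  ultimately have "\<exists>A\<in>?F. \<forall>A'\<in>?F. A \<subseteq> A' \<longrightarrow> A = A'" by (intro finite_has_maximal) auto
  then obtain A where A: "A \<in> ?F" and max': "\<forall>A'\<in>?F. A \<subseteq> A' \<longrightarrow> A = A'" by (elim bexE)
  have max: "A = A'" if "A' \<in> ?F" "A \<subseteq> A'" for A' by (rule mp[OF bspec[OF max' that(1)] that(2)])
  let ?U = "{v \<in> V. card (A `` {v}) < D}"
  have finA: "finite (A `` {w})" for w using A assms(1) by (auto intro: finite_subset)
  have close: "\<exists>n<g. (x, y) \<in> A ^^ n" if "x \<in> ?U" "y \<in> ?U" for x y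
  proof (rule ccontr)
    assume far: "\<not> ?thesis"
    then have "(x, y) \<notin> A ^^ 0" using assms(2) by (metis less_le_trans zero_less_numeral)
    then have ne: "x \<noteq> y" by auto
    let ?A = "A \<union> {(x, y), (y, x)}"
    have "short_cycle_free g ?A" using A far by (intro short_cycle_free_insert) auto
    moreover have "card (?A `` {v}) \<le> D" for v
      using that A by (intro card_insert_arc_le finA ne) auto
    ultimately have "?A \<in> ?F" using A that ne by (auto simp: sym_def)
    then have "A = ?A" by (rule max) auto
    then have "(x, y) \<in> A ^^ 1" by auto
    then show False using far assms(2) by (metis less_le_trans one_less_numeral_iff semiring_norm(76))
  qed
  have "card ?U \<le> g * D ^ g"
  proof (cases "?U = {}")
    case True
    then show ?thesis by (simp only: card.empty)
  next
    case False
    then obtain x where x: "x \<in> ?U" by blast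
    have "?U \<subseteq> (\<Union>n<g. (A ^^ n) `` {x})" using close[OF x] by blast
    then show ?thesis
      using card_short_walk_ends_le[of V A D, where m = g and x = x] assms A card_mono[of "\<Union>n<g. (A ^^ n) `` {x}" ?U]
      by (auto intro: le_trans)
  qed
  then show ?thesis using A by blast
qed

section \<open>A greedy construction\<close>

lemma relpow_subset_mono: "A \<subseteq> B \<Longrightarrow> A ^^ n \<subseteq> B ^^ n" for A B :: "('a \<times> 'a) set"
  by (induction n) (simp_all add: relcomp_mono)

text \<open>
  Edges are added to \<open>B\<close> one at a time, always between vertices that are far apart and have not yet
  received \<open>D\<close> new edges.  A set of the family is alive while it may still be independent in the power:
  none of its \<open>Xa\<close>- and \<open>Xb\<close>-vertices is full and no new edge joins the two kinds.  Since the
  vertices of a live set are not full, almost all of its pairs are available, so a random available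
  edge kills it with probability at least \<open>\<delta>\<close>; the weight bounds the number of full vertices.
  Averaging over the available edges, both quantities are controlled simultaneously.
\<close>

locale greedy_construction =
  fixes V V0 :: "'a set" and B :: "('a \<times> 'a) set" and Xa Xb :: "'a \<Rightarrow> 'a set"
    and D g K s \<alpha> \<beta> :: nat
  assumes V: "finite V" "B \<subseteq> V \<times> V" "V0 \<subseteq> V"
    and symB: "sym B" and B_free: "short_cycle_free g B" and degB: "\<And>v. card (B `` {v}) \<le> D"
    and X_V: "\<And>v. v \<in> V0 \<Longrightarrow> Xa v \<subseteq> V" "\<And>v. v \<in> V0 \<Longrightarrow> Xb v \<subseteq> V"
    and card_X: "\<And>v. v \<in> V0 \<Longrightarrow> \<alpha> \<le> card (Xa v)" "\<And>v. v \<in> V0 \<Longrightarrow> \<beta> \<le> card (Xb v)"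
    and g: "g \<ge> 2" and D: "D \<ge> 1" and K: "g * (2 * D) ^ g \<le> K" "4 * K \<le> card V" "2 * K \<le> s * \<beta>"
    and pos: "s > 0" "\<alpha> > 0" "\<beta> > 0" and s_le: "s * \<alpha> \<le> card V" "s * \<beta> \<le> card V"
begin

definition N where "N = real (card V)"

definition UA where "UA S = (\<Union>v\<in>S. Xa v)"
definition UB where "UB S = (\<Union>v\<in>S. Xb v)"

definition family where
  "family = {S. S \<subseteq> V0 \<and> card S = s \<and> disjoint_family_on Xa S \<and> disjoint_family_on Xb S}"

text \<open>The last clause asks for distance in \<open>B\<close> alone. It later rules out that a
  new edge joins the \<open>Xa\<close>-sphere and the \<open>Xb\<close>-sphere of one and the same
  vertex.\<close>

definition good where
  "good M \<longleftrightarrow> M \<subseteq> V \<times> V \<and> sym M \<and> (\<forall>v. card (M `` {v}) \<le> D) \<and> short_cycle_free g (B \<union> M) \<and>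
    (\<forall>(x, y)\<in>M. \<forall>n<g. (x, y) \<notin> B ^^ n)"

definition full where "full M = {v \<in> V. D \<le> card (M `` {v})}"

definition alive where
  "alive M = {S \<in> family. UA S \<inter> full M = {} \<and> UB S \<inter> full M = {} \<and> M \<inter> UA S \<times> UB S = {}}"

text \<open>Exponential potential: a new edge at most doubles the terms of its two ends, so the
  average growth per step is a factor \<open>1 + 8 / N\<close>, whereas one full vertex already
  accounts for \<open>2 ^ D\<close>.\<close>

definition weight where "weight M = (\<Sum>v\<in>V. 2 ^ card (M `` {v}) :: real)"

definition near where "near M x = (\<Union>n<g. ((B \<union> M) ^^ n) `` {x})"

definition pairs where
  "pairs M = {(x, y). x \<in> V - full M \<and> y \<in> V - full M \<and> y \<notin> near M x}"

definition add where "add M e = M \<union> {(fst e, snd e), (snd e, fst e)}"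

lemma finite_family: "finite family"
proof (rule finite_subset)
  show "family \<subseteq> Pow V" using V(3) unfolding family_def by blast
  show "finite (Pow V)" using V(1) by simp
qed

lemma finite_pairs: "finite (pairs M)"
proof (rule finite_subset)
  show "pairs M \<subseteq> V \<times> V" unfolding pairs_def by blast
  show "finite (V \<times> V)" using V(1) by simp
qed

lemma finite_Image:
  assumes "good M"
  shows "finite (M `` {v})"
proof (rule finite_subset)
  show "M `` {v} \<subseteq> V" using assms unfolding good_def by blast
  show "finite V" by (rule V(1))
qed

lemma near:
  assumes "good M"
  shows "finite (near M x)" "card (near M x) \<le> K"
proof -
  have "card ((B \<union> M) `` {v}) \<le> 2 * D" for v
  proof -
    have "card ((B \<union> M) `` {v}) \<le> card (B `` {v}) + card (M `` {v})"
      unfolding Un_Image by (rule card_Un_le)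
    also have "\<dots> \<le> D + D" using degB assms by (intro add_mono) (auto simp: good_def)
    finally show ?thesis by simp
  qed
  then have "finite (near M x) \<and> card (near M x) \<le> g * (2 * D) ^ g"
    unfolding near_def using V assms D by (intro card_short_walk_ends_le[of V]) (auto simp: good_def)
  then show "finite (near M x)" "card (near M x) \<le> K" using K(1) by auto
qed

lemma pairsD:
  assumes "e \<in> pairs M"
  shows "fst e \<in> V" "snd e \<in> V" "card (M `` {fst e}) < D" "card (M `` {snd e}) < D" "fst e \<noteq> snd e"
    "\<And>n. n < g \<Longrightarrow> (fst e, snd e) \<notin> (B \<union> M) ^^ n"
proof -
  show "fst e \<in> V" "snd e \<in> V" "card (M `` {fst e}) < D" "card (M `` {snd e}) < D"
    using assms by (auto simp: pairs_def full_def)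
  show *: "(fst e, snd e) \<notin> (B \<union> M) ^^ n" if "n < g" for n
    using assms that by (auto simp: pairs_def near_def)
  show "fst e \<noteq> snd e"
  proof
    assume "fst e = snd e"
    then have "(fst e, snd e) \<in> (B \<union> M) ^^ 0" by (metis relpow_0_I)
    moreover have "0 < g" using g by simp
    ultimately show False using * by blast
  qed
qed

lemma good_add:
  assumes "good M" "e \<in> pairs M"
  shows "good (add M e)"
proof -
  note e = pairsD[OF assms(2)]
  have sym: "sym (B \<union> M)" using symB assms(1) by (auto simp: good_def sym_def)
  have "short_cycle_free g ((B \<union> M) \<union> {(fst e, snd e), (snd e, fst e)})"
    using assms(1) e(6) by (intro short_cycle_free_insert sym) (auto simp: good_def)
  moreover have "card (add M e `` {v}) \<le> D" for v
    unfolding add_def using assms(1) e(3,4,5)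
    by (intro card_insert_arc_le finite_Image) (auto simp: good_def)
  moreover have far: "(fst e, snd e) \<notin> B ^^ n" if "n < g" for n
  proof -
    have "B ^^ n \<subseteq> (B \<union> M) ^^ n" by (rule relpow_subset_mono) auto
    then show ?thesis using e(6)[OF that] by blast
  qed
  moreover have "(snd e, fst e) \<notin> B ^^ n" if "n < g" for n
    using far[OF that] sym_relpow[OF symB, of n] by (auto dest: symD)
  ultimately show ?thesis
    using assms(1) e(1,2) unfolding good_def add_def by (auto simp: sym_def Un_assoc mem_Times_iff)
qed

text \<open>At least three quarters of \<open>V\<close> can serve as \<open>x\<close>; for each, at
  most \<open>K\<close>, hence at most a quarter of \<open>V\<close>, is lost to nearness, and half
  of \<open>V\<close> remains for \<open>y\<close>.\<close>

lemma card_pairs: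
  assumes "good M" "4 * card (full M) \<le> card V"
  shows "N\<^sup>2 / 4 \<le> real (card (pairs M))" "real (card (pairs M)) \<le> N\<^sup>2"
proof -
  let ?W = "V - full M"
  have fW: "full M \<subseteq> V" by (auto simp: full_def)
  have finW: "finite ?W" using V(1) by simp
  have cW: "4 * card ?W \<ge> 3 * card V"
    using assms(2) card_Diff_subset[OF finite_subset[OF fW V(1)] fW] by simp
  have eq: "pairs M = (SIGMA x:?W. ?W - near M x)" by (auto simp: pairs_def)
  have each: "card V \<le> 2 * card (?W - near M x)" for x
    using diff_card_le_card_Diff[OF near(1)[OF assms(1)], of ?W x] near(2)[OF assms(1), of x] K(2) cW by linarith
  have "card V * (3 * card V) \<le> card V * (4 * card ?W)" using cW by (rule mult_left_mono) simp
  also have "\<dots> = 4 * (\<Sum>x\<in>?W. card V)" by simp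
  also have "\<dots> \<le> 4 * (\<Sum>x\<in>?W. 2 * card (?W - near M x))" by (intro mult_left_mono sum_mono each) simp
  also have "\<dots> = 8 * card (pairs M)"
    unfolding eq using finW by (subst card_SigmaI) (auto simp: sum_distrib_left)
  finally have "real (card V * (3 * card V)) \<le> real (8 * card (pairs M))" by (rule of_nat_mono)
  then show "N\<^sup>2 / 4 \<le> real (card (pairs M))" by (simp add: N_def power2_eq_square)
  have "card (pairs M) \<le> card (V \<times> V)" using V(1) by (intro card_mono) (auto simp: pairs_def)
  then have "real (card (pairs M)) \<le> real (card (V \<times> V))" by (rule of_nat_mono)
  then show "real (card (pairs M)) \<le> N\<^sup>2" by (simp add: N_def power2_eq_square card_cartesian_product)
qed

lemma full_mono:
  assumes "good M" "e \<in> pairs M"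
  shows "full M \<subseteq> full (add M e)"
proof
  fix v assume v: "v \<in> full M"
  have "card (M `` {v}) \<le> card (add M e `` {v})"
    by (intro card_mono finite_Image good_add assms) (auto simp: add_def)
  then show "v \<in> full (add M e)" using v by (simp add: full_def)
qed

lemma alive_mono:
  assumes "good M" "e \<in> pairs M"
  shows "alive (add M e) \<subseteq> alive M"
proof
  fix S assume "S \<in> alive (add M e)"
  then have S: "S \<in> family" "UA S \<inter> full (add M e) = {}" "UB S \<inter> full (add M e) = {}"
    "add M e \<inter> UA S \<times> UB S = {}" by (simp_all add: alive_def)
  have "M \<subseteq> add M e" by (auto simp: add_def)
  then have "M \<inter> UA S \<times> UB S = {}" using S(4) by blast
  moreover have "UA S \<inter> full M = {}" "UB S \<inter> full M = {}" using S(2,3) full_mono[OF assms] by blast+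
  ultimately show "S \<in> alive M" using S(1) by (simp add: alive_def)
qed

lemma card_killing_pairs:
  assumes "good M" "S \<in> alive M"
  shows "real (s * \<alpha>) * real (s * \<beta>) / 2 \<le> real (card {e \<in> pairs M. S \<notin> alive (add M e)})"
proof -
  have S: "S \<subseteq> V0" "card S = s" "disjoint_family_on Xa S" "disjoint_family_on Xb S"
    "UA S \<inter> full M = {}" "UB S \<inter> full M = {}" using assms(2) by (auto simp: alive_def family_def)
  have finS: "finite S" by (rule finite_subset[OF subset_trans[OF S(1) V(3)] V(1)])
  have UV: "UA S \<subseteq> V" "UB S \<subseteq> V"
    unfolding UA_def UB_def by (intro UN_least X_V, use S(1) in blast)+
  have finU: "finite (UA S)" "finite (UB S)" by (rule finite_subset[OF UV(1) V(1)], rule finite_subset[OF UV(2) V(1)])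
  have fX: "finite (Xa v)" "finite (Xb v)" if "v \<in> S" for v
    by (rule finite_subset[OF X_V(1)[OF subsetD[OF S(1) that]] V(1)],
        rule finite_subset[OF X_V(2)[OF subsetD[OF S(1) that]] V(1)])
  have "s * \<alpha> = (\<Sum>v\<in>S. \<alpha>)" using S(2) by simp
  also have "\<dots> \<le> (\<Sum>v\<in>S. card (Xa v))" using S(1) card_X by (intro sum_mono) auto
  also have "\<dots> = card (UA S)" unfolding UA_def using finS fX S(3)
    by (intro card_UN_disjoint[symmetric]) (auto simp: disjoint_family_on_def)
  finally have cA: "s * \<alpha> \<le> card (UA S)" .
  have "s * \<beta> = (\<Sum>v\<in>S. \<beta>)" using S(2) by simp
  also have "\<dots> \<le> (\<Sum>v\<in>S. card (Xb v))" using S(1) card_X by (intro sum_mono) auto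
  also have "\<dots> = card (UB S)" unfolding UB_def using finS fX S(4)
    by (intro card_UN_disjoint[symmetric]) (auto simp: disjoint_family_on_def)
  finally have cB: "s * \<beta> \<le> card (UB S)" .
  let ?E = "SIGMA x:UA S. UB S - near M x"
  have sub: "?E \<subseteq> {e \<in> pairs M. S \<notin> alive (add M e)}"
  proof
    fix e assume "e \<in> ?E"
    then obtain x y where e: "e = (x, y)" "x \<in> UA S" "y \<in> UB S" "y \<notin> near M x" by blast
    then have "e \<in> pairs M" using S(5,6) UV by (auto simp: pairs_def)
    moreover have "(x, y) \<in> add M e \<inter> UA S \<times> UB S" using e by (simp add: add_def)
    then have "S \<notin> alive (add M e)" unfolding alive_def by blast
    ultimately show "e \<in> {e \<in> pairs M. S \<notin> alive (add M e)}" by blast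
  qed
  have each: "s * \<beta> \<le> 2 * card (UB S - near M x)" for x
    using diff_card_le_card_Diff[OF near(1)[OF assms(1)], of "UB S" x] near(2)[OF assms(1), of x] K(3) cB by linarith
  have "(s * \<alpha>) * (s * \<beta>) \<le> card (UA S) * (s * \<beta>)" using cA by (rule mult_right_mono) simp
  also have "\<dots> = (\<Sum>x\<in>UA S. s * \<beta>)" by simp
  also have "\<dots> \<le> (\<Sum>x\<in>UA S. 2 * card (UB S - near M x))" by (intro sum_mono each)
  also have "\<dots> = 2 * card ?E" using finU by (subst card_SigmaI) (auto simp: sum_distrib_left)
  also have "\<dots> \<le> 2 * card {e \<in> pairs M. S \<notin> alive (add M e)}"
    using finite_pairs by (intro mult_left_mono card_mono sub) auto
  finally have "real ((s * \<alpha>) * (s * \<beta>)) \<le> real (2 * card {e \<in> pairs M. S \<notin> alive (add M e)})" by (rule of_nat_mono)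
  then show ?thesis by simp
qed

lemma weight_add_le:
  assumes "good M" "e \<in> pairs M"
  shows "weight (add M e) \<le> weight M + 2 ^ card (M `` {fst e}) + 2 ^ card (M `` {snd e})"
proof -
  note e = pairsD[OF assms(2)]
  have "2 ^ card (add M e `` {v}) \<le> (2 ^ card (M `` {v}) :: real) + (if v = fst e then 2 ^ card (M `` {v}) else 0) +
      (if v = snd e then 2 ^ card (M `` {v}) else 0)" for v
  proof (cases "v = fst e \<or> v = snd e")
    case True
    obtain x y where xy: "e = (x, y)" by (cases e)
    let ?w = "if v = x then y else x"
    have "add M e `` {v} \<subseteq> insert ?w (M `` {v})" using True e(5) by (auto simp: add_def xy)
    then have "card (add M e `` {v}) \<le> card (insert ?w (M `` {v}))"
      using finite_Image[OF assms(1)] by (intro card_mono) auto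
    also have "\<dots> \<le> Suc (card (M `` {v}))" using finite_Image[OF assms(1)] by (simp add: card_insert_if)
    finally have "(2::real) ^ card (add M e `` {v}) \<le> 2 ^ Suc (card (M `` {v}))" by (intro power_increasing) auto
    then show ?thesis using True e(5) by auto
  next
    case False
    then have "add M e `` {v} = M `` {v}" by (auto simp: add_def)
    then show ?thesis using False by simp
  qed
  then have "weight (add M e) \<le> (\<Sum>v\<in>V. 2 ^ card (M `` {v}) + (if v = fst e then 2 ^ card (M `` {v}) else 0) +
      (if v = snd e then 2 ^ card (M `` {v}) else 0))" unfolding weight_def by (intro sum_mono)
  also have "\<dots> = weight M + 2 ^ card (M `` {fst e}) + 2 ^ card (M `` {snd e})"
    using V(1) e(1,2) by (simp add: sum.distrib weight_def)
  finally show ?thesis .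
qed

text \<open>The lower bound on the number of killing pairs of a live set, divided by the bound
  \<open>N\<^sup>2\<close> on all available pairs.\<close>

definition \<delta> where "\<delta> = real (s * \<alpha>) * real (s * \<beta>) / (2 * N\<^sup>2)"

lemma N_pos: "N > 0"
proof -
  have "0 < s * \<alpha>" using pos by simp
  then have "0 < card V" using s_le(1) by linarith
  then show ?thesis by (simp add: N_def)
qed

lemma \<delta>: "0 < \<delta>" "\<delta> < 1"
proof -
  show "0 < \<delta>" using N_pos pos by (simp add: \<delta>_def)
  have "real (s * \<alpha>) * real (s * \<beta>) \<le> N * N"
    using s_le unfolding N_def by (intro mult_mono of_nat_mono) auto
  also have "\<dots> < 2 * N\<^sup>2" using N_pos by (simp add: power2_eq_square)
  finally show "\<delta> < 1" using N_pos by (simp add: \<delta>_def)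
qed

text \<open>An edge that kills many sets may raise the weight too much and conversely. Averaging a
  nonnegative combination yields one edge that does well for the combination; \<open>P\<close> and
  \<open>Q\<close> are fixed later by normalisation.\<close>

lemma greedy_step:
  assumes "good M" "4 * card (full M) \<le> card V" "P \<ge> 0" "Q \<ge> 0"
  shows "\<exists>M'. good M' \<and> real (card (alive M')) * P + weight M' * Q
    \<le> real (card (alive M)) * (1 - \<delta>) * P + weight M * (1 + 8 / N) * Q"
proof -
  let ?p = "real (card (pairs M))"
  note cp = card_pairs[OF assms(1,2)]
  have p0: "?p > 0" using cp(1) N_pos by (smt (verit) zero_less_power divide_pos_pos)
  have w0: "weight M \<ge> 0" by (simp add: weight_def sum_nonneg)
  have finA: "finite (alive M)" using finite_family by (simp add: alive_def)
  have "(\<Sum>e\<in>pairs M. real (card (alive (add M e)))) \<le> ?p * (real (card (alive M)) * (1 - \<delta>))"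
  proof -
    have "(\<Sum>e\<in>pairs M. card (alive (add M e))) = (\<Sum>e\<in>pairs M. \<Sum>S\<in>alive M. if S \<in> alive (add M e) then 1 else 0)"
    proof (intro sum.cong refl)
      fix e assume "e \<in> pairs M"
      then have "{S \<in> alive M. S \<in> alive (add M e)} = alive (add M e)" using alive_mono[OF assms(1)] by blast
      then show "card (alive (add M e)) = (\<Sum>S\<in>alive M. if S \<in> alive (add M e) then 1 else 0)"
        using finA by (simp flip: sum.inter_filter)
    qed
    also have "\<dots> = (\<Sum>S\<in>alive M. \<Sum>e\<in>pairs M. if S \<in> alive (add M e) then 1 else 0)" by (rule sum.swap)
    also have "\<dots> = (\<Sum>S\<in>alive M. card {e \<in> pairs M. S \<in> alive (add M e)})"
      using finite_pairs by (simp flip: sum.inter_filter)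
    finally have "(\<Sum>e\<in>pairs M. real (card (alive (add M e)))) = (\<Sum>S\<in>alive M. real (card {e \<in> pairs M. S \<in> alive (add M e)}))"
      by (simp flip: of_nat_sum)
    also have "\<dots> \<le> (\<Sum>S\<in>alive M. ?p * (1 - \<delta>))"
    proof (intro sum_mono)
      fix S assume S: "S \<in> alive M"
      have "card (pairs M) = card {e \<in> pairs M. S \<in> alive (add M e)} + card {e \<in> pairs M. S \<notin> alive (add M e)}"
        using finite_pairs by (subst card_Un_disjoint[symmetric]) (auto intro: arg_cong[where f = card])
      moreover have "?p * \<delta> \<le> N\<^sup>2 * \<delta>" using cp(2) \<delta> by (intro mult_right_mono) auto
      moreover have "N\<^sup>2 * \<delta> = real (s * \<alpha>) * real (s * \<beta>) / 2" using N_pos by (simp add: \<delta>_def)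
      ultimately show "real (card {e \<in> pairs M. S \<in> alive (add M e)}) \<le> ?p * (1 - \<delta>)"
        using card_killing_pairs[OF assms(1) S] by (simp add: algebra_simps)
    qed
    finally show ?thesis by (simp add: algebra_simps)
  qed
  moreover have "(\<Sum>e\<in>pairs M. weight (add M e)) \<le> ?p * (weight M * (1 + 8 / N))"
  proof -
    have fst: "(\<Sum>e\<in>pairs M. 2 ^ card (M `` {fst e}) :: real) \<le> N * weight M"
    proof -
      have "(\<Sum>e\<in>pairs M. 2 ^ card (M `` {fst e}) :: real) \<le> (\<Sum>e\<in>V \<times> V. 2 ^ card (M `` {fst e}))"
        using V(1) by (intro sum_mono2) (auto simp: pairs_def)
      also have "\<dots> = (\<Sum>x\<in>V. \<Sum>y\<in>V. 2 ^ card (M `` {x}))" by (subst sum.cartesian_product) (simp add: case_prod_unfold)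
      finally show ?thesis by (simp add: weight_def N_def sum_distrib_left)
    qed
    have snd: "(\<Sum>e\<in>pairs M. 2 ^ card (M `` {snd e}) :: real) \<le> N * weight M"
    proof -
      have "(\<Sum>e\<in>pairs M. 2 ^ card (M `` {snd e}) :: real) \<le> (\<Sum>e\<in>V \<times> V. 2 ^ card (M `` {snd e}))"
        using V(1) by (intro sum_mono2) (auto simp: pairs_def)
      also have "\<dots> = (\<Sum>x\<in>V. \<Sum>y\<in>V. 2 ^ card (M `` {y}))" by (subst sum.cartesian_product) (simp add: case_prod_unfold)
      finally show ?thesis by (simp add: weight_def N_def sum_distrib_left)
    qed
    have "(\<Sum>e\<in>pairs M. weight (add M e)) \<le> (\<Sum>e\<in>pairs M. weight M + 2 ^ card (M `` {fst e}) + 2 ^ card (M `` {snd e}))"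
      by (intro sum_mono weight_add_le assms(1))
    also have "\<dots> = ?p * weight M + (\<Sum>e\<in>pairs M. 2 ^ card (M `` {fst e})) + (\<Sum>e\<in>pairs M. 2 ^ card (M `` {snd e}))"
      by (simp add: sum.distrib)
    also have "\<dots> \<le> ?p * weight M + 2 * N * weight M" using fst snd by simp
    \<comment> \<open>The increments sum to at most \<open>2 * N * weight M\<close> over at least
      \<open>N\<^sup>2 / 4\<close> pairs, whence \<open>8 / N\<close>.\<close>
    also have "2 * N * weight M \<le> ?p * (8 / N) * weight M"
    proof (rule mult_right_mono[OF _ w0])
      have "2 * N = N\<^sup>2 / 4 * (8 / N)" using N_pos by (simp add: power2_eq_square)
      also have "\<dots> \<le> ?p * (8 / N)" using cp(1) N_pos by (intro mult_right_mono) auto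
      finally show "2 * N \<le> ?p * (8 / N)" .
    qed
    finally show ?thesis by (simp add: algebra_simps)
  qed
  ultimately have "(\<Sum>e\<in>pairs M. real (card (alive (add M e)))) * P + (\<Sum>e\<in>pairs M. weight (add M e)) * Q
      \<le> ?p * (real (card (alive M)) * (1 - \<delta>)) * P + ?p * (weight M * (1 + 8 / N)) * Q"
    using assms(3,4) by (intro add_mono mult_right_mono)
  also have "\<dots> = ?p * (real (card (alive M)) * (1 - \<delta>) * P + weight M * (1 + 8 / N) * Q)"
  proof -
    have "x * y * P + x * z * Q = x * (y * P + z * Q)" for x y z by (simp add: algebra_simps)
    then show ?thesis .
  qed
  finally have sum: "(\<Sum>e\<in>pairs M. real (card (alive (add M e))) * P + weight (add M e) * Q)
      \<le> ?p * (real (card (alive M)) * (1 - \<delta>) * P + weight M * (1 + 8 / N) * Q)"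
    by (simp only: sum.distrib sum_distrib_right)
  have "\<exists>e\<in>pairs M. real (card (alive (add M e))) * P + weight (add M e) * Q
      \<le> real (card (alive M)) * (1 - \<delta>) * P + weight M * (1 + 8 / N) * Q"
  proof (rule ccontr)
    assume "\<not> ?thesis"
    moreover have "pairs M \<noteq> {}" using p0 by auto
    ultimately have "(\<Sum>e\<in>pairs M. real (card (alive M)) * (1 - \<delta>) * P + weight M * (1 + 8 / N) * Q)
        < (\<Sum>e\<in>pairs M. real (card (alive (add M e))) * P + weight (add M e) * Q)"
      using finite_pairs by (intro sum_strict_mono) auto
    then show False using sum by simp
  qed
  then show ?thesis using good_add[OF assms(1)] by blast
qed

lemma full_weight: "real (card (full M)) * 2 ^ D \<le> weight M"
proof -
  have "real (card (full M)) * 2 ^ D = (\<Sum>v\<in>full M. 2 ^ D)" by simp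
  also have "\<dots> \<le> (\<Sum>v\<in>full M. 2 ^ card (M `` {v}))"
    by (intro sum_mono power_increasing) (auto simp: full_def)
  also have "\<dots> \<le> weight M" unfolding weight_def using V(1) by (intro sum_mono2) (auto simp: full_def)
  finally show ?thesis .
qed

text \<open>Both quantities are measured against their permitted values after \<open>r\<close>
  steps. Initially each ratio is at most 1, and \<open>greedy_step\<close> with matching
  \<open>P\<close> and \<open>Q\<close> never increases the sum.\<close>

lemma greedy_iteration:
  assumes A0: "real (card family) \<le> A0" "A0 > 0" and full: "8 * (1 + 8 / N) ^ R \<le> 2 ^ D" and r: "r \<le> R"
  shows "\<exists>M. good M \<and> real (card (alive M)) * (1 / ((1 - \<delta>) ^ r * A0)) + weight M * (1 / ((1 + 8 / N) ^ r * N)) \<le> 2"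
  using r
proof (induction r)
  case 0
  have "good {}" using B_free by (auto simp: good_def sym_def)
  moreover have "card (alive {}) \<le> card family" using finite_family by (intro card_mono) (auto simp: alive_def)
  then have "real (card (alive {})) \<le> A0" using A0(1) by linarith
  then have l1: "real (card (alive {})) * (1 / ((1 - \<delta>) ^ 0 * A0)) \<le> 1" using A0(2) by simp
  have l2: "weight {} * (1 / ((1 + 8 / N) ^ 0 * N)) = 1" using N_pos by (simp add: weight_def N_def)
  from add_mono[OF l1 eq_refl[OF l2], unfolded one_add_one]
  show ?case using \<open>good {}\<close> by blast
next
  case (Suc r)
  define x where "x = 1 - \<delta>"
  define y where "y = 1 + 8 / N"
  have xy: "x > 0" "y \<ge> 1" using \<delta> N_pos by (simp_all add: x_def y_def)
  obtain M where M: "good M" "real (card (alive M)) * (1 / (x ^ r * A0)) + weight M * (1 / (y ^ r * N)) \<le> 2"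
    using Suc unfolding x_def y_def by auto
  \<comment> \<open>The weight's share alone is at most 2. With \<open>full\<close> this keeps at
    most a quarter of the vertices full, as \<open>greedy_step\<close> requires.\<close>
  have "weight M * (1 / (y ^ r * N)) \<le> 2"
  proof -
    have "0 \<le> real (card (alive M)) * (1 / (x ^ r * A0))" using xy A0 by simp
    then show ?thesis using M(2) by linarith
  qed
  then have "weight M \<le> 2 * (y ^ r * N)" using xy N_pos by (simp add: field_simps)
  also have "\<dots> \<le> 2 * (y ^ R * N)"
    using xy N_pos Suc.prems by (intro mult_left_mono mult_right_mono power_increasing) auto
  finally have "real (card (full M)) * 2 ^ D \<le> 2 * (y ^ R * N)" using full_weight[of M] by linarith
  also have "4 * \<dots> = (8 * y ^ R) * N" by simp
  also have "\<dots> \<le> 2 ^ D * N" using full N_pos unfolding y_def by (intro mult_right_mono) auto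
  finally have "4 * real (card (full M)) \<le> N" by simp
  then have "4 * card (full M) \<le> card V" unfolding N_def by linarith
  from greedy_step[OF M(1) this, of "1 / (x ^ Suc r * A0)" "1 / (y ^ Suc r * N)"]
  obtain M' where M': "good M'" "real (card (alive M')) * (1 / (x ^ Suc r * A0)) + weight M' * (1 / (y ^ Suc r * N))
      \<le> real (card (alive M)) * x * (1 / (x ^ Suc r * A0)) + weight M * y * (1 / (y ^ Suc r * N))"
    using xy A0 N_pos unfolding x_def y_def by auto
  have e1: "real (card (alive M)) * x * (1 / (x ^ Suc r * A0)) = real (card (alive M)) * (1 / (x ^ r * A0))"
    using xy A0 by simp
  have e2: "weight M * y * (1 / (y ^ Suc r * N)) = weight M * (1 / (y ^ r * N))"
    using xy N_pos by simp
  have "real (card (alive M')) * (1 / (x ^ Suc r * A0)) + weight M' * (1 / (y ^ Suc r * N)) \<le> 2"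
    using M(2) M'(2) unfolding e1 e2 by linarith
  then show ?case using M'(1) unfolding x_def y_def by blast
qed

lemma greedy_result:
  assumes A0: "real (card family) \<le> A0" "A0 > 0" and full: "8 * (1 + 8 / N) ^ R \<le> 2 ^ D"
    and kill: "2 * (1 - \<delta>) ^ R * A0 < 1"
  shows "\<exists>M. good M \<and> alive M = {} \<and> real (card (full M)) * 2 ^ D \<le> 2 * (1 + 8 / N) ^ R * N"
proof -
  obtain M where M: "good M"
    "real (card (alive M)) * (1 / ((1 - \<delta>) ^ R * A0)) + weight M * (1 / ((1 + 8 / N) ^ R * N)) \<le> 2"
    using greedy_iteration[OF A0 full order_refl] by blast
  have w0: "weight M \<ge> 0" by (simp add: weight_def sum_nonneg)
  have y: "(1 + 8 / N) ^ R > 0" using N_pos by (intro zero_less_power) (simp add: add_pos_pos)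
  have x: "(1 - \<delta>) ^ R > 0" using \<delta> by simp
  have t: "0 \<le> real (card (alive M)) * (1 / ((1 - \<delta>) ^ R * A0))" "0 \<le> weight M * (1 / ((1 + 8 / N) ^ R * N))"
    using w0 x y A0 N_pos by (simp_all add: less_imp_le)
  then have "real (card (alive M)) * (1 / ((1 - \<delta>) ^ R * A0)) \<le> 2" "weight M * (1 / ((1 + 8 / N) ^ R * N)) \<le> 2"
    using M(2) by linarith+
  then have "real (card (alive M)) \<le> 2 * ((1 - \<delta>) ^ R * A0)" and w: "weight M \<le> 2 * ((1 + 8 / N) ^ R * N)"
    using x y A0 N_pos by (simp_all add: pos_divide_le_eq)
  then have "card (alive M) = 0" using kill by simp
  moreover have "finite (alive M)" using finite_family by (simp add: alive_def)
  ultimately have "alive M = {}" by simp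
  then show ?thesis using M(1) w full_weight[of M] by (intro exI[of _ M]) simp
qed

end

section \<open>The lower bound\<close>

lemma relpow_trans: "(x, y) \<in> A ^^ m \<Longrightarrow> (y, z) \<in> A ^^ n \<Longrightarrow> (x, z) \<in> A ^^ (m + n)" for A :: "('a \<times> 'a) set"
  by (auto simp: relpow_add)

lemma relpow_Image_subset: "A \<subseteq> V \<times> V \<Longrightarrow> v \<in> V \<Longrightarrow> (A ^^ n) `` {v} \<subseteq> V" for A :: "('a \<times> 'a) set"
  by (cases n) auto

lemma F_mono:
  assumes "d \<le> d'"
  shows "F t d \<le> F t d'"
proof -
  obtain G :: "nat pair_pre_digraph" where G: "admissible t d G" "chromatic_number (graph_power G t) = F t d"
    using F_attained by blast
  have "admissible t d' G" using G(1) assms by (auto simp: admissible_def max_degree_le_def intro: le_trans)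
  then show ?thesis using F_greatest[of t d' G] G(2) by simp
qed

lemma proper_colouring_chromatic_number:
  assumes "proper_colouring G k f"
  shows "\<exists>f. proper_colouring G (chromatic_number G) f"
  unfolding chromatic_number_def by (rule LeastI_ex) (use assms in blast)

text \<open>On \<open>s * L\<close> vertices, if each colour occurs at most \<open>s\<close> times
  within a set \<open>W\<close> holding half of them, then at least \<open>L / 2\<close> colours are
  needed. \<open>h1\<close> keeps full vertices rare and \<open>h2\<close> lets the killing outweigh
  the number of candidate sets. The degree is \<open>2 * D\<close> because \<open>B\<close> and
  \<open>M\<close> contribute up to \<open>D\<close> each.\<close>

lemma F_ge:
  fixes t D L :: nat
  assumes t: "t \<ge> 2" and D: "D \<ge> 2 * t" and L: "D ^ (t - 1) \<le> L" and lnD: "ln D \<ge> 1"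
    and h1: "16 * real D ^ t * exp (D / 4) \<le> 2 ^ D"
    and h2: "real L * (64 * 2 ^ (t - 1) * (real t + 3) * ln D) \<le> real D ^ t"
  shows "real L / 2 \<le> real (F t (2 * D))"
proof -
  define g where "g = 2 * t + 2"
  \<comment> \<open>An even split of \<open>t - 1\<close>: spheres of radius at most
    \<open>b\<close> around vertices at distance above \<open>t\<close> are disjoint because
    \<open>2 * b \<le> t\<close>.\<close>
  define a where "a = (t - 1) div 2"
  define b where "b = t - 1 - a"
  have ab: "a + b = t - 1" "a \<le> b" "2 * b \<le> t" "b \<le> t - 1" "a \<le> t" "b \<le> t" using t by (auto simp: a_def b_def)
  have D1: "D \<ge> 1" and g2: "g \<ge> 2" using D t by (auto simp: g_def)
  have L1: "L \<ge> 1" using L D1 by (meson le_trans one_le_power)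
  define K where "K = g * (2 * D) ^ g"
  define u where "u = (g * D ^ g) * ((b + 1) * D ^ (b + 1))"
  \<comment> \<open>\<open>s'\<close> dominates the exceptional sets: balls of at most
    \<open>K\<close> near vertices and at most \<open>u\<close> vertices in \<open>Bad\<close>. The
    factor 32 in \<open>s\<close> yields \<open>R = N * D / 32\<close>, so the weight bound grows by
    at most \<open>exp (D / 4)\<close>.\<close>
  define s' where "s' = 4 * K + 4 * u + 1"
  define s where "s = 32 * s'"
  define V where "V = {..<s * L}"
  have cV: "card V = s * L" and finV: "finite V" by (simp_all add: V_def)
  have s0: "s > 0" by (simp add: s_def s'_def)
  have s'V: "s' \<le> card V"
  proof -
    have "s' * 1 \<le> s * L" using L1 by (intro mult_mono) (auto simp: s_def)
    then show ?thesis by (simp add: cV)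
  qed
  obtain B where B: "B \<subseteq> V \<times> V" "sym B" "\<And>v. (v, v) \<notin> B" "short_cycle_free g B" "\<And>v. card (B `` {v}) \<le> D"
    "card {v \<in> V. card (B `` {v}) < D} \<le> g * D ^ g"
    using almost_regular_graph[OF finV g2 D1] by blast
  let ?U = "{v \<in> V. card (B `` {v}) < D}"
  have Bim: "finite ((B ^^ n) `` {x}) \<and> card ((B ^^ n) `` {x}) \<le> D ^ n" for n x
    by (rule relpow_Image[OF finV B(1) B(5)])
  have walk_sym: "(y, x) \<in> B ^^ n" if "(x, y) \<in> B ^^ n" for x y n using sym_relpow[OF B(2), of n] that by (auto dest: symD)
  \<comment> \<open>Outside \<open>Bad\<close> no vertex of deficient degree is met within
    \<open>b\<close> steps, so all spheres of radius \<open>j \<le> b\<close> have at least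
    \<open>(D - b) ^ j\<close> elements.\<close>
  define Bad where "Bad = (\<Union>w\<in>?U. \<Union>n<b + 1. (B ^^ n) `` {w})"
  define V0 where "V0 = V - Bad"
  have bad: "finite Bad \<and> card Bad \<le> u"
  proof -
    have *: "finite (\<Union>n<b + 1. (B ^^ n) `` {w}) \<and> card (\<Union>n<b + 1. (B ^^ n) `` {w}) \<le> (b + 1) * D ^ (b + 1)" for w
      by (rule card_short_walk_ends_le[OF finV B(1) B(5) D1])
    have "card Bad \<le> (\<Sum>w\<in>?U. card (\<Union>n<b + 1. (B ^^ n) `` {w}))"
      unfolding Bad_def using finV by (intro card_UN_le) simp
    also have "\<dots> \<le> (\<Sum>w\<in>?U. (b + 1) * D ^ (b + 1))" by (intro sum_mono conjunct2[OF *])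
    also have "\<dots> \<le> u" unfolding u_def using B(6) by (simp only: sum_constant of_nat_id) (rule mult_right_mono, simp_all)
    finally show ?thesis unfolding Bad_def using finV * by auto
  qed
  have reach: "D \<le> card (B `` {w})" if "v \<in> V0" "n \<le> b" "(v, w) \<in> B ^^ n" for v w n
  proof (rule ccontr)
    assume "\<not> ?thesis"
    moreover have "w \<in> V" using relpow_Image_subset[OF B(1), of v n] that(1,3) by (auto simp: V0_def)
    ultimately have "w \<in> ?U" by simp
    then have "v \<in> Bad" using walk_sym[OF that(3)] that(2) unfolding Bad_def by (intro UN_I[of w] UN_I[of n]) auto
    then show False using that(1) by (simp add: V0_def)
  qed
  have ends_V: "ends_from B j v \<subseteq> V" if "v \<in> V0" for j v
    using ends_from_relpow[of B j v] relpow_Image_subset[OF B(1), of v j] that by (auto simp: V0_def)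
  have ends_card: "(D - b) ^ j \<le> card (ends_from B j v)" if "v \<in> V0" "j \<le> b" for j v
  proof -
    have "(D - b) ^ j \<le> (D - j) ^ j" using that by (intro power_mono) auto
    also have "\<dots> \<le> card (ends_from B j v)"
      using that ab(3) by (intro card_ends_from_ge[OF finV B(1,2,4)] reach[of v]) (auto simp: g_def)
    finally show ?thesis .
  qed
  define \<alpha> where "\<alpha> = (D - b) ^ a"
  define \<beta> where "\<beta> = (D - b) ^ b"
  have Db: "D - b > 0" "D \<le> 2 * (D - b)" using D ab t by auto
  have pow_le: "(D - b) ^ j \<le> L" if "j \<le> t - 1" for j
  proof -
    have "(D - b) ^ j \<le> D ^ j" by (intro power_mono) auto
    also have "\<dots> \<le> D ^ (t - 1)" using that D1 by (intro power_increasing) auto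
    finally show ?thesis using L by linarith
  qed
  interpret greedy_construction V V0 B "ends_from B a" "ends_from B b" D g K s \<alpha> \<beta>
  proof
    show "finite V" "B \<subseteq> V \<times> V" "V0 \<subseteq> V" "sym B" "short_cycle_free g B" "card (B `` {v}) \<le> D" for v
      using finV B by (auto simp: V0_def)
    show "ends_from B a v \<subseteq> V" "ends_from B b v \<subseteq> V" if "v \<in> V0" for v using ends_V that by auto
    show "\<alpha> \<le> card (ends_from B a v)" "\<beta> \<le> card (ends_from B b v)" if "v \<in> V0" for v
      using ends_card that ab(2) by (auto simp: \<alpha>_def \<beta>_def)
    show "2 \<le> g" "1 \<le> D" "g * (2 * D) ^ g \<le> K" "0 < s" by (fact g2 D1 s0 | simp add: K_def)+
    show "4 * K \<le> card V" using s'V by (simp add: s'_def)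
    show "0 < \<alpha>" "0 < \<beta>" using Db by (simp_all add: \<alpha>_def \<beta>_def)
    have "2 * K \<le> s * 1" by (simp add: s_def s'_def)
    also have "\<dots> \<le> s * \<beta>" using \<open>0 < \<beta>\<close> by (intro mult_left_mono) auto
    finally show "2 * K \<le> s * \<beta>" .
    show "s * \<alpha> \<le> card V" "s * \<beta> \<le> card V"
      using pow_le[of a] pow_le[of b] ab by (simp_all add: \<alpha>_def \<beta>_def cV)
  qed
  \<comment> \<open>\<open>R\<close> is the number of greedy steps, and \<open>A0\<close> bounds the
    number of \<open>s\<close>-subsets of the \<open>s * L\<close> vertices.\<close>
  define R where "R = s' * L * D"
  define A0 where "A0 = (exp 1 * real L) ^ s"
  have NsL: "N = real s * real L" by (simp add: N_def cV)
  have y: "(1 + 8 / N) ^ R \<le> exp (D / 4)"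
  proof -
    have "(1 + 8 / N) ^ R \<le> exp (8 / N) ^ R" using N_pos by (intro power_mono) (auto simp: add.commute)
    also have "\<dots> = exp (real R * (8 / N))" by (simp flip: exp_of_nat_mult)
    also have "real R * (8 / N) = D / 4"
    proof -
      have "real s' > 0" "real L > 0" using L1 by (simp_all add: s'_def)
      then show ?thesis by (simp add: R_def NsL s_def)
    qed
    finally show ?thesis .
  qed
  have Dt1: "1 \<le> real D ^ t" using D1 by simp
  have full_cond: "8 * (1 + 8 / N) ^ R \<le> 2 ^ D"
  proof -
    have "0 \<le> (1 + 8 / N) ^ R" using N_pos by (intro zero_le_power) simp
    then have "8 * (1 + 8 / N) ^ R \<le> (16 * real D ^ t) * exp (D / 4)"
      using y Dt1 by (intro mult_mono) simp_all
    then show ?thesis using h1 by linarith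
  qed
  have A0: "real (card family) \<le> A0" "A0 > 0"
  proof -
    have "card family \<le> card {S. S \<subseteq> V \<and> card S = s}"
    proof (rule card_mono)
      show "family \<subseteq> {S. S \<subseteq> V \<and> card S = s}"
        using V(3) unfolding family_def by blast
    qed (use finV in simp)
    also have "\<dots> = (s * L) choose s" using finV by (simp add: n_subsets cV)
    finally have "real (card family) \<le> real ((s * L) choose s)" by (rule of_nat_mono)
    also have "\<dots> \<le> (exp 1 * real (s * L) / s) ^ s" by (rule binomial_le_exp[OF s0])
    also have "exp 1 * real (s * L) / s = exp 1 * real L" using s0 by simp
    finally show "real (card family) \<le> A0" by (simp add: A0_def)
    show "A0 > 0" using L1 by (simp add: A0_def)
  qed
  \<comment> \<open>\<open>R * \<delta>\<close> is at least \<open>s * (t + 3) * ln D\<close>, while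
    \<open>2 * A0\<close> is at most \<open>exp (s + s * (1 + ln L))\<close> with
    \<open>ln L \<le> t * ln D\<close>. The sum of the exponents is at most
    \<open>s * (2 - 3 * ln D)\<close>, negative as \<open>ln D \<ge> 1\<close>.\<close>
  have kill: "2 * (1 - \<delta>) ^ R * A0 < 1"
  proof -
    have "(1 - \<delta>) ^ R \<le> exp (- \<delta>) ^ R"
      using \<delta> exp_ge_add_one_self[of "- \<delta>"] by (intro power_mono) auto
    also have "\<dots> = exp (- (real R * \<delta>))" by (simp flip: exp_of_nat_mult)
    finally have 1: "(1 - \<delta>) ^ R \<le> exp (- (real R * \<delta>))" .
    have Rd: "real R * \<delta> = real s * (real (\<alpha> * \<beta>) * real D) / (64 * real L)"
    proof -
      have "real R = real s * real L * real D / 32" by (simp add: R_def s_def)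
      then show ?thesis using s0 L1 by (simp add: \<delta>_def NsL power2_eq_square field_simps)
    qed
    have "(real D / 2) ^ (t - 1) \<le> real (\<alpha> * \<beta>)"
    proof -
      have "(real D / 2) ^ (t - 1) \<le> real (D - b) ^ (t - 1)" using Db(2) by (intro power_mono) auto
      also have "\<dots> = real (\<alpha> * \<beta>)" using ab(1) by (simp add: \<alpha>_def \<beta>_def flip: power_add)
      finally show ?thesis .
    qed
    then have "(real D / 2) ^ (t - 1) * real D \<le> real (\<alpha> * \<beta>) * real D" by (rule mult_right_mono) simp
    moreover have "(real D / 2) ^ (t - 1) * real D = real D ^ t / 2 ^ (t - 1)"
      using t by (cases t) (simp_all add: power_divide)
    ultimately have ab_ge: "real D ^ t / 2 ^ (t - 1) \<le> real (\<alpha> * \<beta>) * real D" by simp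
    have "64 * real L * ((real t + 3) * ln D) = real L * (64 * 2 ^ (t - 1) * (real t + 3) * ln D) / 2 ^ (t - 1)" by simp
    also have "\<dots> \<le> real D ^ t / 2 ^ (t - 1)" using h2 by (intro divide_right_mono) auto
    also note ab_ge
    finally have "(real t + 3) * ln D \<le> real (\<alpha> * \<beta>) * real D / (64 * real L)"
      using L1 by (simp add: pos_le_divide_eq mult.commute)
    then have "real s * ((real t + 3) * ln D) \<le> real s * (real (\<alpha> * \<beta>) * real D / (64 * real L))"
      by (rule mult_left_mono) simp
    then have 2: "real s * ((real t + 3) * ln D) \<le> real R * \<delta>" unfolding Rd by simp
    have lnL: "ln L \<le> t * ln D"
    proof -
      have c: "1 \<le> 64 * 2 ^ (t - 1) * (real t + 3) * ln D"
      proof -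
        have "1 * 1 * 1 * 1 \<le> 64 * 2 ^ (t - 1) * (real t + 3) * ln D" using lnD by (intro mult_mono) auto
        then show ?thesis by simp
      qed
      have "real L * 1 \<le> real L * (64 * 2 ^ (t - 1) * (real t + 3) * ln D)" by (intro mult_left_mono c) simp
      then have "real L \<le> real D ^ t" using h2 by (metis mult_1_right order_trans)
      then have "ln (real L) \<le> ln (real D ^ t)" using L1 D1 by (subst ln_le_cancel_iff) auto
      then show ?thesis using D1 by (simp add: ln_realpow)
    qed
    have A0e: "A0 = exp (real s * (1 + ln L))"
      using L1 by (simp add: A0_def exp_add exp_of_nat_mult)
    have "2 \<le> exp (real s)" using exp_ge_add_one_self[of "real s"] s0 by linarith
    then have "2 * (1 - \<delta>) ^ R * A0 \<le> exp (real s) * exp (- (real R * \<delta>)) * exp (real s * (1 + ln L))"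
      unfolding A0e using 1 \<delta> by (intro mult_mono) auto
    also have "\<dots> = exp (real s - real R * \<delta> + real s * (1 + ln L))" by (simp flip: exp_add)
    also have "\<dots> \<le> exp (real s - real s * ((real t + 3) * ln D) + real s * (1 + real t * ln D))"
    proof -
      have "real s * (1 + ln L) \<le> real s * (1 + real t * ln D)" using lnL by (intro mult_left_mono) auto
      then show ?thesis using 2 by simp
    qed
    also have "\<dots> = exp (real s * (2 - 3 * ln D))" by (simp add: algebra_simps)
    also have "\<dots> < 1" using s0 lnD by (simp add: mult_pos_neg)
    finally show ?thesis .
  qed
  obtain M where M: "good M" "alive M = {}" and fullM: "real (card (full M)) * 2 ^ D \<le> 2 * (1 + 8 / N) ^ R * N"
    using greedy_result[OF A0 full_cond kill] by blast
  have M_props: "M \<subseteq> V \<times> V" "sym M" "\<And>v. card (M `` {v}) \<le> D" "short_cycle_free g (B \<union> M)"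
    "\<And>x y n. (x, y) \<in> M \<Longrightarrow> n < g \<Longrightarrow> (x, y) \<notin> B ^^ n" using M(1) unfolding good_def by blast+
  have full8: "8 * (card (full M) * D ^ t) \<le> card V"
  proof -
    have "real (card (full M)) * (16 * real D ^ t * exp (D / 4)) \<le> real (card (full M)) * 2 ^ D"
      using h1 by (intro mult_left_mono) auto
    also note fullM
    also have "2 * (1 + 8 / N) ^ R * N \<le> 2 * exp (D / 4) * N"
      using N_pos by (intro mult_right_mono mult_left_mono y) simp_all
    finally have "real (card (full M)) * real D ^ t * 8 * (2 * exp (D / 4)) \<le> N * (2 * exp (D / 4))"
      by (simp add: mult_ac)
    then have "real (card (full M)) * real D ^ t * 8 \<le> N" by (rule mult_right_le_imp_le) simp
    then have "real (8 * (card (full M) * D ^ t)) \<le> real (card V)" by (simp add: N_def mult_ac)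
    then show ?thesis by (simp only: of_nat_le_iff)
  qed
  \<comment> \<open>The spheres of a candidate set inside \<open>W\<close> avoid all full vertices,
    so it can fail to be alive only through a new edge between its spheres.\<close>
  define W where "W = {v \<in> V0. ends_from B a v \<inter> full M = {} \<and> ends_from B b v \<inter> full M = {}}"
  have finfull: "finite (full M)" using finV by (simp add: full_def)
  have W_large: "card V \<le> 2 * card W"
  proof -
    \<comment> \<open>By symmetry of walks, a full vertex \<open>w\<close> spoils only vertices
      within \<open>a\<close> or \<open>b\<close> steps of \<open>w\<close>, at most
      \<open>2 * D ^ t\<close> of them.\<close>
    let ?C = "\<Union>w\<in>full M. (B ^^ a) `` {w} \<union> (B ^^ b) `` {w}"
    have "V \<subseteq> W \<union> Bad \<union> ?C"
    proof
      fix v assume v: "v \<in> V"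
      show "v \<in> W \<union> Bad \<union> ?C"
      proof (cases "v \<in> Bad \<or> v \<in> W")
        case False
        then obtain w where "w \<in> full M" "w \<in> ends_from B a v \<or> w \<in> ends_from B b v"
          using v by (auto simp: W_def V0_def)
        then have "(v, w) \<in> B ^^ a \<or> (v, w) \<in> B ^^ b" using ends_from_relpow[of B] by blast
        then have "(w, v) \<in> B ^^ a \<or> (w, v) \<in> B ^^ b" using walk_sym by blast
        then show ?thesis using \<open>w \<in> full M\<close> by blast
      qed auto
    qed
    moreover have finW: "finite W" using finV by (auto simp: W_def V0_def)
    moreover have finC: "finite ?C" using finfull Bim by auto
    ultimately have "card V \<le> card (W \<union> Bad \<union> ?C)" using bad by (intro card_mono) auto
    also have "\<dots> \<le> card W + card Bad + card ?C"
      using card_Un_le[of "W \<union> Bad" ?C] card_Un_le[of W Bad] by linarith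
    also have "card ?C \<le> (\<Sum>w\<in>full M. card ((B ^^ a) `` {w} \<union> (B ^^ b) `` {w}))" by (rule card_UN_le[OF finfull])
    also have "\<dots> \<le> (\<Sum>w\<in>full M. 2 * D ^ t)"
    proof (intro sum_mono)
      fix w
      have "D ^ a \<le> D ^ t" "D ^ b \<le> D ^ t" using ab D1 by (auto intro: power_increasing)
      then show "card ((B ^^ a) `` {w} \<union> (B ^^ b) `` {w}) \<le> 2 * D ^ t"
        using card_Un_le[of "(B ^^ a) `` {w}" "(B ^^ b) `` {w}"] Bim[of a w] Bim[of b w] by linarith
    qed
    also have "\<dots> = 2 * (card (full M) * D ^ t)" by simp
    finally have "card V \<le> card W + card Bad + 2 * (card (full M) * D ^ t)" by simp
    moreover have "4 * card Bad \<le> card V" using bad s'V by (simp add: s'_def)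
    ultimately show ?thesis using full8 by linarith
  qed
  define G where "G = \<lparr> pverts = V, parcs = B \<union> M \<rparr>"
  have M_irr: "(x, x) \<notin> M" for x using M_props(5)[of x x 0] g2 by auto
  have G: "pair_graph G"
  proof
    show "fst e \<in> pverts G" "snd e \<in> pverts G" if "e \<in> parcs G" for e
      using that B(1) M_props(1) by (auto simp: G_def)
    show "finite (pverts G)" by (simp add: G_def finV)
    show "finite (parcs G)" using finite_subset[of "B \<union> M" "V \<times> V"] B(1) M_props(1) finV by (simp add: G_def)
    show "fst e \<noteq> snd e" if "e \<in> parcs G" for e using that B(3) M_irr by (cases e) (auto simp: G_def)
    show "symmetric (with_proj G)" using B(2) M_props(2) by (auto simp: symmetric_def G_def sym_def)
  qed
  have deg: "max_degree_le G (2 * D)"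
    unfolding max_degree_le_def out_degree_eq[OF G]
  proof
    fix v
    have "card (parcs G `` {v}) \<le> card (B `` {v}) + card (M `` {v})"
      unfolding G_def by (simp add: Un_Image card_Un_le)
    then show "card (parcs G `` {v}) \<le> 2 * D" using B(5)[of v] M_props(3)[of v] by linarith
  qed
  have "\<not> has_cycle_of_length G l" if "l \<in> forbidden_lengths t" for l
  proof
    assume "has_cycle_of_length G l"
    moreover have l: "3 \<le> l" "l \<le> g" using that t by (auto simp: forbidden_lengths_def g_def split: if_splits)
    ultimately obtain xs where "cyc (B \<union> M) xs" "length xs = l"
      using cyc_of_has_cycle[OF G] by (auto simp: G_def)
    then show False using M_props(4) l(2) unfolding short_cycle_free_def by auto
  qed
  then have adm: "admissible t (2 * D) G" using G deg by (simp add: admissible_def)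
  have arcs: "(x, y) \<in> parcs (graph_power G t)" if "x \<in> V" "y \<in> V" "x \<noteq> y" "n \<le> t" "(x, y) \<in> (B \<union> M) ^^ n" for x y n
    unfolding parcs_graph_power[OF G] using that by (auto simp: G_def)
  let ?k = "chromatic_number (graph_power G t)"
  have "proper_colouring (graph_power G t) (s * L) id"
    unfolding proper_colouring_def by (auto simp: graph_power_def G_def V_def)
  then obtain f where f: "\<And>v. v \<in> V \<Longrightarrow> f v < ?k" "\<And>x y. (x, y) \<in> parcs (graph_power G t) \<Longrightarrow> f x \<noteq> f y"
  proof -
    obtain f where "proper_colouring (graph_power G t) ?k f"
      using proper_colouring_chromatic_number[OF \<open>proper_colouring (graph_power G t) (s * L) id\<close>] by blast
    moreover have "pverts (graph_power G t) = V" by (simp add: graph_power_def G_def)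
    ultimately show thesis using that[of f] unfolding proper_colouring_def by blast
  qed
  \<comment> \<open>A larger class would contain an \<open>s\<close>-set independent in the power.
    Its spheres are disjoint, so it belongs to \<open>family\<close>; being dead, it has a new edge
    from the \<open>a\<close>-sphere of some \<open>v\<close> to the \<open>b\<close>-sphere of some
    \<open>w\<close>, and a walk of length \<open>a + 1 + b = t\<close> would join \<open>v\<close>
    to \<open>w\<close>.\<close>
  have small: "card {v \<in> W. f v = c} \<le> s" for c
  proof (rule ccontr)
    assume "\<not> ?thesis"
    then have "s \<le> card {v \<in> W. f v = c}" by simp
    then obtain S where S: "S \<subseteq> {v \<in> W. f v = c}" "card S = s" by (metis obtain_subset_with_card_n)
    have SV: "v \<in> V" "v \<in> V0" "v \<in> W" if "v \<in> S" for v using S(1) that by (auto simp: W_def V0_def)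
    have indep: "(x, y) \<notin> (B \<union> M) ^^ n" if "x \<in> S" "y \<in> S" "x \<noteq> y" "n \<le> t" for x y n
    proof
      assume "(x, y) \<in> (B \<union> M) ^^ n"
      then have "f x \<noteq> f y" using arcs SV that by (intro f(2)) blast
      then show False using S(1) that by auto
    qed
    have BM: "(x, y) \<in> (B \<union> M) ^^ n" if "(x, y) \<in> B ^^ n" for x y n
      using relpow_subset_mono[of B "B \<union> M" n] that by blast
    have ends: "(v, x) \<in> B ^^ j" "(x, v) \<in> B ^^ j" if "x \<in> ends_from B j v" for x v j
    proof -
      show "(v, x) \<in> B ^^ j" using ends_from_relpow[of B j v] that by blast
      then show "(x, v) \<in> B ^^ j" by (rule walk_sym)
    qed
    have disj: "disjoint_family_on (ends_from B j) S" if j: "2 * j \<le> t" for j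
      unfolding disjoint_family_on_def
    proof (intro ballI impI)
      fix v w assume vw: "v \<in> S" "w \<in> S" "v \<noteq> w"
      show "ends_from B j v \<inter> ends_from B j w = {}"
      proof (rule ccontr)
        assume "ends_from B j v \<inter> ends_from B j w \<noteq> {}"
        then obtain x where "x \<in> ends_from B j v" "x \<in> ends_from B j w" by blast
        then have "(v, w) \<in> B ^^ (j + j)" using ends relpow_trans by metis
        then show False using indep[OF vw, of "j + j"] BM j by simp
      qed
    qed
    have "2 * a \<le> t" using ab by simp
    then have "S \<in> family" using S disj[of a] disj[of b] ab(3) SV by (auto simp: family_def)
    moreover have "UA S \<inter> full M = {}" "UB S \<inter> full M = {}" using SV(3) by (auto simp: UA_def UB_def W_def)
    ultimately have "M \<inter> UA S \<times> UB S \<noteq> {}" using M(2) by (auto simp: alive_def)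
    then obtain x y v w where xy: "(x, y) \<in> M" "v \<in> S" "w \<in> S" "x \<in> ends_from B a v" "y \<in> ends_from B b w"
      by (auto simp: UA_def UB_def)
    show False
    proof (cases "v = w")
      \<comment> \<open>For \<open>v = w\<close> the ends of the new edge are
        \<open>a + b < g\<close> steps apart in \<open>B\<close>, contrary to the choice of new
        edges.\<close>
      case True
      then have "(x, y) \<in> B ^^ (a + b)" using ends(2)[OF xy(4)] ends(1)[OF xy(5)] relpow_trans by metis
      moreover have "a + b < g" using ab(1) by (simp add: g_def)
      ultimately show False using M_props(5)[OF xy(1)] by blast
    next
      case False
      have "(v, x) \<in> (B \<union> M) ^^ a" "(y, w) \<in> (B \<union> M) ^^ b"
        using BM ends(1)[OF xy(4)] ends(2)[OF xy(5)] by blast+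
      moreover have "(x, y) \<in> (B \<union> M) ^^ 1" using xy(1) by simp
      ultimately have "(v, w) \<in> (B \<union> M) ^^ (a + 1 + b)" using relpow_trans by metis
      then show False using indep[OF xy(2,3) False, of "a + 1 + b"] ab(1) t by simp
    qed
  qed
  have "card W \<le> card (\<Union>c<?k. {v \<in> W. f v = c})"
    using finV f(1) by (intro card_mono) (auto simp: W_def V0_def)
  also have "\<dots> \<le> (\<Sum>c<?k. card {v \<in> W. f v = c})" by (rule card_UN_le) simp
  also have "\<dots> \<le> (\<Sum>c<?k. s)" by (intro sum_mono small)
  finally have "card W \<le> ?k * s" by simp
  then have "s * L \<le> 2 * (?k * s)" using W_large cV by linarith
  also have "\<dots> = s * (2 * ?k)" by (simp only: mult_ac)
  finally have "L \<le> 2 * ?k" using s0 by simp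
  moreover have "?k \<le> F t (2 * D)" by (rule F_greatest[OF adm])
  ultimately show ?thesis by linarith
qed

text \<open>\<open>L\<close> is taken as the largest integer that \<open>h2\<close> permits. The
  construction produces degree \<open>2 * D\<close>, so it is used with \<open>D = d div 2\<close>,
  and monotonicity of \<open>F\<close> covers odd \<open>d\<close>.\<close>

lemma F_lower:
  assumes t: "t \<ge> 2"
  shows "\<exists>c>0. \<forall>\<^sub>F d in sequentially. c * (real d ^ t / ln (real d)) \<le> real (F t d)"
proof -
  define c1 :: real where "c1 = 64 * 2 ^ (t - 1) * (real t + 3)"
  have c1: "c1 > 0" by (simp add: c1_def)
  \<comment> \<open>Since \<open>exp (1 / 4) \<le> 3 / 2\<close> and
    \<open>4 / 3 * (3 / 2) = 2\<close>, a factor \<open>(4 / 3) ^ D\<close> is left to dominate the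
    polynomial.\<close>
  have "((\<lambda>D. 16 * real D ^ t / (4 / 3) ^ D) \<longlongrightarrow> 0) sequentially" by real_asymp
  then have "\<forall>\<^sub>F D in sequentially. 16 * real D ^ t / (4 / 3) ^ D < 1"
    by (rule order_tendstoD) simp
  then have "\<forall>\<^sub>F D in sequentially. 16 * real D ^ t * exp (D / 4) \<le> 2 ^ D"
  proof eventually_elim
    case (elim D)
    have "exp (real D / 4) = exp (1 / 4) ^ D" by (simp flip: exp_of_nat_mult)
    also have "exp (1 / 4 :: real) \<le> 3 / 2" using exp_bound[of "1 / 4"] by (simp add: power2_eq_square)
    then have "exp (1 / 4 :: real) ^ D \<le> (3 / 2) ^ D" by (intro power_mono) auto
    finally have "16 * real D ^ t * exp (real D / 4) \<le> (4 / 3) ^ D * (3 / 2) ^ D"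
      using elim by (intro mult_mono) (auto simp: divide_less_eq)
    also have "\<dots> = 2 ^ D" by (simp flip: power_mult_distrib)
    finally show ?case .
  qed
  moreover have "\<forall>\<^sub>F D in sequentially. ln (real D) \<ge> 1" by real_asymp
  moreover have "\<forall>\<^sub>F D in sequentially. 2 * (c1 * ln (real D)) \<le> real D" by real_asymp
  moreover have "\<forall>\<^sub>F D in sequentially. D \<ge> 2 * t" by (rule eventually_ge_at_top)
  ultimately have "\<forall>\<^sub>F D in sequentially. real D ^ t / (c1 * ln D) / 4 \<le> real (F t (2 * D))"
  proof eventually_elim
    case (elim D)
    define x where "x = real D ^ t / (c1 * ln D)"
    define L where "L = nat \<lfloor>x\<rfloor>"
    have D1: "D \<ge> 1" using elim(4) t by simp
    have cl: "c1 * ln D > 0" using c1 elim(2) by (intro mult_pos_pos) auto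
    have P1: "1 \<le> real D ^ (t - 1)" using D1 by simp
    \<comment> \<open>The extra 1 absorbs the rounding in \<open>L\<close>. The resulting
      \<open>D ^ (t - 1) \<le> L\<close> ensures that the spheres of \<open>s\<close> vertices fit
      into \<open>s * L\<close> vertices.\<close>
    have "(real D ^ (t - 1) + 1) * (c1 * ln D) \<le> (2 * real D ^ (t - 1)) * (c1 * ln D)"
      using P1 cl by (intro mult_right_mono) auto
    also have "\<dots> = real D ^ (t - 1) * (2 * (c1 * ln D))" by simp
    also have "\<dots> \<le> real D ^ (t - 1) * real D" using elim(3) by (intro mult_left_mono) auto
    also have "\<dots> = real D ^ t" using t by (cases t) auto
    finally have x1: "real D ^ (t - 1) + 1 \<le> x" unfolding x_def using cl by (simp add: pos_le_divide_eq)
    then have x2: "x \<ge> 2" using P1 by linarith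
    have Lx: "real L \<le> x" "x - 1 \<le> real L" using x2 by (auto simp: L_def) 
    have "real D ^ (t - 1) \<le> real L" using x1 Lx(2) by linarith
    then have "real (D ^ (t - 1)) \<le> real L" by (simp only: of_nat_power)
    then have "D ^ (t - 1) \<le> L" by (simp only: of_nat_le_iff)
    moreover have "real L * (64 * 2 ^ (t - 1) * (real t + 3) * ln D) \<le> real D ^ t"
    proof -
      have "real L * (c1 * ln D) \<le> x * (c1 * ln D)" using Lx(1) cl by (intro mult_right_mono) auto
      also have "\<dots> = real D ^ t" unfolding x_def by (rule nonzero_eq_divide_eq[THEN iffD1]) (use cl in auto)
      finally show ?thesis by (simp add: c1_def)
    qed
    ultimately have "real L / 2 \<le> real (F t (2 * D))" using F_ge[OF t elim(4)] elim(1,2) by blast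
    moreover have "x / 4 \<le> real L / 2" using Lx(2) x2 by simp
    ultimately show ?case unfolding x_def by linarith
  qed
  moreover have "filterlim (\<lambda>d. d div 2) at_top (sequentially :: nat filter)"
    by (rule filterlim_at_top_div_const_nat) simp
  ultimately have "\<forall>\<^sub>F d in sequentially. real (d div 2) ^ t / (c1 * ln (real (d div 2))) / 4 \<le> real (F t (2 * (d div 2)))"
    by (rule eventually_compose_filterlim)
  moreover have "\<forall>\<^sub>F d in sequentially. d \<ge> (4 :: nat)" by (rule eventually_ge_at_top)
  ultimately have "\<forall>\<^sub>F d in sequentially. (1 / (4 * 3 ^ t * c1)) * (real d ^ t / ln (real d)) \<le> real (F t d)"
  proof eventually_elim
    case (elim d)
    let ?D = "d div 2"
    have D: "real d / 3 \<le> real ?D" "?D \<ge> 2" "?D \<le> d" "2 * ?D \<le> d" using elim(2) by linarith+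
    have ln0: "ln (real ?D) > 0" using D(2) by simp
    have ln: "ln (real ?D) \<le> ln (real d)" using D(2,3) by (subst ln_le_cancel_iff) auto
    have "(1 / (4 * 3 ^ t * c1)) * (real d ^ t / ln (real d)) = (real d / 3) ^ t / (c1 * ln (real d)) / 4"
      by (simp add: power_divide field_simps)
    also have "\<dots> \<le> real ?D ^ t / (c1 * ln (real ?D)) / 4"
      using D(1) ln ln0 c1 by (intro divide_right_mono frac_le power_mono mult_left_mono mult_pos_pos) auto
    also have "\<dots> \<le> real (F t (2 * ?D))" by (rule elim(1))
    also have "\<dots> \<le> real (F t d)" by (intro of_nat_mono F_mono D(4))
    finally show ?case .
  qed
  moreover have "1 / (4 * 3 ^ t * c1) > 0" using c1 by simp
  ultimately show ?thesis by blast
qed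

theorem theorem1:
  fixes t :: nat
  assumes "t \<ge> 2"
  shows "(\<lambda>d. real (F t d)) \<in> \<Theta>(\<lambda>d. real d ^ t / ln (real d))"
proof (rule bigthetaI)
  \<comment> \<open>This includes \<open>d = 1\<close>, where the logarithm vanishes and the
    quotient is 0 by convention.\<close>
  have nonneg: "real d ^ t / ln (real d) \<ge> 0" for d :: nat
    by (cases "d = 0") (auto intro: divide_nonneg_nonneg)
  obtain C where C: "C > 0" "\<forall>\<^sub>F d in sequentially. real (F t d) \<le> C * (real d ^ t / ln (real d))"
    using F_upper[OF assms] by blast
  show "(\<lambda>d. real (F t d)) \<in> O(\<lambda>d. real d ^ t / ln (real d))"
    by (rule bigoI[where c = C]) (use C(2) in \<open>simp only: real_norm_def abs_of_nonneg[OF nonneg] abs_of_nat\<close>)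
  obtain c where c: "c > 0" "\<forall>\<^sub>F d in sequentially. c * (real d ^ t / ln (real d)) \<le> real (F t d)"
    using F_lower[OF assms] by blast
  show "(\<lambda>d. real (F t d)) \<in> \<Omega>(\<lambda>d. real d ^ t / ln (real d))"
    by (rule landau_omega.bigI[OF c(1)]) (use c(2) in \<open>simp only: real_norm_def abs_of_nonneg[OF nonneg] abs_of_nat\<close>)
qed

end
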